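(* Let $A\in C^1([0,1])$ and $B,D,H\in C([0,1])$ be real functions, let $f\in C([0,1])$, and assume that zero is not an eigenvalue of the operator $$L_{cont}u=u^{(4)}+D(x)u^{(3)}+A(x)u^{(2)}+(A'(x)+H(x))u^{(1)}+B(x)u$$ on $[0,1]$ with the boundary conditions $u(0)=u'(0)=u(1)=u'(1)=0$. Let $0<N_1<N_2<\dots<N_k<\dots$ be an increasing sequence of integers and $h_k=1/N_k$. For each $k$ let $\mathfrak{g}^{(k)}\in l^2_{h_k,0}$, with $\mathfrak{g}^{(k)}_x\in l^2_{h_k,0}$, be a solution of the discrete equation (with $h=h_k$, $N=N_k$) $$(\delta_x^4\mathfrak{g}^{(k)})_i+D(x_i)(\delta_x^3\mathfrak{g}^{(k)})_i+A(x_i)(\widetilde{\delta_x^2}\mathfrak{g}^{(k)})_i+(A'(x_i)+H(x_i))(\mathfrak{g}^{(k)}_x)_i+B(x_i)\mathfrak{g}^{(k)}_i=f(x_i),\quad 1\le i\le N_k-1 .$$ Let $\mathfrak{v}^{(k)}=\delta_x^4\mathfrak{g}^{(k)}$ and assume that $\mathfrak{v}^{(k)}_x\in l^2_{h_k,0}$ for all $k$. Assume that $$\sup_{k}|\mathfrak{v}^{(k)}|_{h_k}=\sup_k|\delta_x^4\mathfrak{g}^{(k)}|_{h_k}<\infty .$$ Let $g_{h_k},v_{h_k}$ be the piecewise linear continuous functions on $[0,1]$ corresponding to $\mathfrak{g}^{(k)},\mathfrak{v}^{(k)}$. Then there exist limit functions $g(x),v(x)$ such that, for the whole sequences, $$\lim_{k\to\infty}g_{h_k}=g\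 \text{ in } C([0,1]),\qquad \lim_{k\to\infty}v_{h_k}=v\ \text{ weakly in } L^2(0,1).$$ The limit function $g$ belongs to $H^4(0,1)\cap H^2_0(0,1)$ and satisfies $L_{cont}g=f$ on $[0,1]$.
   Context: Grid: for an integer $N$, $h=1/N$ and $x_j=jh$, $0\le j\le N$. $l^2_h$ is the space of real grid functions $\mathfrak{v}=(\mathfrak{v}_j)_{0\le j\le N}$, with scalar product $(\mathfrak{v},\mathfrak{w})_h=h\sum_{j=0}^N\mathfrak{v}_j\mathfrak{w}_j$ and norm $|\mathfrak{v}|_h=(\mathfrak{v},\mathfrak{v})_h^{1/2}$; $l^2_{h,0}=\{\mathfrak{v}\in l^2_h:\mathfrak{v}_0=\mathfrak{v}_N=0\}$. Basic operators, for $1\le j\le N-1$: $(\delta_x\mathfrak{v})_j=\frac{\mathfrak{v}_{j+1}-\mathfrak{v}_{j-1}}{2h}$, $(\delta_x^2\mathfrak{v})_j=\frac{\mathfrak{v}_{j+1}-2\mathfrak{v}_j+\mathfrak{v}_{j-1}}{h^2}$, $(\sigma_x\mathfrak{v})_j=\frac16\mathfrak{v}_{j-1}+\frac23\mathfrak{v}_j+\frac16\mathfrak{v}_{j+1}$. Hermitian derivative: for $\mathfrak{v}\in l^2_{h,0}$, $\mathfrak{v}_x$ is defined by $(\sigma_x\mathfrak{v}_x)_j=(\delta_x\mathfrak{v})_j$, $1\le j\le N-1$, where the boundary values are taken to be $(\mathfrak{v}_x)_0=(\mathfrak{v}_x)_N=0$, i.e. $\mathfrak{v}_x\in l^2_{h,0}$.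 Higher discrete derivatives, for $1\le j\le N-1$: $(\widetilde{\delta_x^2}\mathfrak{v})_j=2(\delta_x^2\mathfrak{v})_j-(\delta_x\mathfrak{v}_x)_j$; $(\delta_x^4\mathfrak{v})_j=\frac{12}{h^2}\big[(\delta_x\mathfrak{v}_x)_j-(\delta_x^2\mathfrak{v})_j\big]$; $(\delta_x^3\mathfrak{v})_j=2(\delta_x^2\mathfrak{v}_x)_j-(\delta_x\widetilde{\delta_x^2}\mathfrak{v})_j$. The grid function $\delta_x^4\mathfrak{g}$ in the discrete equation (values at interior points) is extended by zero at $x_0,x_N$, so it is regarded as an element of $l^2_{h,0}$. For $j=1,N-1$ the definition of $\delta_x^3\mathfrak{v}$ uses boundary values $(\widetilde{\delta_x^2}\mathfrak{v})_0=\mathfrak{v}^{(2)}_0$ and $(\widetilde{\delta_x^2}\mathfrak{v})_N=\mathfrak{v}^{(2)}_N$. These are determined as follows. Write $\mathfrak{v}^{(2)}_j=(\widetilde{\delta_x^2}\mathfrak{v})_j$, $\mathfrak{v}^{(3)}_j=(\delta_x^3\mathfrak{v})_j$, $\mathfrak{v}^{(4)}_j=(\delta_x^4\mathfrak{v})_j$ at interior points. At $x_0$ the three unknowns $\mathfrak{v}^{(2)}_0,\mathfrak{v}^{(3)}_0,\mathfrak{v}^{(4)}_0$ solve the linear system $$f(x_0)=\mathfrak{v}^{(4)}_0+D(x_0)\mathfrak{v}^{(3)}_0+A(x_0)\mathfrak{v}^{(2)}_0,$$ $$\frac{\mathfrak{v}^{(3)}_2-\mathfrak{v}^{(3)}_0}{2h}=\frac{\mathfrak{v}^{(4)}_0+4\mathfrak{v}^{(4)}_1+\mathfrak{v}^{(4)}_2}{6},$$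 $$\mathfrak{v}^{(4)}_1=2\,\frac{\mathfrak{v}^{(2)}_0-2\mathfrak{v}^{(2)}_1+\mathfrak{v}^{(2)}_2}{h^2}-\frac{\mathfrak{v}^{(3)}_2-\mathfrak{v}^{(3)}_0}{2h}.$$ At $x_N$ the analogous system is $$f(x_N)=\mathfrak{v}^{(4)}_N+D(x_N)\mathfrak{v}^{(3)}_N+A(x_N)\mathfrak{v}^{(2)}_N,$$ $$\frac{\mathfrak{v}^{(3)}_N-\mathfrak{v}^{(3)}_{N-2}}{2h}=\frac{\mathfrak{v}^{(4)}_{N-2}+4\mathfrak{v}^{(4)}_{N-1}+\mathfrak{v}^{(4)}_N}{6},$$ $$\mathfrak{v}^{(4)}_{N-1}=2\,\frac{\mathfrak{v}^{(2)}_N-2\mathfrak{v}^{(2)}_{N-1}+\mathfrak{v}^{(2)}_{N-2}}{h^2}-\frac{\mathfrak{v}^{(3)}_N-\mathfrak{v}^{(3)}_{N-2}}{2h}.$$ (The auxiliary boundary values $\mathfrak{v}^{(4)}_0,\mathfrak{v}^{(4)}_N$ obtained here play no role in the extension by zero of $\delta_x^4\mathfrak{g}$ above.) The meshes considered are fine enough ($N\ge4$) that these systems are uniquely solvable, i.e. $12-4D(0)h+A(0)h^2\neq0$ and $12+4D(1)h+A(1)h^2\ne0$. Piecewise linear function: for $\mathfrak{z}\in l^2_{h,0}$, $z_h$ is the continuous function on $[0,1]$ with $z_h(x_i)=\mathfrak{z}_i$, $0\le i\le N$, and linear on each $(x_i,x_{i+1})$. *)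

theory Defs
  imports "HOL-Analysis.Analysis"
begin

section \<open>Grid functions\<close>

text \<open>
  A grid function on the mesh with \<^term>\<open>N\<close> cells is a function on the naturals that vanishes at
  indices beyond \<^term>\<open>N\<close>, so that equality on the grid is equality of functions.
\<close>

definition mesh :: "nat \<Rightarrow> real" where
  "mesh N = 1 / real N"

definition node :: "nat \<Rightarrow> nat \<Rightarrow> real" where
  "node N j = real j * mesh N"

definition l2h :: "nat \<Rightarrow> (nat \<Rightarrow> real) set" where
  "l2h N = {v. \<forall>j>N. v j = 0}"

definition l2h0 :: "nat \<Rightarrow> (nat \<Rightarrow> real) set" where
  "l2h0 N = {v \<in> l2h N. v 0 = 0 \<and> v N = 0}"

definition inner_h :: "nat \<Rightarrow> (nat \<Rightarrow> real) \<Rightarrow> (nat \<Rightarrow> real) \<Rightarrow> real" where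
  "inner_h N v w = mesh N * (\<Sum>j=0..N. v j * w j)"

definition norm_h :: "nat \<Rightarrow> (nat \<Rightarrow> real) \<Rightarrow> real" where
  "norm_h N v = sqrt (inner_h N v v)"

text \<open>The three basic operators are meaningful only at interior indices \<open>1 \<le> j \<le> N - 1\<close>.\<close>

definition delta_x :: "nat \<Rightarrow> (nat \<Rightarrow> real) \<Rightarrow> nat \<Rightarrow> real" where
  "delta_x N v j = (v (j + 1) - v (j - 1)) / (2 * mesh N)"

definition delta_x2 :: "nat \<Rightarrow> (nat \<Rightarrow> real) \<Rightarrow> nat \<Rightarrow> real" where
  "delta_x2 N v j = (v (j + 1) - 2 * v j + v (j - 1)) / (mesh N)\<^sup>2"

definition sigma_x :: "(nat \<Rightarrow> real) \<Rightarrow> nat \<Rightarrow> real" where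
  "sigma_x v j = 1 / 6 * v (j - 1) + 2 / 3 * v j + 1 / 6 * v (j + 1)"

text \<open>The description is proper for every \<open>N \<ge> 1\<close>: the tridiagonal system is diagonally dominant.\<close>

definition hermite_deriv :: "nat \<Rightarrow> (nat \<Rightarrow> real) \<Rightarrow> nat \<Rightarrow> real" where
  "hermite_deriv N v =
     (THE w. w \<in> l2h0 N \<and> (\<forall>j\<in>{1..N - 1}. sigma_x w j = delta_x N v j))"

text \<open>The fourth discrete derivative, extended by zero to the two end points.\<close>

definition delta_x4 :: "nat \<Rightarrow> (nat \<Rightarrow> real) \<Rightarrow> nat \<Rightarrow> real" where
  "delta_x4 N v j =
     (if 1 \<le> j \<and> j \<le> N - 1
      then 12 / (mesh N)\<^sup>2 * (delta_x N (hermite_deriv N v) j - delta_x2 N v j)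
      else 0)"

text \<open>
  The second discrete derivative at interior indices, and the third discrete derivative
  formed from given values \<^term>\<open>w\<close> of the second one.
\<close>

definition delta_x2_tilde_interior :: "nat \<Rightarrow> (nat \<Rightarrow> real) \<Rightarrow> nat \<Rightarrow> real" where
  "delta_x2_tilde_interior N v j = 2 * delta_x2 N v j - delta_x N (hermite_deriv N v) j"

definition delta_x3_from :: "nat \<Rightarrow> (nat \<Rightarrow> real) \<Rightarrow> (nat \<Rightarrow> real) \<Rightarrow> nat \<Rightarrow> real" where
  "delta_x3_from N v w j = 2 * delta_x2 N (hermite_deriv N v) j - delta_x N w j"

text \<open>
  The linear systems for the values of the second, third and fourth discrete derivatives
  at the two end points. For \<open>N \<ge> 4\<close> the third derivative at the indices \<open>2\<close> and \<open>N - 2\<close>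
  involves interior values of the second one only.
\<close>

definition left_system ::
  "nat \<Rightarrow> (real \<Rightarrow> real) \<Rightarrow> (real \<Rightarrow> real) \<Rightarrow> (real \<Rightarrow> real) \<Rightarrow> (nat \<Rightarrow> real)
    \<Rightarrow> real \<Rightarrow> real \<Rightarrow> real \<Rightarrow> bool" where
  "left_system N A D f v a2 a3 a4 \<longleftrightarrow>
    (let h = mesh N;
         v2 = delta_x2_tilde_interior N v;
         v3 = delta_x3_from N v v2;
         v4 = delta_x4 N v
     in f 0 = a4 + D 0 * a3 + A 0 * a2 \<and>
        (v3 2 - a3) / (2 * h) = (a4 + 4 * v4 1 + v4 2) / 6 \<and>
        v4 1 = 2 * ((a2 - 2 * v2 1 + v2 2) / h\<^sup>2) - (v3 2 - a3) / (2 * h))"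

definition right_system ::
  "nat \<Rightarrow> (real \<Rightarrow> real) \<Rightarrow> (real \<Rightarrow> real) \<Rightarrow> (real \<Rightarrow> real) \<Rightarrow> (nat \<Rightarrow> real)
    \<Rightarrow> real \<Rightarrow> real \<Rightarrow> real \<Rightarrow> bool" where
  "right_system N A D f v b2 b3 b4 \<longleftrightarrow>
    (let h = mesh N;
         v2 = delta_x2_tilde_interior N v;
         v3 = delta_x3_from N v v2;
         v4 = delta_x4 N v
     in f 1 = b4 + D 1 * b3 + A 1 * b2 \<and>
        (b3 - v3 (N - 2)) / (2 * h) = (v4 (N - 2) + 4 * v4 (N - 1) + b4) / 6 \<and>
        v4 (N - 1) = 2 * ((b2 - 2 * v2 (N - 1) + v2 (N - 2)) / h\<^sup>2)
                       - (b3 - v3 (N - 2)) / (2 * h))"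

definition uniquely_solvable_mesh :: "(real \<Rightarrow> real) \<Rightarrow> (real \<Rightarrow> real) \<Rightarrow> nat \<Rightarrow> bool" where
  "uniquely_solvable_mesh A D N \<longleftrightarrow>
     4 \<le> N \<and>
     12 - 4 * D 0 * mesh N + A 0 * (mesh N)\<^sup>2 \<noteq> 0 \<and>
     12 + 4 * D 1 * mesh N + A 1 * (mesh N)\<^sup>2 \<noteq> 0"

text \<open>The second discrete derivative including its two end point values.\<close>

definition delta_x2_tilde ::
  "nat \<Rightarrow> (real \<Rightarrow> real) \<Rightarrow> (real \<Rightarrow> real) \<Rightarrow> (real \<Rightarrow> real) \<Rightarrow> (nat \<Rightarrow> real) \<Rightarrow> nat \<Rightarrow> real" where
  "delta_x2_tilde N A D f v j =
     (if j = 0 then (THE a2. \<exists>a3 a4. left_system N A D f v a2 a3 a4)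
      else if j = N then (THE b2. \<exists>b3 b4. right_system N A D f v b2 b3 b4)
      else if j < N then delta_x2_tilde_interior N v j
      else 0)"

definition delta_x3 ::
  "nat \<Rightarrow> (real \<Rightarrow> real) \<Rightarrow> (real \<Rightarrow> real) \<Rightarrow> (real \<Rightarrow> real) \<Rightarrow> (nat \<Rightarrow> real) \<Rightarrow> nat \<Rightarrow> real" where
  "delta_x3 N A D f v = delta_x3_from N v (delta_x2_tilde N A D f v)"

text \<open>
  For \<open>0 \<le> x \<le> 1\<close> this is the continuous piecewise linear interpolant of \<^term>\<open>z\<close>; at \<open>x = 1\<close>
  the factor of the slope vanishes, leaving \<^term>\<open>z N\<close>.
\<close>

definition piecewise_linear :: "nat \<Rightarrow> (nat \<Rightarrow> real) \<Rightarrow> real \<Rightarrow> real" where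
  "piecewise_linear N z x =
     (let i = nat \<lfloor>real N * x\<rfloor> in z i + (real N * x - real i) * (z (i + 1) - z i))"


section \<open>The continuous operator\<close>

text \<open>The derivative on the closed unit interval, one-sided at the end points.\<close>

definition deriv01 :: "(real \<Rightarrow> real) \<Rightarrow> real \<Rightarrow> real" where
  "deriv01 u x = vector_derivative u (at x within {0..1})"

definition C01 :: "nat \<Rightarrow> (real \<Rightarrow> real) set" where
  "C01 m = {u. (\<forall>i<m. (deriv01 ^^ i) u differentiable_on {0..1}) \<and>
               (\<forall>i\<le>m. continuous_on {0..1} ((deriv01 ^^ i) u))}"

definition L_cont ::
  "(real \<Rightarrow> real) \<Rightarrow> (real \<Rightarrow> real) \<Rightarrow> (real \<Rightarrow> real) \<Rightarrow> (real \<Rightarrow> real)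
    \<Rightarrow> (real \<Rightarrow> real) \<Rightarrow> real \<Rightarrow> real" where
  "L_cont A B D H u x =
     (deriv01 ^^ 4) u x + D x * (deriv01 ^^ 3) u x + A x * (deriv01 ^^ 2) u x
       + (deriv01 A x + H x) * deriv01 u x + B x * u x"

definition is_eigenvalue_L_cont ::
  "(real \<Rightarrow> real) \<Rightarrow> (real \<Rightarrow> real) \<Rightarrow> (real \<Rightarrow> real) \<Rightarrow> (real \<Rightarrow> real) \<Rightarrow> real \<Rightarrow> bool" where
  "is_eigenvalue_L_cont A B D H c \<longleftrightarrow>
     (\<exists>u\<in>C01 4. u 0 = 0 \<and> deriv01 u 0 = 0 \<and> u 1 = 0 \<and> deriv01 u 1 = 0 \<and>
        (\<exists>x\<in>{0..1}. u x \<noteq> 0) \<and>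
        (\<forall>x\<in>{0..1}. L_cont A B D H u x = c * u x))"


section \<open>Function spaces on the open unit interval\<close>

abbreviation leb01 :: "real measure" where
  "leb01 \<equiv> lebesgue_on {0<..<1}"

definition L2_01 :: "(real \<Rightarrow> real) set" where
  "L2_01 = {u. u \<in> borel_measurable leb01 \<and> integrable leb01 (\<lambda>x. (u x)\<^sup>2)}"

definition weakly_converges_L2 :: "(nat \<Rightarrow> real \<Rightarrow> real) \<Rightarrow> (real \<Rightarrow> real) \<Rightarrow> bool" where
  "weakly_converges_L2 w v \<longleftrightarrow>
     (\<forall>k. w k \<in> L2_01) \<and> v \<in> L2_01 \<and>
     (\<forall>p\<in>L2_01. (\<lambda>k. LINT x|leb01. w k x * p x) \<longlonglongrightarrow> (LINT x|leb01. v x * p x))"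

text \<open>Smooth functions with compact support in the open unit interval.\<close>

definition test_functions :: "(real \<Rightarrow> real) set" where
  "test_functions =
     {p. (\<forall>n x. (deriv ^^ n) p differentiable (at x)) \<and>
         (\<exists>K. compact K \<and> K \<subseteq> {0<..<1} \<and> (\<forall>x. x \<notin> K \<longrightarrow> p x = 0))}"

definition weak_deriv :: "nat \<Rightarrow> (real \<Rightarrow> real) \<Rightarrow> (real \<Rightarrow> real) \<Rightarrow> bool" where
  "weak_deriv n u w \<longleftrightarrow>
     (\<forall>p\<in>test_functions.
        (LINT x|leb01. u x * (deriv ^^ n) p x) = (-1) ^ n * (LINT x|leb01. w x * p x))"

definition sobolev :: "nat \<Rightarrow> (real \<Rightarrow> real) set" where
  "sobolev m = {u \<in> L2_01. \<forall>i\<le>m. \<exists>w\<in>L2_01. weak_deriv i u w}"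

text \<open>
  The closure of the test functions in the Sobolev norm. The weak derivatives \<open>w i\<close> are
  determined almost everywhere, so the choice of \<open>w\<close> is immaterial.
\<close>

definition sobolev0 :: "nat \<Rightarrow> (real \<Rightarrow> real) set" where
  "sobolev0 m = {u \<in> sobolev m.
     \<exists>w. (\<forall>i\<le>m. w i \<in> L2_01 \<and> weak_deriv i u (w i)) \<and>
         (\<forall>e>0. \<exists>p\<in>test_functions.
            sqrt (\<Sum>i\<le>m. LINT x|leb01. (w i x - (deriv ^^ i) p x)\<^sup>2) < e)}"

end

theory Submission
  imports Defs "HOL-Complex_Analysis.Great_Picard"
begin

text \<open>
  The values \<open>u\<close> and slopes \<open>hermite_deriv u\<close> are the nodal data of a clamped cubic spline, and
  \<open>delta_x4 u\<close> is the second difference of the nodal values of its second derivative. A bound on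
  \<open>delta_x4 u\<close> in the discrete norm therefore bounds the first three derivatives of the spline, and
  the discrete equation bounds \<open>delta_x4 u\<close> uniformly at all interior nodes except those next to
  the end points. There \<open>h delta_x4 u = O(sqrt h)\<close> suffices, so the auxiliary systems for the end
  point values never enter. By the Arzela--Ascoli theorem a subsequence of the spline data converges
  uniformly, and the limit solves the first order system equivalent to \<open>L_cont g = f\<close>. This solution
  is unique because zero is not an eigenvalue, hence the whole sequence converges. Finally
  \<open>delta_x4 u\<close> converges uniformly away from the end points and is bounded in \<open>L\<^sup>2\<close>, hence
  converges weakly.
\<close>

section \<open>Hermitian derivatives and cubic splines\<close>

text \<open>The stencil of \<open>delta_x3\<close> at \<open>j\<close> reaches one node to each
  side, so for \<open>2 \<le> j \<le> n - 2\<close> it meets only interior values of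
  \<open>delta_x2_tilde\<close>. There every discrete derivative equals the spline derivative up to
  bounded multiples of \<open>mesh n * delta_x4\<close> at neighbouring nodes, and a single term of
  the discrete norm shows that these are O(sqrt h). The spline thus satisfies the differential
  equation at these nodes with a defect of that order. Next to an end point \<open>delta_x4\<close>
  may be as large as 1 / sqrt h, so the third derivative need not be Lipschitz uniformly in the
  mesh. Dropping its outermost jumps repairs this and is invisible in the limit. The initial second
  and third derivatives are controlled by the clamped right end, which gives two independent linear
  equations for them. Membership in the closure of the test functions requires explicit
  approximants. A function supported inside the interval has a compactly supported double primitive
  exactly when it is orthogonal to 1 and x, and the clamped conditions say that the second
  derivative of the limit has the same orthogonality.\<close>

lemma mesh_pos: "n > 0 \<Longrightarrow> mesh n > 0"
  by (simp add: mesh_def)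

lemma mesh_le_1: "mesh n \<le> 1"
  by (cases n) (auto simp: mesh_def)

lemma node_0 [simp]: "node n 0 = 0"
  by (simp add: node_def)

lemma node_last [simp]: "n > 0 \<Longrightarrow> node n n = 1"
  by (simp add: node_def mesh_def)

lemma node_Suc: "node n (Suc i) = node n i + mesh n"
  by (simp add: node_def algebra_simps)

lemma node_in_unit: "i \<le> n \<Longrightarrow> node n i \<in> {0..1}"
  by (cases "n = 0") (auto simp: node_def mesh_def)

text \<open>The equation \<open>sigma_x w j = b j\<close> solved for \<open>w (j + 1)\<close>,
  started from \<open>w 0 = 0\<close> and a free value \<open>s\<close> at index 1: the shooting
  method for the tridiagonal system.\<close>

fun shoot :: "(nat \<Rightarrow> real) \<Rightarrow> real \<Rightarrow> nat \<Rightarrow> real" where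
  "shoot b s 0 = 0"
| "shoot b s (Suc 0) = s"
| "shoot b s (Suc (Suc j)) = 6 * b (Suc j) - 4 * shoot b s (Suc j) - shoot b s j"

lemma shoot_affine: "shoot b s j = shoot b 0 j + s * shoot (\<lambda>_. 0) 1 j"
  by (induction b s j rule: shoot.induct) (simp_all add: algebra_simps)

text \<open>Diagonal dominance: the recursion gives \<open>\<bar>y (j + 2)\<bar> \<ge> 4 * \<bar>y
  (j + 1)\<bar> - \<bar>y j\<bar> > 3 * \<bar>y (j + 1)\<bar>\<close>. So the homogeneous solution
  never returns to zero, and the free value can be adjusted to meet the condition at the right
  end.\<close>

lemma shoot_growth: "\<bar>shoot (\<lambda>_. 0) 1 j\<bar> < \<bar>shoot (\<lambda>_. 0) 1 (Suc j)\<bar>"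
  by (induction j) auto

lemma shoot_nonzero: "j > 0 \<Longrightarrow> shoot (\<lambda>_. 0) 1 j \<noteq> 0"
  using shoot_growth[of "j - 1"] by auto

lemma sigma_system_shoot:
  assumes "w \<in> l2h0 n" "\<forall>j\<in>{1..n - 1}. sigma_x w j = b j" "j \<le> n"
  shows "w j = shoot b (w 1) j"
proof -
  \<comment> \<open>The recursion is of second order, so the induction carries two consecutive
    values; the guard keeps the second one on the grid.\<close>
  have "w j = shoot b (w 1) j \<and> (Suc j \<le> n \<longrightarrow> w (Suc j) = shoot b (w 1) (Suc j))"
    using assms(3)
  proof (induction j)
    case 0
    then show ?case using assms(1) by (simp add: l2h0_def)
  next
    case (Suc j)
    have "w (Suc (Suc j)) = 6 * b (Suc j) - 4 * w (Suc j) - w j" if "Suc (Suc j) \<le> n"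
    proof -
      have "sigma_x w (Suc j) = b (Suc j)" using assms(2) that by (simp add: Ball_def)
      then show ?thesis by (simp add: sigma_x_def)
    qed
    then show ?case using Suc by simp
  qed
  then show ?thesis ..
qed

text \<open>The value at \<open>n\<close> is affine in the value at 1, with the nonzero coefficient
  \<open>?e\<close>. The right boundary condition therefore fixes exactly one start, and the start
  fixes all other values.\<close>

lemma hermite_deriv_ex1:
  assumes "n > 0"
  shows "\<exists>!w. w \<in> l2h0 n \<and> (\<forall>j\<in>{1..n - 1}. sigma_x w j = delta_x n v j)"
proof -
  let ?b = "delta_x n v"
  let ?e = "shoot (\<lambda>_. 0) 1 n"
  define s where "s = - shoot ?b 0 n / ?e"
  define w where "w = (\<lambda>j. if j \<le> n then shoot ?b s j else 0)"
  have e: "?e \<noteq> 0" using shoot_nonzero assms by blast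
  then have "shoot ?b s n = 0"
    by (subst shoot_affine) (simp add: s_def)
  then have "w \<in> l2h0 n" by (simp add: w_def l2h0_def l2h_def)
  moreover have "sigma_x w j = ?b j" if "j \<in> {1..n - 1}" for j
  proof -
    from that have "j = Suc (j - 1)" by simp
    then obtain i where "j = Suc i" by blast
    then show ?thesis using that by (auto simp: sigma_x_def w_def field_simps)
  qed
  moreover have "w' = w''" if w': "w' \<in> l2h0 n" "\<forall>j\<in>{1..n - 1}. sigma_x w' j = ?b j"
    and w'': "w'' \<in> l2h0 n" "\<forall>j\<in>{1..n - 1}. sigma_x w'' j = ?b j" for w' w''
  proof -
    have "w' n = shoot ?b 0 n + w' 1 * ?e" "w'' n = shoot ?b 0 n + w'' 1 * ?e"
      using sigma_system_shoot[OF w', of n] sigma_system_shoot[OF w'', of n]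
        shoot_affine[of ?b "w' 1" n] shoot_affine[of ?b "w'' 1" n] by auto
    moreover have "w' n = w'' n" using w'(1) w''(1) by (simp add: l2h0_def)
    ultimately have "w' 1 * ?e = w'' 1 * ?e" by linarith
    then have "w' 1 = w'' 1" using e by simp
    then have "w' j = w'' j" for j
      using sigma_system_shoot[OF w', of j] sigma_system_shoot[OF w'', of j] w'(1) w''(1)
      by (cases "j \<le> n") (auto simp: l2h0_def l2h_def)
    then show ?thesis by blast
  qed
  ultimately show ?thesis by metis
qed

lemma hermite_deriv:
  assumes "n > 0"
  shows "hermite_deriv n v \<in> l2h0 n"
    and "j \<in> {1..n - 1} \<Longrightarrow> sigma_x (hermite_deriv n v) j = delta_x n v j"
  using theI'[OF hermite_deriv_ex1[OF assms, of v]] by (auto simp: hermite_deriv_def)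

text \<open>Nodal values of the second derivative of the cubic Hermite interpolant of \<open>u\<close> with slopes
  \<open>hermite_deriv n u\<close>, evaluated on the cell to the right of the node.\<close>

definition spline2 :: "nat \<Rightarrow> (nat \<Rightarrow> real) \<Rightarrow> nat \<Rightarrow> real" where
  "spline2 n u j =
     (let m = hermite_deriv n u; h = mesh n in
      if j < n then 6 * (u (j + 1) - u j) / h\<^sup>2 - (4 * m j + 2 * m (j + 1)) / h
      else (2 * m (j - 1) + 4 * m j) / h - 6 * (u j - u (j - 1)) / h\<^sup>2)"

text \<open>The second derivative of a cubic is linear on a cell, so for \<open>j < n\<close> this
  is the constant third derivative on the cell to the right of node \<open>j\<close>.\<close>

definition spline3 :: "nat \<Rightarrow> (nat \<Rightarrow> real) \<Rightarrow> nat \<Rightarrow> real" where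
  "spline3 n u j = (spline2 n u (j + 1) - spline2 n u j) / mesh n"

section \<open>Identities for the spline data on a cell and across a node\<close>

lemma spline2_right:
  assumes "j < n"
  shows "(mesh n)\<^sup>2 * spline2 n u j = 6 * (u (Suc j) - u j)
     - mesh n * (4 * hermite_deriv n u j + 2 * hermite_deriv n u (Suc j))"
proof -
  have "mesh n > 0" using assms by (intro mesh_pos) auto
  then show ?thesis using assms
    by (simp add: spline2_def Let_def field_simps power2_eq_square)
qed

text \<open>The cell to the left gives the same nodal value. At an interior node this is continuity
  of the second derivative, which is what \<open>sigma_x (hermite_deriv n u) = delta_x n u\<close>
  expresses; at the last node it is the definition.\<close>

lemma spline2_left:
  assumes "j < n"
  shows "(mesh n)\<^sup>2 * spline2 n u (Suc j) = mesh n * (2 * hermite_deriv n u j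
     + 4 * hermite_deriv n u (Suc j)) - 6 * (u (Suc j) - u j)"
proof -
  have h: "mesh n > 0" using assms by (intro mesh_pos) auto
  show ?thesis
  proof (cases "Suc j = n")
    case True
    with h show ?thesis
      by (auto simp: spline2_def Let_def field_simps power2_eq_square)
  next
    case False
    then have "Suc j \<in> {1..n - 1}" using assms by auto
    then have "sigma_x (hermite_deriv n u) (Suc j) = delta_x n u (Suc j)"
      using assms by (intro hermite_deriv) auto
    then have "6 * (u (Suc (Suc j)) - u j) / 2 = mesh n * (hermite_deriv n u j
        + 4 * hermite_deriv n u (Suc j) + hermite_deriv n u (Suc (Suc j)))"
      using h by (simp add: sigma_x_def delta_x_def field_simps)
    with spline2_right[of "Suc j" n u] False assms show ?thesis
      by (simp add: algebra_simps)
  qed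
qed

text \<open>The trapezoidal rule is exact because the second derivative is linear on the
  cell.\<close>

lemma hermite_deriv_step:
  assumes "j < n"
  shows "hermite_deriv n u (Suc j) - hermite_deriv n u j
    = mesh n * (spline2 n u j + spline2 n u (Suc j)) / 2"
proof -
  have h: "mesh n > 0" using assms by (intro mesh_pos) auto
  have "mesh n * (hermite_deriv n u (Suc j) - hermite_deriv n u j)
    = mesh n * (mesh n * (spline2 n u j + spline2 n u (Suc j)) / 2)"
    using spline2_right[OF assms, of u] spline2_left[OF assms, of u]
    by (simp add: algebra_simps power2_eq_square)
  with h show ?thesis by (simp only: mult_cancel_left) simp
qed

text \<open>Taylor expansion at the left node, with the linear second derivative integrated
  twice.\<close>

lemma spline_step:
  assumes "j < n"
  shows "u (Suc j) - u j = mesh n * hermite_deriv n u j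
    + (mesh n)\<^sup>2 * (2 * spline2 n u j + spline2 n u (Suc j)) / 6"
  using spline2_right[OF assms, of u] spline2_left[OF assms, of u]
  by (simp add: field_simps)

lemma spline2_step: "0 < n \<Longrightarrow> spline2 n u (Suc j) - spline2 n u j = mesh n * spline3 n u j"
  using mesh_pos[of n] by (simp add: spline3_def)

lemma delta_x4_eq:
  assumes "Suc j < n"
  shows "(mesh n)\<^sup>2 * ((mesh n)\<^sup>2 * delta_x4 n u (Suc j))
     = 6 * mesh n * (hermite_deriv n u (Suc (Suc j)) - hermite_deriv n u j)
       - 12 * (u (Suc (Suc j)) - 2 * u (Suc j) + u j)"
proof -
  have *: "h\<^sup>2 * (h\<^sup>2 * (12 / h\<^sup>2 * (a / (2 * h) - b / h\<^sup>2))) = 6 * h * a - 12 * b"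
    if "h > 0" for h a b :: real
    using that by (simp add: field_simps power2_eq_square)
  have "delta_x4 n u (Suc j) = 12 / (mesh n)\<^sup>2
      * (delta_x n (hermite_deriv n u) (Suc j) - delta_x2 n u (Suc j))"
    using assms by (auto simp: delta_x4_def)
  then show ?thesis
    using *[OF mesh_pos, of n "hermite_deriv n u (Suc (Suc j)) - hermite_deriv n u j"
        "u (Suc (Suc j)) - 2 * u (Suc j) + u j"] assms
    by (simp only: delta_x_def delta_x2_def) simp
qed

text \<open>In the second difference of \<open>spline2\<close> the middle value occurs twice and is
  taken once from each adjacent cell. The slope at the middle node cancels, and the combination that
  defines \<open>delta_x4\<close> remains.\<close>

lemma spline3_step:
  assumes "Suc j < n"
  shows "spline3 n u (Suc j) - spline3 n u j = mesh n * delta_x4 n u (Suc j)"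
proof -
  have h: "mesh n > 0" using assms by (intro mesh_pos) auto
  have "(mesh n)\<^sup>2 * (spline2 n u (Suc (Suc j)) - 2 * spline2 n u (Suc j) + spline2 n u j)
    = (mesh n)\<^sup>2 * ((mesh n)\<^sup>2 * delta_x4 n u (Suc j))"
    using assms spline2_right[of j n u] spline2_left[of "Suc j" n u]
      spline2_right[of "Suc j" n u] spline2_left[of "j" n u]
    unfolding delta_x4_eq[OF assms] by (simp add: algebra_simps)
  then have "spline2 n u (Suc (Suc j)) - 2 * spline2 n u (Suc j) + spline2 n u j
    = (mesh n)\<^sup>2 * delta_x4 n u (Suc j)"
    using h by (metis mult_left_cancel less_irrefl zero_less_power)
  then have "mesh n * (spline3 n u (Suc j) - spline3 n u j)
      = mesh n * (mesh n * delta_x4 n u (Suc j))"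
    using h unfolding right_diff_distrib spline3_def by (simp add: power2_eq_square)
  then show ?thesis using h by (metis mult_left_cancel less_irrefl zero_less_power)
qed

text \<open>Averaging the left and right formulas for \<open>spline2\<close> removes the middle
  slope. The result differs from \<open>delta_x2_tilde_interior\<close> by a multiple of the
  combination that defines \<open>delta_x4\<close>.\<close>

lemma delta_x2_tilde_interior_spline:
  assumes "Suc j < n"
  shows "delta_x2_tilde_interior n u (Suc j)
    = spline2 n u (Suc j) + (mesh n)\<^sup>2 / 12 * delta_x4 n u (Suc j)"
proof -
  have h: "mesh n > 0" using assms by (intro mesh_pos) auto
  have "(mesh n)\<^sup>2 * delta_x2_tilde_interior n u (Suc j)
      = 2 * (u (Suc (Suc j)) - 2 * u (Suc j) + u j)
        - mesh n * (hermite_deriv n u (Suc (Suc j)) - hermite_deriv n u j) / 2"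
    using h by (simp add: delta_x2_tilde_interior_def delta_x_def delta_x2_def
        field_simps power2_eq_square)
  also have "\<dots> = (mesh n)\<^sup>2 * spline2 n u (Suc j)
      + (mesh n)\<^sup>2 * ((mesh n)\<^sup>2 * delta_x4 n u (Suc j)) / 12"
    using assms spline2_right[of "Suc j" n u] spline2_left[of "j" n u]
    unfolding delta_x4_eq[OF assms] by (simp add: field_simps)
  also have "\<dots> = (mesh n)\<^sup>2 * (spline2 n u (Suc j) + (mesh n)\<^sup>2 / 12 * delta_x4 n u (Suc j))"
    by (simp add: algebra_simps)
  finally show ?thesis using h by (metis mult_left_cancel less_irrefl zero_less_power)
qed

text \<open>By the trapezoidal identity \<open>delta_x2\<close> of the slopes is the central
  difference of \<open>spline2\<close>. It enters twice, and \<open>delta_x\<close> of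
  \<open>delta_x2_tilde\<close> removes it once, up to the \<open>delta_x4\<close> correction. The
  range of \<open>j\<close> keeps \<open>j - 1\<close> and \<open>j + 1\<close> interior, so the end
  point systems are not met.\<close>

lemma delta_x3_spline:
  assumes "2 \<le> j" "j + 2 \<le> n"
  shows "delta_x3 n A D f u j = spline3 n u j - mesh n / 2 * delta_x4 n u j
     - mesh n / 24 * (delta_x4 n u (Suc j) - delta_x4 n u (j - 1))"
proof -
  have "j = Suc (Suc (j - 2))" using assms by simp
  then obtain i where i: "j = Suc (Suc i)" by blast
  let ?k = "Suc i"
  have h: "mesh n > 0" using assms by (intro mesh_pos) auto
  have d2: "delta_x2 n (hermite_deriv n u) j
      = (spline2 n u (Suc j) - spline2 n u ?k) / (2 * mesh n)"
  proof -
    have "hermite_deriv n u (Suc j) - 2 * hermite_deriv n u j + hermite_deriv n u ?k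
      = mesh n * (spline2 n u (Suc j) - spline2 n u ?k) / 2"
      using hermite_deriv_step[of ?k n u] hermite_deriv_step[of j n u] assms i
      by (simp add: algebra_simps)
    moreover have "delta_x2 n (hermite_deriv n u) j
      = (hermite_deriv n u (Suc j) - 2 * hermite_deriv n u j + hermite_deriv n u ?k) / (mesh n)\<^sup>2"
      using i by (simp add: delta_x2_def)
    ultimately have "delta_x2 n (hermite_deriv n u) j
        = mesh n * (spline2 n u (Suc j) - spline2 n u ?k) / 2 / (mesh n)\<^sup>2"
      by (simp only:)
    also have "\<dots> = (spline2 n u (Suc j) - spline2 n u ?k) / (2 * mesh n)"
      using h by (simp add: power2_eq_square)
    finally show ?thesis .
  qed
  \<comment> \<open>The central difference is the mean of the slopes on the two adjacent cells, and
    these differ by \<open>mesh n * delta_x4 n u j\<close>.\<close>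
  have "spline2 n u (Suc j) - spline2 n u ?k
      = mesh n * (2 * spline3 n u j - mesh n * delta_x4 n u j)"
    using spline2_step[of n u ?k] spline2_step[of n u j] spline3_step[of ?k n u] assms i
    by (simp add: algebra_simps)
  then have "delta_x2 n (hermite_deriv n u) j
      = mesh n * (2 * spline3 n u j - mesh n * delta_x4 n u j) / (2 * mesh n)"
    by (simp only: d2)
  then have 1: "delta_x2 n (hermite_deriv n u) j
      = spline3 n u j - mesh n / 2 * delta_x4 n u j"
    using h by simp
  have "delta_x2_tilde n A D f u (Suc j) = delta_x2_tilde_interior n u (Suc j)"
    if "Suc j \<noteq> n" using assms that by (auto simp: delta_x2_tilde_def)
  moreover have "Suc j \<noteq> n" using assms by auto
  moreover have "delta_x2_tilde n A D f u ?k = delta_x2_tilde_interior n u ?k"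
    using assms i by (auto simp: delta_x2_tilde_def)
  ultimately have "delta_x n (delta_x2_tilde n A D f u) j
     = (spline2 n u (Suc j) + (mesh n)\<^sup>2 / 12 * delta_x4 n u (Suc j)
        - (spline2 n u ?k + (mesh n)\<^sup>2 / 12 * delta_x4 n u ?k)) / (2 * mesh n)"
    using delta_x2_tilde_interior_spline[of "j" n u]
      delta_x2_tilde_interior_spline[of i n u] assms i
    by (simp add: delta_x_def)
  also have "\<dots> = (spline2 n u (Suc j) - spline2 n u ?k) / (2 * mesh n)
       + mesh n / 24 * (delta_x4 n u (Suc j) - delta_x4 n u ?k)"
    using h by (simp add: field_simps power2_eq_square)
  finally have "delta_x n (delta_x2_tilde n A D f u) j
     = (spline2 n u (Suc j) - spline2 n u ?k) / (2 * mesh n)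
       + mesh n / 24 * (delta_x4 n u (Suc j) - delta_x4 n u ?k)" .
  with d2 1 i show ?thesis by (simp add: delta_x3_def delta_x3_from_def)
qed

section \<open>A priori bounds\<close>

text \<open>One term of the norm already gives \<open>mesh n * (v j)^2 \<le> C^2\<close>; take the
  root and multiply by \<open>sqrt (mesh n)\<close>.\<close>

lemma h_delta_x4_bound:
  assumes "norm_h n v \<le> C" "j \<le> n" "n > 0"
  shows "\<bar>mesh n * v j\<bar> \<le> C * sqrt (mesh n)"
proof -
  have h: "mesh n > 0" using assms mesh_pos by auto
  have "mesh n * (v j * v j) \<le> inner_h n v v"
    unfolding inner_h_def using assms h
    by (intro mult_left_mono member_le_sum) auto
  then have "sqrt (mesh n * (v j * v j)) \<le> C"
    using assms(1) unfolding norm_h_def by (meson order_trans real_sqrt_le_mono)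
  then have "sqrt (mesh n) * \<bar>v j\<bar> \<le> C" by (simp add: real_sqrt_mult)
  then have "sqrt (mesh n) * (sqrt (mesh n) * \<bar>v j\<bar>) \<le> sqrt (mesh n) * C"
    using h by (intro mult_left_mono) auto
  moreover have "sqrt (mesh n) * (sqrt (mesh n) * \<bar>v j\<bar>) = \<bar>mesh n * v j\<bar>"
    using h unfolding mult.assoc[symmetric] by (simp add: abs_mult)
  ultimately show ?thesis by (simp add: mult.commute)
qed

text \<open>The mean square bound controls the discrete L^1 norm, which is what summing the jumps of
  \<open>spline3\<close> requires. The elementary bound \<open>\<bar>x\<bar> \<le> 1 + x * x\<close>
  stands in for the Cauchy-Schwarz inequality, and \<open>n * mesh n = 1\<close> turns its first
  summand into 1.\<close>

lemma sum_h_bound: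
  assumes "norm_h n v \<le> C" "n > 0" "j < n"
  shows "mesh n * (\<Sum>i<j. \<bar>v (Suc i)\<bar>) \<le> 1 + C\<^sup>2"
proof -
  have h: "mesh n > 0" using assms mesh_pos by auto

  have C: "inner_h n v v \<le> C\<^sup>2"
    using assms(1) unfolding norm_h_def by (intro sqrt_le_D)
  have "\<bar>x\<bar> \<le> 1 + x * x" for x :: real
  proof -
    have "(x - 1)\<^sup>2 = x * x - 2 * x + 1" "(x + 1)\<^sup>2 = x * x + 2 * x + 1"
      by (simp_all add: power2_eq_square algebra_simps)
    moreover have "0 \<le> (x - 1)\<^sup>2" "0 \<le> (x + 1)\<^sup>2" by simp_all
    ultimately show ?thesis by linarith
  qed
  then have "(\<Sum>i<j. \<bar>v (Suc i)\<bar>) \<le> (\<Sum>i<j. 1 + v (Suc i) * v (Suc i))"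
    by (intro sum_mono)
  also have "\<dots> = real j + (\<Sum>i\<in>Suc ` {..<j}. v i * v i)"
    by (simp add: sum.distrib sum.reindex)
  also have "\<dots> \<le> real n + (\<Sum>i=0..n. v i * v i)"
    using assms by (intro add_mono sum_mono2) auto
  finally have "mesh n * (\<Sum>i<j. \<bar>v (Suc i)\<bar>) \<le> mesh n * (real n + (\<Sum>i=0..n. v i * v i))"
    using h by (intro mult_left_mono) auto
  also have "\<dots> = 1 + inner_h n v v"
    using assms(2) by (simp add: inner_h_def mesh_def field_simps)
  finally show ?thesis using C by simp
qed

text \<open>Each of at most \<open>n\<close> steps contributes an error \<open>mesh n * E\<close>,
  and \<open>n * mesh n = 1\<close>: a discrete integration of an estimate for the
  derivative.\<close>

lemma steps_bound:
  fixes Y Z :: "nat \<Rightarrow> real"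
  assumes "\<And>i. i < n \<Longrightarrow> \<bar>(Y (Suc i) - Y i) - (Z (Suc i) - Z i)\<bar> \<le> mesh n * E"
    and "Y 0 = Z 0" "E \<ge> 0" "j \<le> n"
  shows "\<bar>Y j - Z j\<bar> \<le> E"
proof -
  have "\<bar>Y j - Z j\<bar> \<le> node n j * E" using assms(4)
  proof (induction j)
    case (Suc j)
    then have "\<bar>Y j - Z j\<bar> \<le> node n j * E" "\<bar>(Y (Suc j) - Y j) - (Z (Suc j) - Z j)\<bar> \<le> mesh n * E"
      using assms(1)[of j] by auto
    then show ?case unfolding node_Suc by (simp add: algebra_simps)
  qed (use assms(2) in simp)
  also have "\<dots> \<le> 1 * E" using node_in_unit[OF assms(4)] assms(3) by (intro mult_right_mono) auto
  finally show ?thesis by simp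
qed

text \<open>The third derivative stays within \<open>E\<close> of its value \<open>T0\<close> on the
  first cell. Summation from the clamped left end compares the lower derivatives with
  \<open>M0 + x * T0\<close> and its primitives, and the clamped right end then bounds
  \<open>M0\<close> and \<open>T0\<close>. The constant 50 covers the largest total,
  \<open>E + 16 * E + 30 * E\<close> for \<open>spline2\<close>.\<close>

lemma spline_bounds:
  assumes "u \<in> l2h0 n" "norm_h n (delta_x4 n u) \<le> C" "n > 0"
  defines "E \<equiv> 1 + C\<^sup>2"
  shows "j < n \<Longrightarrow> \<bar>spline3 n u j\<bar> \<le> 50 * E"
    and "j \<le> n \<Longrightarrow> \<bar>spline2 n u j\<bar> \<le> 50 * E"
    and "j \<le> n \<Longrightarrow> \<bar>hermite_deriv n u j\<bar> \<le> 50 * E"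
    and "j \<le> n \<Longrightarrow> \<bar>u j\<bar> \<le> 50 * E"
proof -
  have h: "mesh n > 0" using assms mesh_pos by auto
  have E: "E > 0" unfolding E_def using zero_le_power2[of C] by linarith
  define M0 T0 where "M0 = spline2 n u 0" and "T0 = spline3 n u 0"
  let ?x = "node n"
  have T: "\<bar>spline3 n u j - T0\<bar> \<le> E" if "j < n" for j
  proof -
    have "\<bar>spline3 n u j - T0\<bar> \<le> mesh n * (\<Sum>i<j. \<bar>delta_x4 n u (Suc i)\<bar>)" using that
    proof (induction j)
      case (Suc j)
      then have "spline3 n u (Suc j) - spline3 n u j = mesh n * delta_x4 n u (Suc j)"
        by (intro spline3_step)
      moreover have "\<bar>mesh n * delta_x4 n u (Suc j)\<bar> = mesh n * \<bar>delta_x4 n u (Suc j)\<bar>"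
        using h by (simp add: abs_mult)
      moreover have "\<bar>spline3 n u j - T0\<bar> \<le> mesh n * (\<Sum>i<j. \<bar>delta_x4 n u (Suc i)\<bar>)"
        using Suc by simp
      ultimately show ?case by (simp add: distrib_left)
    qed (simp add: T0_def)
    also have "\<dots> \<le> E" unfolding E_def using sum_h_bound assms that by blast
    finally show ?thesis .
  qed
  have M: "\<bar>spline2 n u j - (M0 + ?x j * T0)\<bar> \<le> E" if "j \<le> n" for j
  proof (rule steps_bound[OF _ _ _ that])
    fix i assume "i < n"
    then have "(spline2 n u (Suc i) - spline2 n u i) - ((M0 + ?x (Suc i) * T0) - (M0 + ?x i * T0))
      = mesh n * (spline3 n u i - T0)"
      using spline2_step[of n u i] by (simp add: node_Suc algebra_simps)
    also have "\<bar>\<dots>\<bar> \<le> mesh n * E" using T[OF \<open>i < n\<close>] h by (simp add: abs_mult)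
    finally show "\<bar>(spline2 n u (Suc i) - spline2 n u i) - ((M0 + ?x (Suc i) * T0) - (M0 + ?x i * T0))\<bar>
      \<le> mesh n * E" .
  qed (use E in \<open>auto simp: M0_def\<close>)
  let ?m = "\<lambda>j. ?x j * M0 + (?x j)\<^sup>2 / 2 * T0"
  have m: "\<bar>hermite_deriv n u j - ?m j\<bar> \<le> E" if "j \<le> n" for j
  proof (rule steps_bound[OF _ _ _ that])
    fix i assume "i < n"
    let ?r = "\<lambda>i. spline2 n u i - (M0 + ?x i * T0)"
    have "(hermite_deriv n u (Suc i) - hermite_deriv n u i) - (?m (Suc i) - ?m i)
      = mesh n * ((?r i + ?r (Suc i)) / 2)"
      unfolding hermite_deriv_step[OF \<open>i < n\<close>] node_Suc
      by (simp add: field_simps power2_eq_square)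
    also have "\<bar>\<dots>\<bar> \<le> mesh n * E" using M[of i] M[of "Suc i"] \<open>i < n\<close> h by (simp add: abs_mult)
    finally show "\<bar>(hermite_deriv n u (Suc i) - hermite_deriv n u i) - (?m (Suc i) - ?m i)\<bar> \<le> mesh n * E" .
  qed (use E assms hermite_deriv(1)[of n u] in \<open>auto simp: l2h0_def\<close>)
  let ?g = "\<lambda>j. (?x j)\<^sup>2 / 2 * M0 + (?x j) ^ 3 / 6 * T0"
  \<comment> \<open>One \<open>E\<close> is the error of the slopes; the other covers the three
    errors of the second derivative, divided by 6.\<close>
  have g: "\<bar>u j - ?g j\<bar> \<le> 2 * E" if "j \<le> n" for j
  proof (rule steps_bound[OF _ _ _ that])
    fix i assume "i < n"
    let ?r = "\<lambda>i. spline2 n u i - (M0 + ?x i * T0)"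
    let ?q = "hermite_deriv n u i - ?m i + mesh n * (2 * ?r i + ?r (Suc i)) / 6"
    have "(u (Suc i) - u i) - (?g (Suc i) - ?g i) = mesh n * ?q"
      unfolding spline_step[OF \<open>i < n\<close>] node_Suc
      by (simp add: field_simps power2_eq_square power3_eq_cube)
    also have "\<bar>\<dots>\<bar> \<le> mesh n * (2 * E)"
    proof -
      have "\<bar>mesh n * (2 * ?r i + ?r (Suc i)) / 6\<bar> = mesh n * (\<bar>2 * ?r i + ?r (Suc i)\<bar> / 6)"
        using h by (simp add: abs_mult)
      also have "\<dots> \<le> 1 * (\<bar>2 * ?r i + ?r (Suc i)\<bar> / 6)"
        using mesh_le_1 by (intro mult_right_mono) auto
      also have "\<dots> \<le> E" using M[of i] M[of "Suc i"] \<open>i < n\<close> E by simp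
      finally have "\<bar>?q\<bar> \<le> 2 * E" using m[of i] \<open>i < n\<close> by simp
      then show ?thesis using h unfolding abs_mult by (simp add: mult_left_mono)
    qed
    finally show "\<bar>(u (Suc i) - u i) - (?g (Suc i) - ?g i)\<bar> \<le> mesh n * (2 * E)" .
  qed (use E assms in \<open>auto simp: l2h0_def\<close>)
  have "hermite_deriv n u n = 0" "u n = 0" using assms hermite_deriv(1)[of n u] by (auto simp: l2h0_def)
  then have 1: "\<bar>M0 + T0 / 2\<bar> \<le> E" and 2: "\<bar>M0 / 2 + T0 / 6\<bar> \<le> 2 * E"
    using m[of n] g[of n] assms(3) by auto
  \<comment> \<open>Half of the first combination minus the second is \<open>T0 / 12\<close>, so
    \<open>\<bar>T0\<bar> \<le> 12 * (E / 2 + 2 * E)\<close>.\<close>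
  have T0: "\<bar>T0\<bar> \<le> 30 * E" using 1 2 by linarith
  have M0: "\<bar>M0\<bar> \<le> 16 * E" using 1 T0 by linarith
  have pow: "\<bar>(?x j) ^ k * y\<bar> \<le> \<bar>y\<bar>" if "j \<le> n" for j k y
  proof -
    have "\<bar>(?x j) ^ k\<bar> \<le> 1" using node_in_unit[OF that] by (simp add: power_le_one)
    then show ?thesis unfolding abs_mult by (rule mult_left_le_one_le[OF abs_ge_zero abs_ge_zero])
  qed
  show "\<bar>spline3 n u j\<bar> \<le> 50 * E" if "j < n" using T[OF that] T0 E by linarith
  show "\<bar>spline2 n u j\<bar> \<le> 50 * E" if "j \<le> n"
    using M[OF that] T0 E M0 pow[OF that, of 1 T0] unfolding power_one_right by linarith
  show "\<bar>hermite_deriv n u j\<bar> \<le> 50 * E" if "j \<le> n"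
    using m[OF that] T0 E M0 pow[OF that, of 1 M0] pow[OF that, of 2 "T0 / 2"]
    unfolding power_one_right by (simp only: times_divide_eq_right times_divide_eq_left)
  show "\<bar>u j\<bar> \<le> 50 * E" if "j \<le> n"
    using g[OF that] T0 E M0 pow[OF that, of 2 "M0 / 2"] pow[OF that, of 3 "T0 / 6"]
    by (simp only: times_divide_eq_right times_divide_eq_left)
qed

text \<open>The third derivative is frozen next to the end points, where the equation involves the
  values of the second one at the end points; this makes its increments \<open>O(h)\<close> everywhere.\<close>

definition spline3_inner :: "nat \<Rightarrow> (nat \<Rightarrow> real) \<Rightarrow> nat \<Rightarrow> real" where
  "spline3_inner n u j = spline3 n u (max 1 (min j (n - 2)))"

text \<open>A single mesh. The bounds \<open>C\<close> and \<open>Q\<close> are parameters, so that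
  the constants derived from them are uniform along a sequence of meshes.\<close>

locale bounded_solution =
  fixes A B D H f :: "real \<Rightarrow> real" and C Q :: real and n :: nat and u :: "nat \<Rightarrow> real"
  assumes n: "4 \<le> n" and u: "u \<in> l2h0 n"
    and C: "norm_h n (delta_x4 n u) \<le> C"
    and eq: "\<forall>i\<in>{1..n - 1}.
           delta_x4 n u i + D (node n i) * delta_x3 n A D f u i
           + A (node n i) * delta_x2_tilde n A D f u i
           + (deriv01 A (node n i) + H (node n i)) * hermite_deriv n u i
           + B (node n i) * u i = f (node n i)"
    and Q: "\<And>x. x \<in> {0..1} \<Longrightarrow> \<bar>A x\<bar> \<le> Q" "\<And>x. x \<in> {0..1} \<Longrightarrow> \<bar>B x\<bar> \<le> Q"
      "\<And>x. x \<in> {0..1} \<Longrightarrow> \<bar>D x\<bar> \<le> Q" "\<And>x. x \<in> {0..1} \<Longrightarrow> \<bar>deriv01 A x + H x\<bar> \<le> Q"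
      "\<And>x. x \<in> {0..1} \<Longrightarrow> \<bar>f x\<bar> \<le> Q"
begin

abbreviation "h \<equiv> mesh n"
abbreviation "m \<equiv> hermite_deriv n u"
abbreviation "v \<equiv> delta_x4 n u"
abbreviation "S2 \<equiv> spline2 n u"
abbreviation "S3 \<equiv> spline3 n u"

text \<open>The fourth derivative that the differential equation would assign to the spline data at
  node \<open>i\<close>.\<close>

definition R :: "nat \<Rightarrow> real" where
  "R i = f (node n i) - D (node n i) * S3 i - A (node n i) * S2 i
     - (deriv01 A (node n i) + H (node n i)) * m i - B (node n i) * u i"

definition E :: real where "E = 1 + C\<^sup>2"
text \<open>One constant that bounds \<open>v\<close> away from the ends and serves as Lipschitz
  constant of all four profiles. \<open>Q * (1 + 200 * E)\<close> bounds \<open>R\<close>, which has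
  four products of size \<open>Q * (50 * E)\<close>; \<open>Q * C\<close> bounds the defect
  \<open>v - R\<close>; \<open>100 * E\<close> covers the steps of \<open>u\<close>, where the slope
  and the second derivative contribute \<open>50 * E\<close> each.\<close>

definition L :: real where "L = Q * (1 + 200 * E) + Q * C + 100 * E"

lemma h: "h > 0"
  using n by (intro mesh_pos) auto

lemma E: "E \<ge> 1"
  by (simp add: E_def)

lemma Q0: "Q \<ge> 0"
  using Q(1)[of 0] by auto

lemma C0: "C \<ge> 0"
proof -
  have "0 \<le> norm_h n v"
    using h by (simp add: norm_h_def inner_h_def sum_nonneg)
  then show ?thesis using C by linarith
qed

lemma L: "L \<ge> 100 * E" "L \<ge> 0"
proof -
  have "0 \<le> Q * (1 + 200 * E)" "0 \<le> Q * C" using Q0 C0 E by simp_all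
  then show "L \<ge> 100 * E" "L \<ge> 0" using E by (simp_all only: L_def)
qed

lemma bounds:
  "j < n \<Longrightarrow> \<bar>S3 j\<bar> \<le> 50 * E" "j \<le> n \<Longrightarrow> \<bar>S2 j\<bar> \<le> 50 * E"
  "j \<le> n \<Longrightarrow> \<bar>m j\<bar> \<le> 50 * E" "j \<le> n \<Longrightarrow> \<bar>u j\<bar> \<le> 50 * E"
  unfolding E_def using n by (intro spline_bounds[OF u C]; simp)+

lemma hv: "j \<le> n \<Longrightarrow> \<bar>h * v j\<bar> \<le> C * sqrt h"
  using h_delta_x4_bound[OF C] n by auto

text \<open>The equation and \<open>R\<close> differ by the corrections of the third and second
  discrete derivatives. These are multiples of \<open>h * v\<close> at \<open>i - 1\<close>,
  \<open>i\<close> and \<open>i + 1\<close>, each at most \<open>C * sqrt h\<close>. The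
  coefficients 1/2 + 1/24 + 1/24 = 7/12 and 1/12 add up to less than 1.\<close>

lemma consistency:
  assumes "2 \<le> i" "i + 2 \<le> n"
  shows "\<bar>v i - R i\<bar> \<le> Q * C * sqrt h"
proof -
  let ?x = "node n i"
  have x: "?x \<in> {0..1}" using assms by (intro node_in_unit) auto
  define a b where "a = h / 2 * v i + h / 24 * (v (Suc i) - v (i - 1))" and "b = - (h\<^sup>2 / 12 * v i)"
  have 3: "delta_x3 n A D f u i = S3 i - a"
    using delta_x3_spline[OF assms, of A D f u] unfolding a_def by linarith
  have i: "Suc (i - 1) = i" "i \<noteq> n" "i \<noteq> 0" "i < n" using assms by auto
  have "delta_x2_tilde_interior n u i = S2 i - b"
    using delta_x2_tilde_interior_spline[of "i - 1" n u] unfolding i(1) b_def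
    using i(4) by linarith
  then have 2: "delta_x2_tilde n A D f u i = S2 i - b"
    using i(2-4) by (simp add: delta_x2_tilde_def)
  have "i \<in> {1..n - 1}" using i by simp
  from bspec[OF eq this]
  have f: "f ?x = v i + D ?x * (S3 i - a) + A ?x * (S2 i - b)
      + (deriv01 A ?x + H ?x) * m i + B ?x * u i"
    unfolding 2 3 by (rule sym)
  have d: "v i - R i = D ?x * a + A ?x * b"
    unfolding R_def f by (simp add: algebra_simps)
  have hv': "\<bar>h * v i\<bar> \<le> C * sqrt h" "\<bar>h * v (Suc i)\<bar> \<le> C * sqrt h" "\<bar>h * v (i - 1)\<bar> \<le> C * sqrt h"
    using assms by (intro hv; simp)+
  moreover have "a = (h * v i) / 2 + (h * v (Suc i)) / 24 - (h * v (i - 1)) / 24"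
    by (simp add: a_def algebra_simps)
  ultimately have a: "\<bar>a\<bar> \<le> 7 / 12 * (C * sqrt h)"
    by linarith
  have "\<bar>b\<bar> = h * \<bar>h * v i\<bar> / 12" using h by (simp add: b_def abs_mult power2_eq_square)
  also have "\<dots> \<le> 1 * (C * sqrt h) / 12"
    using h mesh_le_1[of n] hv' by (intro divide_right_mono mult_mono) auto
  finally have b: "\<bar>b\<bar> \<le> 1 / 12 * (C * sqrt h)" by simp
  have "\<bar>D ?x * a\<bar> \<le> Q * (7 / 12 * (C * sqrt h))" "\<bar>A ?x * b\<bar> \<le> Q * (1 / 12 * (C * sqrt h))"
    unfolding abs_mult using a b Q x Q0 by (intro mult_mono; simp)+
  moreover have "0 \<le> Q * (C * sqrt h)" using Q0 C0 h by simp
  ultimately show ?thesis unfolding d mult.assoc by linarith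
qed

text \<open>Bootstrap: the lower order terms are already bounded, so the equation turns the mean
  square bound into a pointwise one.\<close>

lemma v_bound:
  assumes "2 \<le> i" "i + 2 \<le> n"
  shows "\<bar>v i\<bar> \<le> L"
proof -
  let ?x = "node n i"
  have x: "?x \<in> {0..1}" using assms by (intro node_in_unit) auto
  have "\<bar>D ?x * S3 i\<bar> \<le> Q * (50 * E)" "\<bar>A ?x * S2 i\<bar> \<le> Q * (50 * E)"
    "\<bar>(deriv01 A ?x + H ?x) * m i\<bar> \<le> Q * (50 * E)" "\<bar>B ?x * u i\<bar> \<le> Q * (50 * E)"
    unfolding abs_mult using assms by (auto intro!: mult_mono Q[OF x] bounds Q0)
  then have "\<bar>R i\<bar> \<le> Q + 4 * (Q * (50 * E))"
    using Q(5)[OF x] unfolding R_def by linarith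
  moreover have "Q * C * sqrt h \<le> Q * C * 1"
    using mesh_le_1[of n] h Q0 C0 by (intro mult_left_mono) auto
  ultimately have "\<bar>v i\<bar> \<le> Q + 4 * (Q * (50 * E)) + Q * C"
    using consistency[OF assms] by linarith
  moreover have "L = Q + 4 * (Q * (50 * E)) + Q * C + 100 * E"
    by (simp add: L_def algebra_simps)
  ultimately show ?thesis using E by linarith
qed

text \<open>In this range the clamping leaves both \<open>i\<close> and \<open>Suc i\<close>
  unchanged, and \<open>Suc i\<close> lies between 2 and \<open>n - 2\<close>, where
  \<open>v_bound\<close> applies. All other steps vanish.\<close>

lemma spline3_inner_step:
  assumes "1 \<le> i" "i + 3 \<le> n"
  shows "spline3_inner n u (Suc i) - spline3_inner n u i = h * v (Suc i)"
proof -
  have "max 1 (min (Suc i) (n - 2)) = Suc i" "max 1 (min i (n - 2)) = i"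
    using assms by auto
  then show ?thesis using spline3_step[of i n u] assms by (simp add: spline3_inner_def)
qed

lemma spline3_inner_step_end:
  assumes "\<not> (1 \<le> i \<and> i + 3 \<le> n)"
  shows "spline3_inner n u (Suc i) = spline3_inner n u i"
proof -
  have "max 1 (min (Suc i) (n - 2)) = max 1 (min i (n - 2))" using assms n by auto
  then show ?thesis by (simp add: spline3_inner_def)
qed

text \<open>Clamping moves an index below \<open>n\<close> by at most one cell, so at most one jump
  \<open>h * v\<close> is lost.\<close>

lemma spline3_inner_diff:
  assumes "i < n"
  shows "\<bar>spline3_inner n u i - S3 i\<bar> \<le> C * sqrt h"
proof -
  consider "i = 0" | "i = n - 1" | "1 \<le> i" "i \<le> n - 2" using assms n by linarith
  then show ?thesis
  proof cases
    case 1
    then show ?thesis using spline3_step[of 0 n u] hv[of 1] n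
      by (simp add: spline3_inner_def)
  next
    case 2
    then have "max 1 (min i (n - 2)) = n - 2" "Suc (n - 2) = i" "i \<le> n" using n by auto
    then show ?thesis using spline3_step[of "n - 2" n u] hv[of i] n assms
      by (simp add: spline3_inner_def)
  next
    case 3
    then have "max 1 (min i (n - 2)) = i" by auto
    then show ?thesis using C0 h by (simp add: spline3_inner_def)
  qed
qed

lemma spline3_inner_bound: "\<bar>spline3_inner n u i\<bar> \<le> 50 * E"
  unfolding spline3_inner_def using n by (intro bounds) auto

lemma step_bounds:
  assumes "i < n"
  shows "\<bar>u (Suc i) - u i\<bar> \<le> L * h" "\<bar>m (Suc i) - m i\<bar> \<le> L * h"
    "\<bar>S2 (Suc i) - S2 i\<bar> \<le> L * h"
    "\<bar>spline3_inner n u (Suc i) - spline3_inner n u i\<bar> \<le> L * h"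
proof -
  have *: "\<bar>h * x\<bar> \<le> L * h" if "\<bar>x\<bar> \<le> L" for x
    using that h by (simp add: abs_mult)
  have e: "u (Suc i) - u i = h * (m i + h * (2 * S2 i + S2 (Suc i)) / 6)"
    using spline_step[OF assms, of u] by (simp add: algebra_simps power2_eq_square)
  have "\<bar>h * (2 * S2 i + S2 (Suc i)) / 6\<bar> \<le> 50 * E"
  proof -
    have "\<bar>h * (2 * S2 i + S2 (Suc i)) / 6\<bar> = h * (\<bar>2 * S2 i + S2 (Suc i)\<bar> / 6)"
      using h by (simp add: abs_mult)
    also have "\<dots> \<le> 1 * (\<bar>2 * S2 i + S2 (Suc i)\<bar> / 6)"
      using mesh_le_1 by (intro mult_right_mono) auto
    also have "\<dots> \<le> 50 * E"
      using bounds(2)[of i] bounds(2)[of "Suc i"] assms E by simp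
    finally show ?thesis .
  qed
  moreover have "\<bar>m i\<bar> \<le> 50 * E" using bounds[of i] assms by simp
  ultimately have "\<bar>m i + h * (2 * S2 i + S2 (Suc i)) / 6\<bar> \<le> L" using L by linarith
  then show "\<bar>u (Suc i) - u i\<bar> \<le> L * h" unfolding e by (rule *)
  have e: "m (Suc i) - m i = h * ((S2 i + S2 (Suc i)) / 2)"
    using hermite_deriv_step[OF assms, of u] by simp
  have "\<bar>S2 i\<bar> \<le> 50 * E" "\<bar>S2 (Suc i)\<bar> \<le> 50 * E"
    using bounds(2)[of i] bounds(2)[of "Suc i"] assms by simp_all
  then have "\<bar>S2 i + S2 (Suc i)\<bar> \<le> 2 * L" using L E by linarith
  then have "\<bar>(S2 i + S2 (Suc i)) / 2\<bar> \<le> L" by simp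
  then show "\<bar>m (Suc i) - m i\<bar> \<le> L * h" unfolding e by (rule *)
  have e: "S2 (Suc i) - S2 i = h * S3 i"
    using spline2_step[of n u i] assms by simp
  have "\<bar>S3 i\<bar> \<le> L" using bounds(1)[OF assms] L E by linarith
  then show "\<bar>S2 (Suc i) - S2 i\<bar> \<le> L * h" unfolding e by (rule *)
  show "\<bar>spline3_inner n u (Suc i) - spline3_inner n u i\<bar> \<le> L * h"
  proof (cases "1 \<le> i \<and> i + 3 \<le> n")
    case True
    then show ?thesis using spline3_inner_step[of i] *[OF v_bound[of "Suc i"]] by simp
  next
    case False
    then show ?thesis using spline3_inner_step_end[OF False] L h by simp
  qed
qed

end

section \<open>Piecewise linear interpolation and limits of difference quotients\<close>

lemma node_eq: "n > 0 \<Longrightarrow> node n j = real j / real n"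
  by (simp add: node_def mesh_def)

lemma piecewise_linear_node: "n > 0 \<Longrightarrow> piecewise_linear n z (node n j) = z j"
  by (simp add: piecewise_linear_def node_eq)

lemma cell_index:
  assumes "n > 0" "x \<in> {0..<1}"
  defines "i \<equiv> nat \<lfloor>real n * x\<rfloor>"
  shows "i < n" "node n i \<le> x" "x < node n (Suc i)" "0 \<le> real n * x - real i" "real n * x - real i \<le> 1"
proof -
  have nn: "0 \<le> real n * x" using assms by simp
  then have "real i \<le> real n * x" "real n * x < real i + 1"
    unfolding i_def by linarith+
  moreover have "real n * x < real n" using assms by simp
  then have "real i < real n" using calculation(1) by linarith
  ultimately show "i < n" "node n i \<le> x" "x < node n (Suc i)"
    "0 \<le> real n * x - real i" "real n * x - real i \<le> 1"
    using assms(1) by (auto simp: node_eq field_simps)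
qed

text \<open>At \<open>x = 1\<close> the floor selects index \<open>n\<close>, which has no cell to
  its right; the last cell with \<open>t = 1\<close> replaces it. So the interpolant is always a
  convex combination on a cell with \<open>i < n\<close>, the same cell for every
  \<open>z\<close>.\<close>

lemma cell_cases:
  assumes "n > 0" "x \<in> {0..1}"
  obtains i t where "i < n" "t \<in> {0..1}" "x = node n i + t * mesh n"
    "\<And>z. piecewise_linear n z x = z i + t * (z (Suc i) - z i)"
proof (cases "x = 1")
  case True
  have "piecewise_linear n z x = z n" for z
    using piecewise_linear_node[OF assms(1), of z n] assms True by simp
  then have "piecewise_linear n z x = z (n - 1) + 1 * (z (Suc (n - 1)) - z (n - 1))" for z
    using assms by simp
  moreover have "x = node n (n - 1) + 1 * mesh n"
    using node_Suc[of n "n - 1"] assms True by simp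
  ultimately show ?thesis using that[of "n - 1" 1] assms by simp
next
  case False
  then have x: "x \<in> {0..<1}" using assms by auto
  let ?i = "nat \<lfloor>real n * x\<rfloor>"
  show ?thesis
  proof (rule that[of ?i "real n * x - real ?i"])
    show "x = node n ?i + (real n * x - real ?i) * mesh n"
      using assms(1) by (simp add: node_def mesh_def field_simps)
  qed (use cell_index[OF assms(1) x] in \<open>auto simp: piecewise_linear_def Let_def\<close>)
qed

lemma piecewise_linear_bounded:
  assumes "n > 0" "x \<in> {0..1}" "\<And>j. j \<le> n \<Longrightarrow> \<bar>z j\<bar> \<le> K"
  shows "\<bar>piecewise_linear n z x\<bar> \<le> K"
proof -
  obtain i t where i: "i < n" "t \<in> {0..1}" "piecewise_linear n z x = z i + t * (z (Suc i) - z i)"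
    using cell_cases[OF assms(1,2)] by metis
  have "z i + t * (z (Suc i) - z i) = (1 - t) * z i + t * z (Suc i)" by (simp add: algebra_simps)
  also have "\<bar>\<dots>\<bar> \<le> (1 - t) * \<bar>z i\<bar> + t * \<bar>z (Suc i)\<bar>"
    using i(2) by (intro order_trans[OF abs_triangle_ineq]) (simp add: abs_mult)
  also have "\<dots> \<le> (1 - t) * K + t * K"
    using i assms(3)[of i] assms(3)[of "Suc i"] by (intro add_mono mult_left_mono) auto
  finally show ?thesis using i(3) by (simp add: algebra_simps)
qed

lemma piecewise_linear_close:
  assumes "n > 0" "x \<in> {0..1}"
  obtains i where "i < n" "node n i \<le> x" "x \<le> node n (Suc i)"
    "\<And>z y e. \<bar>z i - y\<bar> \<le> e \<Longrightarrow> \<bar>z (Suc i) - y\<bar> \<le> e \<Longrightarrow> \<bar>piecewise_linear n z x - y\<bar> \<le> e"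
proof -
  obtain i t where i: "i < n" "t \<in> {0..1}" "x = node n i + t * mesh n"
    "\<And>z. piecewise_linear n z x = z i + t * (z (Suc i) - z i)"
    using cell_cases[OF assms(1,2)] by metis
  have h: "mesh n > 0" using assms by (intro mesh_pos)
  have "\<bar>piecewise_linear n z x - y\<bar> \<le> e" if "\<bar>z i - y\<bar> \<le> e" "\<bar>z (Suc i) - y\<bar> \<le> e" for z y e
  proof -
    have "piecewise_linear n z x - y = (1 - t) * (z i - y) + t * (z (Suc i) - y)"
      unfolding i(4) by (simp add: algebra_simps)
    also have "\<bar>\<dots>\<bar> \<le> (1 - t) * \<bar>z i - y\<bar> + t * \<bar>z (Suc i) - y\<bar>"
      using i(2) by (intro order_trans[OF abs_triangle_ineq]) (simp add: abs_mult)
    also have "\<dots> \<le> (1 - t) * e + t * e"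
      using i that by (intro add_mono mult_left_mono) auto
    finally show ?thesis by (simp add: algebra_simps)
  qed
  moreover have "node n i \<le> x" "x \<le> node n (Suc i)"
    using i h by (auto simp: node_Suc mult_left_le_one_le)
  ultimately show ?thesis using that i(1) by blast
qed

section \<open>Lipschitz bounds and continuity of the interpolants\<close>

lemma nodes_lipschitz:
  assumes "n > 0" "\<And>i. i < n \<Longrightarrow> \<bar>z (Suc i) - z i\<bar> \<le> L * mesh n" "i \<le> j" "j \<le> n"
  shows "\<bar>z j - z i\<bar> \<le> L * (node n j - node n i)"
  using assms(3,4)
proof (induction j rule: dec_induct)
  case (step j)
  then have "\<bar>z j - z i\<bar> \<le> L * (node n j - node n i)" "\<bar>z (Suc j) - z j\<bar> \<le> L * mesh n"
    using assms(2) by auto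
  then show ?case unfolding node_Suc by (simp add: algebra_simps)
qed simp

lemma piecewise_linear_lipschitz:
  assumes "n > 0" and L: "\<And>i. i < n \<Longrightarrow> \<bar>z (Suc i) - z i\<bar> \<le> L * mesh n"
    and x: "x \<in> {0..1}" and y: "y \<in> {0..1}"
  shows "\<bar>piecewise_linear n z x - piecewise_linear n z y\<bar> \<le> L * \<bar>x - y\<bar>"
proof -
  have h: "mesh n > 0" using assms by (intro mesh_pos)
  have *: "\<bar>piecewise_linear n z y - piecewise_linear n z x\<bar> \<le> L * (y - x)"
    if x: "x \<in> {0..1}" and y: "y \<in> {0..1}" and "x \<le> y" for x y
  proof -
    obtain i t where i: "i < n" "t \<in> {0..1}" "x = node n i + t * mesh n"
      "piecewise_linear n z x = z i + t * (z (Suc i) - z i)"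
      using cell_cases[OF assms(1) x] by metis
    obtain j s where j: "j < n" "s \<in> {0..1}" "y = node n j + s * mesh n"
      "piecewise_linear n z y = z j + s * (z (Suc j) - z j)"
      using cell_cases[OF assms(1) y] by metis
    consider "i = j" | "i < j" | "j < i" by linarith
    then show ?thesis
    proof cases
      case 1
      then have "(s - t) * mesh n \<ge> 0" using i j \<open>x \<le> y\<close> by (simp add: algebra_simps)
      then have "s \<ge> t" using h by (simp add: zero_le_mult_iff)
      have "piecewise_linear n z y - piecewise_linear n z x = (s - t) * (z (Suc i) - z i)"
        using i j 1 by (simp add: algebra_simps)
      also have "\<bar>\<dots>\<bar> \<le> (s - t) * (L * mesh n)"
        using L[OF i(1)] \<open>s \<ge> t\<close> by (simp add: abs_mult mult_left_mono)
      also have "\<dots> = L * (y - x)" using i j 1 by (simp add: algebra_simps)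
      finally show ?thesis .
    next
      case 2
      have "\<bar>(1 - t) * (z (Suc i) - z i)\<bar> \<le> (1 - t) * (L * mesh n)"
        using L[OF i(1)] i(2) by (simp add: abs_mult mult_left_mono)
      moreover have "\<bar>s * (z (Suc j) - z j)\<bar> \<le> s * (L * mesh n)"
        using L[OF j(1)] j(2) by (simp add: abs_mult mult_left_mono)
      moreover have "\<bar>z j - z (Suc i)\<bar> \<le> L * (node n j - node n (Suc i))"
        using nodes_lipschitz[where z=z and L=L, OF assms(1) L, of "Suc i" j] 2 j(1) by simp
      moreover have "piecewise_linear n z y - piecewise_linear n z x
        = s * (z (Suc j) - z j) + (z j - z (Suc i)) + (1 - t) * (z (Suc i) - z i)"
        unfolding i(4) j(4) by (simp add: algebra_simps)
      ultimately have "\<bar>piecewise_linear n z y - piecewise_linear n z x\<bar>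
        \<le> s * (L * mesh n) + L * (node n j - node n (Suc i)) + (1 - t) * (L * mesh n)"
        by linarith
      also have "\<dots> = L * (y - x)" unfolding i(3) j(3) node_Suc by (simp add: algebra_simps)
      finally show ?thesis .
    next
      case 3
      \<comment> \<open>\<open>cell_cases\<close> does not say which neighbouring cell it returns at
        a node, so \<open>j < i\<close> is compatible with \<open>x \<le> y\<close>; then both
        points are the same node.\<close>
      then have "node n (Suc j) \<le> node n i" using h by (simp add: node_def)
      moreover have "0 \<le> t * mesh n" "s * mesh n \<le> mesh n" using i j h by auto
      ultimately have "y \<le> x" "node n i \<le> x" "y \<le> node n (Suc j)"
        unfolding i(3) j(3) node_Suc by linarith+
      then have "x = y" using \<open>x \<le> y\<close> by simp
      then show ?thesis by simp
    qed
  qed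
  show ?thesis
  proof (cases "x \<le> y")
    case True then show ?thesis using *[OF x y] by (simp add: abs_minus_commute)
  next
    case False then show ?thesis using *[OF y x] by simp
  qed
qed

lemma continuous_on_piecewise_linear:
  assumes "n > 0"
  shows "continuous_on {0..1} (piecewise_linear n z)"
proof -
  \<comment> \<open>A crude constant: the total variation divided by the mesh size bounds every
    single slope.\<close>
  define L where "L = (\<Sum>i<n. \<bar>z (Suc i) - z i\<bar>) / mesh n"
  have h: "mesh n > 0" using assms by (intro mesh_pos)
  have "\<bar>z (Suc i) - z i\<bar> \<le> L * mesh n" if "i < n" for i
    using h that by (auto simp: L_def intro: member_le_sum)
  then have "\<bar>piecewise_linear n z x - piecewise_linear n z y\<bar> \<le> L * \<bar>x - y\<bar>"
    if "x \<in> {0..1}" "y \<in> {0..1}" for x y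
    using piecewise_linear_lipschitz[OF assms _ that] by blast
  moreover have "L \<ge> 0" unfolding L_def using h by (simp add: sum_nonneg)
  ultimately have "L-lipschitz_on {0..1} (piecewise_linear n z)"
    by (intro lipschitz_onI) (auto simp: dist_real_def)
  then show ?thesis by (rule lipschitz_on_continuous_on)
qed

text \<open>Convergence is measured at the nodes only, since that is where the difference equations
  hold.\<close>

definition node_limit :: "(nat \<Rightarrow> nat) \<Rightarrow> (nat \<Rightarrow> nat \<Rightarrow> real) \<Rightarrow> (real \<Rightarrow> real) \<Rightarrow> bool" where
  "node_limit N Y y \<longleftrightarrow>
     (\<forall>e>0. \<forall>\<^sub>F k in sequentially. \<forall>j\<le>N k. \<bar>Y k j - y (node (N k) j)\<bar> \<le> e)"

lemma node_limit_piecewise_linear: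
  assumes "\<And>k. N k > 0"
    and "uniform_limit {0..1} (\<lambda>k. piecewise_linear (N k) (Y k)) y sequentially"
  shows "node_limit N Y y"
  unfolding node_limit_def
proof (intro allI impI)
  fix e :: real assume "e > 0"
  from uniform_limitD[OF assms(2) this]
  show "\<forall>\<^sub>F k in sequentially. \<forall>j\<le>N k. \<bar>Y k j - y (node (N k) j)\<bar> \<le> e"
  proof eventually_elim
    case (elim k)
    show ?case
    proof (intro allI impI)
      fix j assume "j \<le> N k"
      then have "dist (piecewise_linear (N k) (Y k) (node (N k) j)) (y (node (N k) j)) < e"
        using elim node_in_unit by blast
      then show "\<bar>Y k j - y (node (N k) j)\<bar> \<le> e"
        using assms(1) by (simp add: piecewise_linear_node dist_real_def)
    qed
  qed
qed

section \<open>From difference equations to derivatives of the limit\<close>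

lemma mesh_tendsto_0:
  assumes "filterlim N at_top sequentially"
  shows "(\<lambda>k. mesh (N k)) \<longlonglongrightarrow> 0"
  unfolding mesh_def using assms
  by (intro tendsto_divide_0[OF tendsto_const] filterlim_at_top_imp_at_infinity
      filterlim_compose[OF filterlim_real_sequentially])

lemma continuous_bounded01:
  fixes g :: "real \<Rightarrow> real"
  assumes "continuous_on {0..1} g"
  obtains K where "\<And>x. x \<in> {0..1} \<Longrightarrow> \<bar>g x\<bar> \<le> K"
proof -
  have "bounded (g ` {0..1})"
    using compact_continuous_image[OF assms] by (intro compact_imp_bounded) auto
  then obtain K where "\<forall>y\<in>g ` {0..1}. norm y \<le> K" unfolding bounded_iff by blast
  then have "\<bar>g x\<bar> \<le> K" if "x \<in> {0..1}" for x using that by simp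
  then show ?thesis by (rule that)
qed

lemma antiderivative01:
  assumes "continuous_on {0..1} \<phi>"
  obtains \<Phi> where "\<And>x. x \<in> {0..1} \<Longrightarrow> (\<Phi> has_real_derivative \<phi> x) (at x within {0..1})"
  using antiderivative_continuous[OF assms] has_real_derivative_iff_has_vector_derivative by metis

text \<open>The exceptional indices absorb the two boundary layers of the third derivative.\<close>

lemma discrete_antiderivative_limit:
  assumes N: "filterlim N at_top sequentially" "\<And>k. N k > 0"
    and lim: "node_limit N Y y" and y: "continuous_on {0..1} y" and \<phi>: "continuous_on {0..1} \<phi>"
    and step: "\<And>e. e > 0 \<Longrightarrow> \<forall>\<^sub>F k in sequentially. \<forall>i<N k.
      \<bar>Y k (Suc i) - Y k i - mesh (N k) * \<phi> (node (N k) i)\<bar>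
        \<le> mesh (N k) * e + (if i = 0 \<or> N k \<le> i + 2 then mesh (N k) * K else 0)"
    and x: "x \<in> {0..1}"
  shows "(y has_real_derivative \<phi> x) (at x within {0..1})"
proof -
  obtain \<Phi> where \<Phi>: "\<And>x. x \<in> {0..1} \<Longrightarrow> (\<Phi> has_real_derivative \<phi> x) (at x within {0..1})"
    using antiderivative01[OF \<phi>] by blast
  then have c\<Phi>: "continuous_on {0..1} \<Phi>"
    by (meson DERIV_continuous continuous_on_eq_continuous_within)
  \<comment> \<open>\<open>\<Phi>\<close> obeys the same difference scheme up to o(h) per step, so
    the total increments of \<open>w\<close> vanish in the limit and \<open>w\<close> turns out to
    be constant.\<close>
  define w where "w = (\<lambda>x. y x - \<Phi> x)"
  have cw: "continuous_on {0..1} w" unfolding w_def by (intro continuous_intros y c\<Phi>)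
  have h: "mesh (N k) > 0" for k using N(2) by (rule mesh_pos)
  have h0: "(\<lambda>k. mesh (N k)) \<longlonglongrightarrow> 0" by (rule mesh_tendsto_0[OF N(1)])
  \<comment> \<open>Five errors: two for replacing \<open>Y k j\<close> and \<open>Y k 0\<close> by
    values of \<open>y\<close>, two accumulated over the steps (one from the scheme, one from the
    mean value theorem), and one from the exceptional indices.\<close>
  have small: "\<forall>\<^sub>F k in sequentially. \<forall>j\<le>N k. \<bar>w (node (N k) j) - w 0\<bar> \<le> 5 * e" if "e > 0" for e
  proof -
    have "uniformly_continuous_on {0..1} \<phi>" using \<phi> by (intro compact_uniformly_continuous) auto
    then obtain d where d: "d > 0" "\<And>x y. x \<in> {0..1} \<Longrightarrow> y \<in> {0..1} \<Longrightarrow> dist y x < d \<Longrightarrow> dist (\<phi> y) (\<phi> x) < e"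
      using \<open>e > 0\<close> unfolding uniformly_continuous_on_def by metis
    have "\<forall>\<^sub>F k in sequentially. mesh (N k) < d"
      using h0 d(1) by (rule order_tendstoD)
    moreover have "\<forall>\<^sub>F k in sequentially. 3 * (mesh (N k) * \<bar>K\<bar>) < e"
    proof -
      have "(\<lambda>k. 3 * (mesh (N k) * \<bar>K\<bar>)) \<longlonglongrightarrow> 3 * (0 * \<bar>K\<bar>)" by (intro tendsto_intros h0)
      then show ?thesis using \<open>e > 0\<close> by (intro order_tendstoD) auto
    qed
    moreover note step[OF \<open>e > 0\<close>]
    moreover have "\<forall>\<^sub>F k in sequentially. \<forall>j\<le>N k. \<bar>Y k j - y (node (N k) j)\<bar> \<le> e"
      using lim \<open>e > 0\<close> unfolding node_limit_def by blast
    ultimately show ?thesis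
    proof eventually_elim
      case (elim k)
      let ?h = "mesh (N k)" and ?x = "node (N k)"
      let ?r = "\<lambda>i. if i = 0 \<or> N k \<le> i + 2 then ?h * \<bar>K\<bar> else 0"
      have inc: "\<bar>(Y k (Suc i) - \<Phi> (?x (Suc i))) - (Y k i - \<Phi> (?x i))\<bar> \<le> 2 * (?h * e) + ?r i"
        if "i < N k" for i
      proof -
        have sub: "{?x i..?x (Suc i)} \<subseteq> {0..1}"
          using node_in_unit[of i "N k"] node_in_unit[of "Suc i" "N k"] that by auto
        have "\<exists>z\<in>{?x i<..<?x (Suc i)}. \<Phi> (?x (Suc i)) - \<Phi> (?x i) = \<phi> z * (?x (Suc i) - ?x i)"
        proof (rule mvt_simple)
          show "?x i < ?x (Suc i)" using h by (simp add: node_Suc)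
          fix z assume "?x i \<le> z" "z \<le> ?x (Suc i)"
          then have "z \<in> {0..1}" using sub by auto
          then show "(\<Phi> has_derivative (\<lambda>t. \<phi> z * t)) (at z within {?x i..?x (Suc i)})"
            using has_derivative_subset[OF \<Phi>[unfolded has_field_derivative_def] sub] by simp
        qed
        then obtain z where z: "?x i < z" "z < ?x (Suc i)" "\<Phi> (?x (Suc i)) - \<Phi> (?x i) = ?h * \<phi> z"
          by (auto simp: node_Suc mult.commute)
        have "dist (\<phi> z) (\<phi> (?x i)) < e"
          using d(2)[of "?x i" z] z sub elim(1) node_in_unit[of i "N k"] that
          by (auto simp: dist_real_def node_Suc)
        then have "\<bar>?h * (\<phi> z - \<phi> (?x i))\<bar> \<le> ?h * e"
          using h[of k] by (simp add: abs_mult dist_real_def)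
        moreover have "\<bar>Y k (Suc i) - Y k i - ?h * \<phi> (?x i)\<bar> \<le> ?h * e + ?r i"
        proof -
          have "?h * K \<le> ?h * \<bar>K\<bar>" using h[of k] by (intro mult_left_mono) auto
          then show ?thesis using elim(3)[rule_format, OF that] by (auto split: if_splits)
        qed
        ultimately show ?thesis using z(3) by (simp add: algebra_simps)
      qed
      have sum: "\<bar>(Y k j - \<Phi> (?x j)) - (Y k 0 - \<Phi> 0)\<bar> \<le> 2 * (?x j * e) + (\<Sum>i<j. ?r i)"
        if "j \<le> N k" for j
        using that
      proof (induction j)
        case (Suc j)
        then show ?case using inc[of j] by (simp add: node_Suc algebra_simps)
      qed simp
      show ?case
      proof (intro allI impI)
        fix j assume j: "j \<le> N k"
        have "(\<Sum>i<j. ?r i) \<le> (\<Sum>i<N k. ?r i)"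
          using j h[of k] by (intro sum_mono2) auto
        also have "\<dots> = (\<Sum>i\<in>{i\<in>{..<N k}. i = 0 \<or> N k \<le> i + 2}. ?h * \<bar>K\<bar>)"
          by (intro sum.inter_filter[symmetric]) auto
        \<comment> \<open>Only three steps are exceptional, so their total is O(h).\<close>
        also have "\<dots> \<le> (\<Sum>i\<in>{0, N k - 2, N k - 1}. ?h * \<bar>K\<bar>)"
          using h[of k] by (intro sum_mono2) auto
        also have "\<dots> \<le> 3 * (?h * \<bar>K\<bar>)"
        proof -
          have "card {0, N k - 2, N k - 1} \<le> 3" by (simp add: card_insert_if)
          then show ?thesis using h[of k] by (simp add: mult_right_mono)
        qed
        finally have 1: "(\<Sum>i<j. ?r i) \<le> e" using elim(2) by simp
        have "?x j * e \<le> 1 * e" using node_in_unit[OF j] \<open>e > 0\<close> by (intro mult_right_mono) auto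
        then have "\<bar>(Y k j - \<Phi> (?x j)) - (Y k 0 - \<Phi> 0)\<bar> \<le> 3 * e"
          using sum[OF j] 1 by linarith
        moreover have "\<bar>Y k j - y (?x j)\<bar> \<le> e" "\<bar>Y k 0 - y 0\<bar> \<le> e"
          using elim(4)[rule_format, OF j] elim(4)[rule_format, of 0] by simp_all
        ultimately show "\<bar>w (?x j) - w 0\<bar> \<le> 5 * e" unfolding w_def by linarith
      qed
    qed
  qed
  \<comment> \<open>The nodes just below \<open>x\<close> tend to \<open>x\<close>, and
    \<open>w\<close> is continuous. The point 1 lies in no half-open cell and is added afterwards by
    closure.\<close>
  have const: "w x = w 0" if x: "x \<in> {0..<1}" for x
  proof -
    define j where "j = (\<lambda>k. nat \<lfloor>real (N k) * x\<rfloor>)"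
    have "(\<lambda>k. x - node (N k) (j k)) \<longlonglongrightarrow> 0"
    proof (rule tendsto_sandwich[OF _ _ tendsto_const h0])
      show "\<forall>\<^sub>F k in sequentially. 0 \<le> x - node (N k) (j k)"
        using cell_index(2)[OF N(2) x] by (simp add: j_def)
      show "\<forall>\<^sub>F k in sequentially. x - node (N k) (j k) \<le> mesh (N k)"
        using cell_index(3)[OF N(2) x] by (simp add: j_def node_Suc less_imp_le algebra_simps)
    qed
    then have "(\<lambda>k. x - (x - node (N k) (j k))) \<longlonglongrightarrow> x - 0" by (intro tendsto_intros)
    then have lim: "(\<lambda>k. node (N k) (j k)) \<longlonglongrightarrow> x" by simp
    have j_le: "j k \<le> N k" for k using cell_index(1)[OF N(2) x, of k] by (simp add: j_def)
    have "(\<lambda>k. w (node (N k) (j k))) \<longlonglongrightarrow> w x"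
      using cw lim x node_in_unit[OF j_le] by (intro continuous_on_tendsto_compose[OF cw]) auto
    moreover have "(\<lambda>k. w (node (N k) (j k))) \<longlonglongrightarrow> w 0"
    proof (rule tendstoI)
      fix e :: real assume "e > 0"
      then have "\<forall>\<^sub>F k in sequentially. \<forall>j\<le>N k. \<bar>w (node (N k) j) - w 0\<bar> \<le> 5 * (e / 6)"
        by (intro small) auto
      then show "\<forall>\<^sub>F k in sequentially. dist (w (node (N k) (j k))) (w 0) < e"
      proof eventually_elim
        case (elim k)
        then have "\<bar>w (node (N k) (j k)) - w 0\<bar> \<le> 5 * (e / 6)" using j_le by blast
        then show ?case using \<open>e > 0\<close> by (simp add: dist_real_def)
      qed
    qed
    ultimately show ?thesis using LIMSEQ_unique by blast
  qed
  have "w x = w 0" if "x \<in> {0..1}" for x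
  proof (rule continuous_constant_on_closure[of "{0..<1::real}" w "w 0"])
    show "continuous_on (closure {0..<1}) w" using cw by simp
    show "x \<in> closure {0..<1}" using that by simp
  qed (rule const)
  then have eq: "y x = \<Phi> x + w 0" if "x \<in> {0..1}" for x
    using that unfolding w_def by (metis add.commute diff_add_cancel)
  have "((\<lambda>x. \<Phi> x + w 0) has_real_derivative \<phi> x) (at x within {0..1})"
    using \<Phi>[OF x] by (auto intro!: derivative_eq_intros)
  then show ?thesis
    by (rule has_field_derivative_transform_within[where d=1]) (use x eq in auto)
qed

section \<open>Compactness\<close>

text \<open>Packing the four components into one vector lets a single compactness argument extract a
  common subsequence.\<close>

definition profile :: "nat \<Rightarrow> (nat \<Rightarrow> real) \<Rightarrow> real \<Rightarrow> real \<times> real \<times> real \<times> real" where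
  "profile n u x = (piecewise_linear n u x, piecewise_linear n (hermite_deriv n u) x,
     piecewise_linear n (spline2 n u) x, piecewise_linear n (spline3_inner n u) x)"

lemma norm_quadruple_le:
  "norm (a, b, c, d) \<le> \<bar>a\<bar> + \<bar>b\<bar> + \<bar>c\<bar> + \<bar>d\<bar>" for a b c d :: real
  using norm_Pair_le[of a "(b, c, d)"] norm_Pair_le[of b "(c, d)"] norm_Pair_le[of c d]
  by simp

context bounded_solution
begin

lemma profile_bound:
  assumes "x \<in> {0..1}"
  shows "norm (profile n u x) \<le> 200 * E"
proof -
  have "\<bar>piecewise_linear n u x\<bar> \<le> 50 * E" "\<bar>piecewise_linear n m x\<bar> \<le> 50 * E"
    "\<bar>piecewise_linear n S2 x\<bar> \<le> 50 * E" "\<bar>piecewise_linear n (spline3_inner n u) x\<bar> \<le> 50 * E"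
    using n assms by (auto intro!: piecewise_linear_bounded bounds spline3_inner_bound)
  then show ?thesis unfolding profile_def by (intro order_trans[OF norm_quadruple_le]) linarith
qed

lemma profile_lipschitz:
  assumes "x \<in> {0..1}" "y \<in> {0..1}"
  shows "norm (profile n u x - profile n u y) \<le> 4 * (L * \<bar>x - y\<bar>)"
proof -
  have "0 < n" using n by simp
  note lip = piecewise_linear_lipschitz[OF this _ assms, where L = L]
  have "\<bar>piecewise_linear n u x - piecewise_linear n u y\<bar> \<le> L * \<bar>x - y\<bar>"
    by (rule lip) (rule step_bounds)
  moreover have "\<bar>piecewise_linear n m x - piecewise_linear n m y\<bar> \<le> L * \<bar>x - y\<bar>"
    by (rule lip) (rule step_bounds)
  moreover have "\<bar>piecewise_linear n S2 x - piecewise_linear n S2 y\<bar> \<le> L * \<bar>x - y\<bar>"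
    by (rule lip) (rule step_bounds)
  moreover have "\<bar>piecewise_linear n (spline3_inner n u) x
      - piecewise_linear n (spline3_inner n u) y\<bar> \<le> L * \<bar>x - y\<bar>"
    by (rule lip) (rule step_bounds)
  ultimately show ?thesis
    unfolding profile_def diff_Pair by (intro order_trans[OF norm_quadruple_le]) linarith
qed

end

text \<open>The clamped fourth order problem as a first order system for \<open>a\<close> and its
  first three derivatives. Each component of the limit enters as a function of its own, so no
  iterated \<open>deriv01\<close> has to be identified while passing to the limit.\<close>

definition bvp_solution ::
  "(real \<Rightarrow> real) \<Rightarrow> (real \<Rightarrow> real) \<Rightarrow> (real \<Rightarrow> real) \<Rightarrow> (real \<Rightarrow> real) \<Rightarrow> (real \<Rightarrow> real)
    \<Rightarrow> (real \<Rightarrow> real) \<Rightarrow> (real \<Rightarrow> real) \<Rightarrow> (real \<Rightarrow> real) \<Rightarrow> (real \<Rightarrow> real) \<Rightarrow> bool" where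
  "bvp_solution A B D H f a b c d \<longleftrightarrow>
     (\<forall>x\<in>{0..1}. (a has_real_derivative b x) (at x within {0..1}) \<and>
        (b has_real_derivative c x) (at x within {0..1}) \<and>
        (c has_real_derivative d x) (at x within {0..1}) \<and>
        (d has_real_derivative f x - D x * d x - A x * c x - (deriv01 A x + H x) * b x - B x * a x)
          (at x within {0..1})) \<and>
     a 0 = 0 \<and> b 0 = 0 \<and> a 1 = 0 \<and> b 1 = 0"

lemma bvp_solution_continuous:
  assumes "bvp_solution A B D H f a b c d"
  shows "continuous_on {0..1} a" "continuous_on {0..1} b" "continuous_on {0..1} c"
    "continuous_on {0..1} d"
  using assms unfolding bvp_solution_def
  by (meson DERIV_continuous continuous_on_eq_continuous_within)+

locale bounded_solution_sequence =
  fixes A B D H f :: "real \<Rightarrow> real" and C Q :: real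
    and N :: "nat \<Rightarrow> nat" and u :: "nat \<Rightarrow> nat \<Rightarrow> real"
  assumes sol: "\<And>k. bounded_solution A B D H f C Q (N k) (u k)"
    and N: "strict_mono N"
    and cont: "continuous_on {0..1} A" "continuous_on {0..1} B" "continuous_on {0..1} D"
      "continuous_on {0..1} (\<lambda>x. deriv01 A x + H x)" "continuous_on {0..1} f"
begin

abbreviation "Y \<equiv> \<lambda>k. profile (N k) (u k)"

text \<open>Lets results stated for a convergent full sequence be instantiated along any extracted
  subsequence.\<close>

lemma subsequence:
  "strict_mono s \<Longrightarrow> bounded_solution_sequence A B D H f C Q (N \<circ> s) (u \<circ> s)"
  by (rule bounded_solution_sequence.intro) (simp_all add: sol N cont strict_mono_o)

lemma N_lim: "filterlim N at_top sequentially"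
  using N by (rule filterlim_subseq)

lemma N_pos: "N k > 0"
  using bounded_solution.n[OF sol, of k] by simp

lemma h_lim: "(\<lambda>k. mesh (N k)) \<longlonglongrightarrow> 0"
  using N_lim by (rule mesh_tendsto_0)

lemma eventually_h_small:
  assumes "e > 0"
  shows "\<forall>\<^sub>F k in sequentially. K * mesh (N k) \<le> e"
proof -
  have "(\<lambda>k. K * mesh (N k)) \<longlonglongrightarrow> K * 0" by (intro tendsto_intros h_lim)
  then have "\<forall>\<^sub>F k in sequentially. K * mesh (N k) < e"
    using assms by (intro order_tendstoD) auto
  then show ?thesis by eventually_elim simp
qed

lemma eventually_sqrt_h_small:
  assumes "e > 0"
  shows "\<forall>\<^sub>F k in sequentially. K * sqrt (mesh (N k)) \<le> e"
proof -
  have "(\<lambda>k. K * sqrt (mesh (N k))) \<longlonglongrightarrow> K * sqrt 0" by (intro tendsto_intros h_lim)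
  then have "\<forall>\<^sub>F k in sequentially. K * sqrt (mesh (N k)) < e"
    using assms by (intro order_tendstoD) auto
  then show ?thesis by eventually_elim simp
qed

context
  fixes a b c d
  assumes lim: "uniform_limit {0..1} Y (\<lambda>x. (a x, b x, c x, d x)) sequentially"
begin

lemma component_limits:
  "uniform_limit {0..1} (\<lambda>k. piecewise_linear (N k) (u k)) a sequentially"
  "uniform_limit {0..1} (\<lambda>k. piecewise_linear (N k) (hermite_deriv (N k) (u k))) b sequentially"
  "uniform_limit {0..1} (\<lambda>k. piecewise_linear (N k) (spline2 (N k) (u k))) c sequentially"
  "uniform_limit {0..1} (\<lambda>k. piecewise_linear (N k) (spline3_inner (N k) (u k))) d sequentially"
proof -
  show "uniform_limit {0..1} (\<lambda>k. piecewise_linear (N k) (u k)) a sequentially"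
    using bounded_linear.uniform_limit[OF bounded_linear_fst lim] by (simp add: profile_def)
  note snd = bounded_linear.uniform_limit[OF bounded_linear_snd lim]
  show "uniform_limit {0..1} (\<lambda>k. piecewise_linear (N k) (hermite_deriv (N k) (u k))) b sequentially"
    using bounded_linear.uniform_limit[OF bounded_linear_fst snd] by (simp add: profile_def)
  note snd = bounded_linear.uniform_limit[OF bounded_linear_snd snd]
  show "uniform_limit {0..1} (\<lambda>k. piecewise_linear (N k) (spline2 (N k) (u k))) c sequentially"
    using bounded_linear.uniform_limit[OF bounded_linear_fst snd] by (simp add: profile_def)
  show "uniform_limit {0..1} (\<lambda>k. piecewise_linear (N k) (spline3_inner (N k) (u k))) d sequentially"
    using bounded_linear.uniform_limit[OF bounded_linear_snd snd] by (simp add: profile_def)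
qed

lemma limits_continuous:
  "continuous_on {0..1} a" "continuous_on {0..1} b" "continuous_on {0..1} c" "continuous_on {0..1} d"
  by (rule uniform_limit_theorem[OF _ component_limits(1)]
      uniform_limit_theorem[OF _ component_limits(2)]
      uniform_limit_theorem[OF _ component_limits(3)]
      uniform_limit_theorem[OF _ component_limits(4)],
      use N_pos in \<open>simp_all add: continuous_on_piecewise_linear\<close>)+

lemmas component_node_limits = component_limits[THEN node_limit_piecewise_linear[OF N_pos]]

text \<open>The candidate limit of \<open>delta_x4\<close>; it later becomes the weak limit.\<close>

definition F :: "real \<Rightarrow> real" where
  "F x = f x - D x * d x - A x * c x - (deriv01 A x + H x) * b x - B x * a x"

lemma F_continuous: "continuous_on {0..1} F"
  unfolding F_def by (intro continuous_intros cont limits_continuous)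

text \<open>At these nodes \<open>delta_x4\<close> is within O(sqrt h) of \<open>R\<close>, and
  \<open>R\<close> is assembled from data that converge uniformly at the nodes.\<close>

lemma delta_x4_limit:
  assumes "e > 0"
  shows "\<forall>\<^sub>F k in sequentially. \<forall>i. 2 \<le> i \<longrightarrow> i + 2 \<le> N k \<longrightarrow>
    \<bar>delta_x4 (N k) (u k) i - F (node (N k) i)\<bar> \<le> e"
proof -
  have Q0: "Q \<ge> 0" by (rule bounded_solution.Q0[OF sol[of 0]])
  \<comment> \<open>Four products contribute \<open>Q * r\<close> each, and the defect contributes
    \<open>r\<close>.\<close>
  define r where "r = e / (4 * Q + 1)"
  have r: "r > 0" "(4 * Q + 1) * r = e" using assms Q0 by (auto simp: r_def)
  note ev = component_node_limits[unfolded node_limit_def, rule_format, OF r(1)]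
  show ?thesis
    using ev eventually_sqrt_h_small[OF r(1), of "Q * C"]
  proof eventually_elim
    case (elim k)
    interpret bounded_solution A B D H f C Q "N k" "u k" by (rule sol)
    show ?case
    proof (intro allI impI)
      fix i assume i: "2 \<le> i" "i + 2 \<le> N k"
      let ?x = "node (N k) i"
      have x: "?x \<in> {0..1}" using i by (intro node_in_unit) auto
      have "max 1 (min i (N k - 2)) = i" using i by auto
      then have S3: "\<bar>S3 i - d ?x\<bar> \<le> r" using elim(4) i by (auto simp: spline3_inner_def dest!: spec[of _ i])
      have "\<bar>D ?x * (S3 i - d ?x)\<bar> \<le> Q * r" "\<bar>A ?x * (S2 i - c ?x)\<bar> \<le> Q * r"
        "\<bar>(deriv01 A ?x + H ?x) * (m i - b ?x)\<bar> \<le> Q * r" "\<bar>B ?x * (u k i - a ?x)\<bar> \<le> Q * r"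
        unfolding abs_mult using S3 elim(1-3) i x Q0 by (auto intro!: mult_mono Q)
      moreover have "R i - F ?x = - (D ?x * (S3 i - d ?x)) - A ?x * (S2 i - c ?x)
        - (deriv01 A ?x + H ?x) * (m i - b ?x) - B ?x * (u k i - a ?x)"
        unfolding R_def F_def by (simp add: algebra_simps)
      moreover have "\<bar>v i - R i\<bar> \<le> r" using consistency[OF i] elim(5) by linarith
      ultimately have "\<bar>v i - F ?x\<bar> \<le> 4 * (Q * r) + r" by linarith
      then show "\<bar>v i - F ?x\<bar> \<le> e" using r(2) by (simp add: algebra_simps)
    qed
  qed
qed

lemma limit_derivatives:
  assumes x: "x \<in> {0..1}"
  shows "(a has_real_derivative b x) (at x within {0..1})"
    and "(b has_real_derivative c x) (at x within {0..1})"
    and "(c has_real_derivative d x) (at x within {0..1})"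
    and "(d has_real_derivative F x) (at x within {0..1})"
proof -
  note ev = component_node_limits[unfolded node_limit_def, rule_format]
  note rule = discrete_antiderivative_limit[OF N_lim N_pos _ _ _ _ x]
  define K where "K = bounded_solution.E C"
  have mid: "\<bar>y - hk * p\<bar> \<le> hk * e + (if P then hk * K else 0)"
    if "y = hk * q" "hk > 0" "K \<ge> 0" "\<bar>q - p\<bar> \<le> e" for y hk p q e K :: real and P
  proof -
    have "\<bar>hk * q - hk * p\<bar> = hk * \<bar>q - p\<bar>"
      using that(2) by (simp add: abs_mult flip: right_diff_distrib)
    also have "\<dots> \<le> hk * e" using that by (intro mult_left_mono) auto
    finally have "\<bar>hk * q - hk * p\<bar> \<le> hk * e" .
    moreover have "0 \<le> (if P then hk * K else 0)" using that by simp
    ultimately show ?thesis unfolding that(1) by linarith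
  qed
  show "(a has_real_derivative b x) (at x within {0..1})"
  proof (rule rule[OF component_node_limits(1) limits_continuous(1,2), where K = 0])
    fix e :: real assume e: "e > 0"
    then have "e / 2 > 0" by simp
    from ev(2)[OF this] eventually_h_small[OF this, of "25 * K"]
    show "\<forall>\<^sub>F k in sequentially. \<forall>i<N k. \<bar>u k (Suc i) - u k i - mesh (N k) * b (node (N k) i)\<bar>
       \<le> mesh (N k) * e + (if i = 0 \<or> N k \<le> i + 2 then mesh (N k) * 0 else 0)"
    proof eventually_elim
      case (elim k)
      interpret bounded_solution A B D H f C Q "N k" "u k" by (rule sol)
      show ?case
      proof (intro allI impI)
        fix i assume i: "i < N k"
        let ?q = "m i + h * (2 * S2 i + S2 (Suc i)) / 6"
        have s: "u k (Suc i) - u k i = h * ?q"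
          using spline_step[OF i, of "u k"] by (simp add: algebra_simps power2_eq_square)
        have "\<bar>h * (2 * S2 i + S2 (Suc i)) / 6\<bar> = h * (\<bar>2 * S2 i + S2 (Suc i)\<bar> / 6)"
          using h by (simp add: abs_mult)
        also have "\<dots> \<le> h * (25 * K)"
        proof (intro mult_left_mono)
          have "\<bar>S2 i\<bar> \<le> 50 * K" "\<bar>S2 (Suc i)\<bar> \<le> 50 * K"
            using bounds(2)[of i] bounds(2)[of "Suc i"] i by (simp_all add: K_def)
          then have "\<bar>2 * S2 i + S2 (Suc i)\<bar> \<le> 150 * K" by linarith
          then show "\<bar>2 * S2 i + S2 (Suc i)\<bar> / 6 \<le> 25 * K" by simp
        qed (use h in simp)
        also have "\<dots> \<le> e / 2" using elim(2) by (simp add: mult.commute)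
        finally have "\<bar>h * (2 * S2 i + S2 (Suc i)) / 6\<bar> \<le> e / 2" .
        moreover have "\<bar>m i - b (node (N k) i)\<bar> \<le> e / 2" using elim(1) i by simp
        ultimately have "\<bar>?q - b (node (N k) i)\<bar> \<le> e" by linarith
        then show "\<bar>u k (Suc i) - u k i - h * b (node (N k) i)\<bar>
          \<le> h * e + (if i = 0 \<or> N k \<le> i + 2 then h * 0 else 0)"
          by (rule mid[OF s h order_refl])
      qed
    qed
  qed
  show "(b has_real_derivative c x) (at x within {0..1})"
  proof (rule rule[OF component_node_limits(2) limits_continuous(2,3), where K = 0])
    fix e :: real assume e: "e > 0"
    have Ls: "\<forall>\<^sub>F k in sequentially. bounded_solution.L C Q * mesh (N k) \<le> e / 2"
      using e by (intro eventually_h_small) auto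
    have "e / 2 > 0" using e by simp
    from ev(3)[OF this] Ls
    show "\<forall>\<^sub>F k in sequentially. \<forall>i<N k. \<bar>hermite_deriv (N k) (u k) (Suc i)
        - hermite_deriv (N k) (u k) i - mesh (N k) * c (node (N k) i)\<bar>
       \<le> mesh (N k) * e + (if i = 0 \<or> N k \<le> i + 2 then mesh (N k) * 0 else 0)"
    proof eventually_elim
      case (elim k)
      interpret bounded_solution A B D H f C Q "N k" "u k" by (rule sol)
      show ?case
      proof (intro allI impI)
        fix i assume i: "i < N k"
        let ?q = "S2 i + (S2 (Suc i) - S2 i) / 2"
        have s: "m (Suc i) - m i = h * ?q"
          using hermite_deriv_step[OF i, of "u k"] by (simp add: field_simps)
        have 1: "\<bar>S2 (Suc i) - S2 i\<bar> \<le> e / 2"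
          using step_bounds(3)[OF i] elim(2) by linarith
        have 2: "\<bar>S2 i - c (node (N k) i)\<bar> \<le> e / 2" using elim(1) i by simp
        have "\<bar>?q - c (node (N k) i)\<bar>
            \<le> \<bar>S2 i - c (node (N k) i)\<bar> + \<bar>S2 (Suc i) - S2 i\<bar> / 2"
          using abs_triangle_ineq[of "S2 i - c (node (N k) i)" "(S2 (Suc i) - S2 i) / 2"]
          by (simp add: add_diff_eq diff_add_eq)
        also have "\<dots> \<le> e / 2 + e / 2 / 2" by (intro add_mono divide_right_mono 1 2) simp
        also have "\<dots> \<le> e" using e by simp
        finally have "\<bar>?q - c (node (N k) i)\<bar> \<le> e" .
        then show "\<bar>m (Suc i) - m i - h * c (node (N k) i)\<bar>
          \<le> h * e + (if i = 0 \<or> N k \<le> i + 2 then h * 0 else 0)"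
          by (rule mid[OF s h order_refl])
      qed
    qed
  qed
  show "(c has_real_derivative d x) (at x within {0..1})"
  proof (rule rule[OF component_node_limits(3) limits_continuous(3,4), where K = 0])
    fix e :: real assume e: "e > 0"
    then have "e / 2 > 0" by simp
    from ev(4)[OF this] eventually_sqrt_h_small[OF this, of C]
    show "\<forall>\<^sub>F k in sequentially. \<forall>i<N k. \<bar>spline2 (N k) (u k) (Suc i)
        - spline2 (N k) (u k) i - mesh (N k) * d (node (N k) i)\<bar>
       \<le> mesh (N k) * e + (if i = 0 \<or> N k \<le> i + 2 then mesh (N k) * 0 else 0)"
    proof eventually_elim
      case (elim k)
      interpret bounded_solution A B D H f C Q "N k" "u k" by (rule sol)
      show ?case
      proof (intro allI impI)
        fix i assume i: "i < N k"
        have s: "S2 (Suc i) - S2 i = h * S3 i"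
          using spline2_step[of "N k" "u k" i] i by simp
        have "\<bar>spline3_inner (N k) (u k) i - d (node (N k) i)\<bar> \<le> e / 2" using elim(1) i by simp
        \<comment> \<open>Passing between \<open>S3\<close> and \<open>spline3_inner\<close> costs
          O(sqrt h) on every cell, including the outermost ones, and this disappears in the
          limit.\<close>
        then have "\<bar>S3 i - d (node (N k) i)\<bar> \<le> e"
          using spline3_inner_diff[OF i] elim(2) by linarith
        then show "\<bar>S2 (Suc i) - S2 i - h * d (node (N k) i)\<bar>
          \<le> h * e + (if i = 0 \<or> N k \<le> i + 2 then h * 0 else 0)"
          by (rule mid[OF s h order_refl])
      qed
    qed
  qed
  obtain K where K: "\<And>x. x \<in> {0..1} \<Longrightarrow> \<bar>F x\<bar> \<le> K"
    using continuous_bounded01[OF F_continuous] by blast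
  have K0: "K \<ge> 0" using K[of 0] by force
  show "(d has_real_derivative F x) (at x within {0..1})"
  proof (rule rule[OF component_node_limits(4) limits_continuous(4) F_continuous, where K = K])
    fix e :: real assume e: "e > 0"
    then have e2: "e / 2 > 0" by simp
    have "uniformly_continuous_on {0..1} F" using F_continuous by (intro compact_uniformly_continuous) auto
    then obtain s where s: "s > 0" "\<And>x y. x \<in> {0..1} \<Longrightarrow> y \<in> {0..1} \<Longrightarrow> dist y x < s \<Longrightarrow> dist (F y) (F x) < e / 2"
      using e2 unfolding uniformly_continuous_on_def by metis
    have hs: "\<forall>\<^sub>F k in sequentially. mesh (N k) < s"
      using h_lim s(1) by (rule order_tendstoD)
    show "\<forall>\<^sub>F k in sequentially. \<forall>i<N k. \<bar>spline3_inner (N k) (u k) (Suc i)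
        - spline3_inner (N k) (u k) i - mesh (N k) * F (node (N k) i)\<bar>
       \<le> mesh (N k) * e + (if i = 0 \<or> N k \<le> i + 2 then mesh (N k) * K else 0)"
      using delta_x4_limit[OF e2] hs
    proof eventually_elim
      case (elim k)
      interpret bounded_solution A B D H f C Q "N k" "u k" by (rule sol)
      show ?case
      proof (intro allI impI)
        fix i assume i: "i < N k"
        let ?x = "node (N k)"
        have x: "?x i \<in> {0..1}" "?x (Suc i) \<in> {0..1}"
          using node_in_unit[of i "N k"] node_in_unit[of "Suc i" "N k"] i by simp_all
        show "\<bar>spline3_inner (N k) (u k) (Suc i) - spline3_inner (N k) (u k) i - h * F (?x i)\<bar>
          \<le> h * e + (if i = 0 \<or> N k \<le> i + 2 then h * K else 0)"
        proof (cases "1 \<le> i \<and> i + 3 \<le> N k")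
          case True
          then have "\<bar>v (Suc i) - F (?x (Suc i))\<bar> \<le> e / 2" using elim(1) by simp
          \<comment> \<open>The step carries \<open>v\<close> at \<open>Suc i\<close>, while the
            scheme is anchored at \<open>i\<close>; uniform continuity of \<open>F\<close> bridges
            the cell.\<close>
          moreover have "dist (F (?x (Suc i))) (F (?x i)) < e / 2"
            using x elim(2) h by (intro s) (auto simp: dist_real_def node_Suc)
          ultimately have "\<bar>v (Suc i) - F (?x i)\<bar> \<le> e" unfolding dist_real_def by linarith
          then show ?thesis
            using True by (intro mid[OF spline3_inner_step h K0]) auto
        next
          case False
          \<comment> \<open>A frozen step is zero, so its error is the whole term
            \<open>h * F\<close>, which the exceptional allowance absorbs.\<close>
          have "\<bar>h * F (?x i)\<bar> \<le> h * K" using K[OF x(1)] h by (simp add: abs_mult)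
          moreover have "i = 0 \<or> N k \<le> i + 2" using False by auto
          moreover have "h * e \<ge> 0" using h e by simp
          ultimately show ?thesis using spline3_inner_step_end[OF False] by simp
        qed
      qed
    qed
  qed
qed

lemma bvp_solution_limit: "bvp_solution A B D H f a b c d"
proof -
  have "w 0 = 0" "w 1 = 0" if "node_limit N W w" "\<And>k. W k \<in> l2h0 (N k)" for W w
  proof -
    have W: "W k 0 = 0" "W k (N k) = 0" for k using that(2)[of k] by (auto simp: l2h0_def)
    have small: "\<bar>w 0\<bar> \<le> e \<and> \<bar>w 1\<bar> \<le> e" if e: "e > 0" for e
    proof -
      have "\<forall>\<^sub>F k in sequentially. \<bar>w 0\<bar> \<le> e \<and> \<bar>w 1\<bar> \<le> e"
        using \<open>node_limit N W w\<close>[unfolded node_limit_def, rule_format, OF e]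
      proof eventually_elim
        case (elim k)
        from elim[rule_format, of 0] elim[rule_format, of "N k"] show ?case
          using W N_pos by simp
      qed
      then show ?thesis by simp
    qed
    show "w 0 = 0" "w 1 = 0" using small field_le_epsilon[of "\<bar>w 0\<bar>" 0] field_le_epsilon[of "\<bar>w 1\<bar>" 0] by auto
  qed
  note zero = this
  have "a 0 = 0" "a 1 = 0"
    using zero[OF component_node_limits(1)] bounded_solution.u[OF sol] by blast+
  moreover have "b 0 = 0" "b 1 = 0"
    using zero[OF component_node_limits(2)] hermite_deriv(1)[OF N_pos] by blast+
  ultimately show ?thesis
    using limit_derivatives unfolding bvp_solution_def F_def by blast
qed

end

text \<open>The profiles are equibounded and uniformly Lipschitz, so the Arzela-Ascoli theorem
  applies; along the extracted subsequence \<open>bvp_solution_limit\<close> identifies the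
  limit.\<close>

lemma convergent_subsequence:
  obtains s a b c d where "strict_mono s" "bvp_solution A B D H f a b c d"
    "uniform_limit {0..1} (\<lambda>k. Y (s k)) (\<lambda>x. (a x, b x, c x, d x)) sequentially"
proof -
  let ?L = "bounded_solution.L C Q"
  obtain y s where y: "continuous_on {0..1} y" "strict_mono (s :: nat \<Rightarrow> nat)"
    "\<And>e. 0 < e \<Longrightarrow> \<exists>M. \<forall>k x. k \<ge> M \<and> x \<in> {0..1::real} \<longrightarrow> norm (Y (s k) x - y x) < e"
  proof (rule Arzela_Ascoli[of "{0..1::real}" Y "200 * bounded_solution.E C"])
    show "norm (Y k x) \<le> 200 * bounded_solution.E C" if "x \<in> {0..1}" for k x
      using bounded_solution.profile_bound[OF sol that] .
    show "\<exists>d>0. \<forall>k y. y \<in> {0..1} \<and> norm (x - y) < d \<longrightarrow> norm (Y k x - Y k y) < e"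
      if x: "x \<in> {0..1}" and "0 < e" for x e :: real
    proof (intro exI[of _ "e / (4 * ?L + 1)"] conjI allI impI)
      have L: "?L \<ge> 0" by (rule bounded_solution.L(2)[OF sol[of 0]])
      then show "0 < e / (4 * ?L + 1)" using \<open>0 < e\<close> by simp
      fix k y assume y: "y \<in> {0..1} \<and> norm (x - y) < e / (4 * ?L + 1)"
      then have "(4 * ?L + 1) * \<bar>x - y\<bar> < e" using L by (simp add: field_simps)
      moreover have "norm (Y k x - Y k y) \<le> 4 * (?L * \<bar>x - y\<bar>)"
        using bounded_solution.profile_lipschitz[OF sol x] y by blast
      ultimately show "norm (Y k x - Y k y) < e" by (simp add: algebra_simps)
    qed
  qed auto
  define a b c d where "a = (\<lambda>x. fst (y x))" and "b = (\<lambda>x. fst (snd (y x)))"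
    and "c = (\<lambda>x. fst (snd (snd (y x))))" and "d = (\<lambda>x. snd (snd (snd (y x))))"
  have lim: "uniform_limit {0..1} (\<lambda>k. Y (s k)) (\<lambda>x. (a x, b x, c x, d x)) sequentially"
    unfolding uniform_limit_iff eventually_sequentially dist_norm a_def b_def c_def d_def prod.collapse
    using y(3) by meson
  interpret s: bounded_solution_sequence A B D H f C Q "N \<circ> s" "u \<circ> s"
    by (rule subsequence[OF y(2)])
  have "bvp_solution A B D H f a b c d"
    using s.bvp_solution_limit lim by simp
  with lim y(2) show ?thesis using that by blast
qed

end

section \<open>Uniqueness of the limit\<close>

lemma deriv01_eq:
  assumes "(u has_real_derivative w) (at x within {0..1})" "x \<in> {0..1}"
  shows "deriv01 u x = w"
  unfolding deriv01_def
  using vector_derivative_within_cbox[of 0 1 x u w] assms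
  by (simp add: has_real_derivative_iff_has_vector_derivative)

lemma has_real_derivative_cong01:
  assumes "(u has_real_derivative d) (at x within {0..1})" "x \<in> {0..1}"
    and "\<And>y. y \<in> {0..1} \<Longrightarrow> w y = u y"
  shows "(w has_real_derivative d) (at x within {0..1})"
  using assms by (intro has_field_derivative_transform_within[where f = u and d = 1 and g = w]) auto

lemma deriv01_funpow:
  assumes w: "\<And>i x. i < m \<Longrightarrow> x \<in> {0..1} \<Longrightarrow> (w i has_real_derivative w (Suc i) x) (at x within {0..1})"
  shows "i \<le> m \<Longrightarrow> x \<in> {0..1} \<Longrightarrow> (deriv01 ^^ i) (w 0) x = w i x"
proof (induction i arbitrary: x)
  case (Suc i)
  have "((deriv01 ^^ i) (w 0) has_real_derivative w (Suc i) x) (at x within {0..1})"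
    by (rule has_real_derivative_cong01[OF w]) (use Suc in auto)
  then show ?case using deriv01_eq Suc.prems by simp
qed simp

lemma C01I:
  assumes w: "\<And>i x. i < m \<Longrightarrow> x \<in> {0..1} \<Longrightarrow> (w i has_real_derivative w (Suc i) x) (at x within {0..1})"
    and c: "continuous_on {0..1} (w m)"
  shows "w 0 \<in> C01 m"
proof -
  note pow = deriv01_funpow[where w = w, OF w]
  have "(deriv01 ^^ i) (w 0) differentiable_on {0..1}" if "i < m" for i
    unfolding differentiable_on_def real_differentiable_def
  proof
    fix x :: real assume x: "x \<in> {0..1}"
    have "((deriv01 ^^ i) (w 0) has_real_derivative w (Suc i) x) (at x within {0..1})"
      by (rule has_real_derivative_cong01[OF w]) (use pow that x in auto)
    then show "\<exists>D. ((deriv01 ^^ i) (w 0) has_real_derivative D) (at x within {0..1})" by blast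
  qed
  moreover have "continuous_on {0..1} ((deriv01 ^^ m) (w 0))"
    using c pow by (subst continuous_on_cong[OF refl, of _ _ "w m"]) auto
  ultimately show ?thesis
    unfolding C01_def by (auto simp: le_less intro: differentiable_imp_continuous_on)
qed

lemma C01_0: "u \<in> C01 0 \<longleftrightarrow> continuous_on {0..1} u"
  by (simp add: C01_def)

definition bvp_rhs ::
  "(real \<Rightarrow> real) \<Rightarrow> (real \<Rightarrow> real) \<Rightarrow> (real \<Rightarrow> real) \<Rightarrow> (real \<Rightarrow> real) \<Rightarrow> (real \<Rightarrow> real)
    \<Rightarrow> (real \<Rightarrow> real) \<Rightarrow> (real \<Rightarrow> real) \<Rightarrow> (real \<Rightarrow> real) \<Rightarrow> (real \<Rightarrow> real) \<Rightarrow> real \<Rightarrow> real" where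
  "bvp_rhs A B D H f a b c d x = f x - D x * d x - A x * c x - (deriv01 A x + H x) * b x - B x * a x"

lemma less_4_cases: "i < 4 \<Longrightarrow> i = 0 \<or> i = 1 \<or> i = 2 \<or> i = (3::nat)"
  by auto

text \<open>List indexing turns the five functions into a family indexed by the order of the
  derivative, the form expected by the lemmas on iterated and weak derivatives.\<close>

lemma bvp_solution_derivs:
  assumes "bvp_solution A B D H f a b c d"
  defines "w \<equiv> (!) [a, b, c, d, bvp_rhs A B D H f a b c d]"
  shows "i < 4 \<Longrightarrow> x \<in> {0..1} \<Longrightarrow> (w i has_real_derivative w (Suc i) x) (at x within {0..1})"
proof -
  assume "i < 4" and x: "x \<in> {0..1}"
  have "(a has_real_derivative b x) (at x within {0..1})"
    "(b has_real_derivative c x) (at x within {0..1})"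
    "(c has_real_derivative d x) (at x within {0..1})"
    "(d has_real_derivative bvp_rhs A B D H f a b c d x) (at x within {0..1})"
    using assms(1) x unfolding bvp_solution_def bvp_rhs_def by blast+
  with less_4_cases[OF \<open>i < 4\<close>] show ?thesis
    by (elim disjE) (simp_all add: w_def numeral_eq_Suc)
qed

lemma bvp_solution_classical:
  assumes sol: "bvp_solution A B D H f a b c d"
    and cont: "continuous_on {0..1} A" "continuous_on {0..1} B" "continuous_on {0..1} D"
      "continuous_on {0..1} (\<lambda>x. deriv01 A x + H x)" "continuous_on {0..1} f"
  shows "a \<in> C01 4" and "x \<in> {0..1} \<Longrightarrow> L_cont A B D H a x = f x"
    and "x \<in> {0..1} \<Longrightarrow> deriv01 a x = b x"
proof -
  let ?w = "(!) [a, b, c, d, bvp_rhs A B D H f a b c d]"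
  note w = bvp_solution_derivs[OF sol]
  have "continuous_on {0..1} (bvp_rhs A B D H f a b c d)"
    unfolding bvp_rhs_def by (intro continuous_intros cont bvp_solution_continuous[OF sol])
  then show "a \<in> C01 4" using C01I[of 4 ?w, OF w] by simp
  assume x: "x \<in> {0..1}"
  have "(deriv01 ^^ i) a x = ?w i x" if "i \<le> 4" for i
    using deriv01_funpow[of 4 ?w, OF w that x] by simp
  from this[of 1] this[of 2] this[of 3] this[of 4]
  have p: "deriv01 a x = b x" "(deriv01 ^^ 2) a x = c x" "(deriv01 ^^ 3) a x = d x"
    "(deriv01 ^^ 4) a x = bvp_rhs A B D H f a b c d x"
    by (simp_all add: numeral_eq_Suc)
  then show "deriv01 a x = b x" by simp
  show "L_cont A B D H a x = f x" unfolding L_cont_def p bvp_rhs_def by simp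
qed

lemma bvp_solution_diff:
  assumes "bvp_solution A B D H f a b c d" "bvp_solution A B D H f a' b' c' d'"
  shows "bvp_solution A B D H (\<lambda>_. 0) (\<lambda>x. a x - a' x) (\<lambda>x. b x - b' x) (\<lambda>x. c x - c' x) (\<lambda>x. d x - d' x)"
proof -
  have "((\<lambda>x. d x - d' x) has_real_derivative
      0 - D x * (d x - d' x) - A x * (c x - c' x) - (deriv01 A x + H x) * (b x - b' x) - B x * (a x - a' x))
      (at x within {0..1})" if "x \<in> {0..1}" for x
  proof (rule DERIV_cong)
    show "((\<lambda>x. d x - d' x) has_real_derivative bvp_rhs A B D H f a b c d x - bvp_rhs A B D H f a' b' c' d' x)
      (at x within {0..1})"
      unfolding bvp_rhs_def using assms that unfolding bvp_solution_def by (intro DERIV_diff) auto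
  qed (simp add: bvp_rhs_def algebra_simps)
  then show ?thesis
    using assms unfolding bvp_solution_def by (auto intro!: DERIV_diff)
qed

lemma has_real_derivative_zero01:
  assumes "(u has_real_derivative w) (at x within {0..1})" "x \<in> {0..1}" "\<And>y. y \<in> {0..1} \<Longrightarrow> u y = 0"
  shows "w = 0"
proof -
  have "(u has_real_derivative 0) (at x within {0..1})"
    by (rule has_real_derivative_cong01[of "\<lambda>_. 0"]) (use assms in auto)
  then show ?thesis using assms(1,2) deriv01_eq by metis
qed

text \<open>The difference of two solutions solves the homogeneous problem; were its first component
  nonzero, it would be an eigenfunction for 0. The remaining components are successive derivatives
  and vanish with it.\<close>

lemma bvp_solution_unique:
  assumes sol: "bvp_solution A B D H f a b c d" "bvp_solution A B D H f a' b' c' d'"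
    and cont: "continuous_on {0..1} A" "continuous_on {0..1} B" "continuous_on {0..1} D"
      "continuous_on {0..1} (\<lambda>x. deriv01 A x + H x)"
    and ev: "\<not> is_eigenvalue_L_cont A B D H 0"
    and x: "x \<in> {0..1}"
  shows "a x = a' x" "b x = b' x" "c x = c' x" "d x = d' x"
proof -
  note diff = bvp_solution_diff[OF sol]
  note cl = bvp_solution_classical[OF diff cont continuous_on_const]
  have bc: "a 0 = 0" "a' 0 = 0" "a 1 = 0" "a' 1 = 0" "b 0 = 0" "b' 0 = 0" "b 1 = 0" "b' 1 = 0"
    using sol by (simp_all add: bvp_solution_def)
  have 0: "a y - a' y = 0" if "y \<in> {0..1}" for y
  proof (rule ccontr)
    assume "a y - a' y \<noteq> 0"
    then have "is_eigenvalue_L_cont A B D H 0"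
      unfolding is_eigenvalue_L_cont_def using that cl bc
      by (intro bexI[of _ "\<lambda>x. a x - a' x"]) auto
    then show False using ev by blast
  qed
  have der: "((\<lambda>x. a x - a' x) has_real_derivative b y - b' y) (at y within {0..1})"
    "((\<lambda>x. b x - b' x) has_real_derivative c y - c' y) (at y within {0..1})"
    "((\<lambda>x. c x - c' x) has_real_derivative d y - d' y) (at y within {0..1})" if "y \<in> {0..1}" for y
    using diff that unfolding bvp_solution_def by blast+
  have 1: "b y - b' y = 0" if "y \<in> {0..1}" for y
    using has_real_derivative_zero01[OF der(1)[OF that] that 0] .
  have 2: "c y - c' y = 0" if "y \<in> {0..1}" for y
    using has_real_derivative_zero01[OF der(2)[OF that] that 1] .
  have 3: "d y - d' y = 0" if "y \<in> {0..1}" for y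
    using has_real_derivative_zero01[OF der(3)[OF that] that 2] .
  show "a x = a' x" "b x = b' x" "c x = c' x" "d x = d' x"
    using 0[OF x] 1[OF x] 2[OF x] 3[OF x] by simp_all
qed

text \<open>Otherwise some subsequence would keep a distance \<open>e\<close> from the limit found
  along the first subsequence. It has a convergent subsequence of its own, whose limit is the same
  by uniqueness.\<close>

lemma (in bounded_solution_sequence) whole_sequence_converges:
  assumes ev: "\<not> is_eigenvalue_L_cont A B D H 0"
  obtains a b c d where "bvp_solution A B D H f a b c d"
    "uniform_limit {0..1} Y (\<lambda>x. (a x, b x, c x, d x)) sequentially"
proof -
  obtain s a b c d where sol: "bvp_solution A B D H f a b c d"
    by (rule convergent_subsequence)
  have "uniform_limit {0..1} Y (\<lambda>x. (a x, b x, c x, d x)) sequentially"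
  proof (rule ccontr)
    assume "\<not> ?thesis"
    then obtain e where e: "e > 0"
      "\<not> (\<forall>\<^sub>F k in sequentially. \<forall>x\<in>{0..1}. dist (Y k x) (a x, b x, c x, d x) < e)"
      unfolding uniform_limit_iff by blast
    then obtain r :: "nat \<Rightarrow> nat" where r: "strict_mono r"
      "\<And>k. \<not> (\<forall>x\<in>{0..1}. dist (Y (r k) x) (a x, b x, c x, d x) < e)"
      using not_eventually_sequentiallyD by blast
    interpret r: bounded_solution_sequence A B D H f C Q "N \<circ> r" "u \<circ> r"
      by (rule subsequence[OF r(1)])
    obtain t a' b' c' d' where t: "bvp_solution A B D H f a' b' c' d'"
      "uniform_limit {0..1} (\<lambda>k. r.Y (t k)) (\<lambda>x. (a' x, b' x, c' x, d' x)) sequentially"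
      by (rule r.convergent_subsequence)
    have eq: "(a x, b x, c x, d x) = (a' x, b' x, c' x, d' x)" if "x \<in> {0..1}" for x
      by (simp only: bvp_solution_unique[OF sol t(1) cont(1-4) ev that])
    have "\<forall>\<^sub>F k in sequentially. \<forall>x\<in>{0..1}. dist (r.Y (t k) x) (a' x, b' x, c' x, d' x) < e"
      using t(2) e(1) by (rule uniform_limitD)
    then have "\<forall>\<^sub>F k in sequentially. \<forall>x\<in>{0..1}. dist (Y (r (t k)) x) (a x, b x, c x, d x) < e"
    proof eventually_elim
      case (elim k)
      show ?case
      proof
        fix x :: real assume x: "x \<in> {0..1}"
        show "dist (Y (r (t k)) x) (a x, b x, c x, d x) < e"
          using bspec[OF elim x] unfolding eq[OF x] o_apply .
      qed
    qed
    from eventually_happens'[OF sequentially_bot this]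
    obtain k where "\<forall>x\<in>{0..1}. dist (Y (r (t k)) x) (a x, b x, c x, d x) < e" ..
    with r(2)[of "t k"] show False by contradiction
  qed
  with sol show ?thesis using that by blast
qed

section \<open>Weak convergence\<close>

lemma space_leb01 [simp]: "space leb01 = {0<..<1}"
  by (simp add: space_restrict_space)

lemma borel_measurable_leb01: "g \<in> borel_measurable borel \<Longrightarrow> g \<in> borel_measurable leb01"
  by (intro measurable_restrict_space1 measurable_completion) simp

lemma emeasure_leb01: "A \<in> sets borel \<Longrightarrow> A \<subseteq> {0<..<1} \<Longrightarrow> emeasure leb01 A = emeasure lborel A"
  by (subst emeasure_restrict_space) auto

interpretation leb01: finite_measure leb01
  by (rule finite_measureI) (simp add: emeasure_leb01)

lemma integrable_leb01_bounded:
  fixes g :: "real \<Rightarrow> real"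
  assumes "g \<in> borel_measurable leb01" "\<And>x. x \<in> {0<..<1} \<Longrightarrow> \<bar>g x\<bar> \<le> K"
  shows "integrable leb01 g"
  using assms by (intro leb01.integrable_const_bound[where B = K]) auto

lemma continuous_leb01:
  fixes g :: "real \<Rightarrow> real"
  assumes "continuous_on {0..1} g"
  shows "g \<in> borel_measurable leb01" "integrable leb01 g"
proof -
  show m: "g \<in> borel_measurable leb01"
    by (rule continuous_imp_measurable_on_sets_lebesgue)
      (use assms in \<open>auto intro: continuous_on_subset\<close>)
  obtain K where "\<And>x. x \<in> {0..1} \<Longrightarrow> \<bar>g x\<bar> \<le> K"
    using continuous_bounded01[OF assms] by blast
  then show "integrable leb01 g" by (intro integrable_leb01_bounded[OF m, of K]) auto
qed

lemma continuous_L2_01: "continuous_on {0..1} g \<Longrightarrow> g \<in> L2_01"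
  unfolding L2_01_def using continuous_leb01(1) continuous_leb01(2)[OF continuous_on_power]
  by blast

lemma L2_01_product:
  assumes "p \<in> L2_01" "q \<in> L2_01"
  shows "integrable leb01 (\<lambda>x. p x * q x)"
proof (rule Bochner_Integration.integrable_bound)
  show "integrable leb01 (\<lambda>x. (p x)\<^sup>2 + (q x)\<^sup>2)" using assms by (auto simp: L2_01_def)
  show "(\<lambda>x. p x * q x) \<in> borel_measurable leb01" using assms by (auto simp: L2_01_def)
  show "AE x in leb01. norm (p x * q x) \<le> norm ((p x)\<^sup>2 + (q x)\<^sup>2)"
  proof (rule AE_I2)
    fix x
    have "(\<bar>p x\<bar> - \<bar>q x\<bar>)\<^sup>2 \<ge> 0" by simp
    then have "2 * \<bar>p x * q x\<bar> \<le> (p x)\<^sup>2 + (q x)\<^sup>2"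
      by (simp add: power2_diff abs_mult)
    then show "norm (p x * q x) \<le> norm ((p x)\<^sup>2 + (q x)\<^sup>2)" by simp
  qed
qed

lemma one_L2_01: "(\<lambda>_. 1) \<in> L2_01"
  by (intro continuous_L2_01 continuous_intros)

text \<open>The weight \<open>s\<close> can be chosen small against the singular factor
  \<open>a\<close>; the price \<open>1 / s\<close> falls on the fixed function \<open>b\<close>,
  whose square has a vanishing integral over the layers.\<close>

lemma young_le:
  fixes a b s :: real
  assumes "s > 0" "a \<ge> 0" "b \<ge> 0"
  shows "a * b \<le> s * a\<^sup>2 + b\<^sup>2 / s"
proof -
  have "0 \<le> (s * a - b)\<^sup>2 / s" using assms by simp
  also have "\<dots> = s * a\<^sup>2 - 2 * (a * b) + b\<^sup>2 / s"
    using assms by (simp add: field_simps power2_eq_square)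
  finally show ?thesis using mult_nonneg_nonneg[of a b] assms by linarith
qed

text \<open>Away from two boundary layers of width \<open>O(h)\<close> the convergence is uniform; on the layers,
  where the functions are \<open>O(1 / sqrt h)\<close>, the test function has a vanishing norm.\<close>

lemma weakly_converges_L2_boundary_layers:
  assumes w: "\<And>k. w k \<in> L2_01" and v: "v \<in> L2_01"
    and h: "h \<longlonglongrightarrow> 0" "\<And>k. h k > 0"
    and inner: "\<And>e. e > 0 \<Longrightarrow> \<forall>\<^sub>F k in sequentially.
      \<forall>x\<in>{0<..<1}. 3 * h k \<le> x \<longrightarrow> x \<le> 1 - 3 * h k \<longrightarrow> \<bar>w k x - v x\<bar> \<le> e"
    and layer: "\<And>k x. x \<in> {0<..<1} \<Longrightarrow> h k * (w k x - v x)\<^sup>2 \<le> M"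
  shows "weakly_converges_L2 w v"
proof -
  define J where "J = (\<lambda>k. {0<..<3 * h k} \<union> {1 - 3 * h k<..<1})"
  have J_meas [measurable]: "J k \<in> sets borel" for k by (simp add: J_def)
  have J_ind: "indicator (J k) \<in> borel_measurable leb01" for k
    by (intro borel_measurable_leb01) simp
  have M: "M \<ge> 0" using layer[of "1 / 2" 0] h(2)[of 0] by (auto intro: order_trans[rotated])
  have J_int: "(LINT x|leb01. indicator (J k) x) \<le> 6 * h k" for k
  proof -
    have "(LINT x|leb01. indicator (J k) x) = measure leb01 (J k \<inter> {0<..<1})"
      by (simp add: J_def)
    also have "\<dots> = measure lborel (J k \<inter> {0<..<1})"
      unfolding measure_def by (subst emeasure_leb01) auto
    also have "\<dots> \<le> measure lborel ({0..3 * h k} \<union> {1 - 3 * h k..1})"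
    proof (rule measure_mono_fmeasurable)
      show "J k \<inter> {0<..<1} \<subseteq> {0..3 * h k} \<union> {1 - 3 * h k..1}" by (auto simp: J_def)
      show "{0..3 * h k} \<union> {1 - 3 * h k..1} \<in> fmeasurable lborel"
        by (intro fmeasurable.Un fmeasurableI) (auto simp: emeasure_lborel_Icc_eq)
    qed auto
    also have "\<dots> \<le> measure lborel {0..3 * h k} + measure lborel {1 - 3 * h k..1}"
      by (rule measure_Un_le) auto
    also have "\<dots> = 6 * h k" using h(2)[of k] by simp
    finally show ?thesis .
  qed
  have "(\<lambda>k. LINT x|leb01. w k x * p x) \<longlonglongrightarrow> (LINT x|leb01. v x * p x)" if p: "p \<in> L2_01" for p
  proof -
    have p_meas: "p \<in> borel_measurable leb01" and p2: "integrable leb01 (\<lambda>x. (p x)\<^sup>2)"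
      using p by (auto simp: L2_01_def)
    have p1: "integrable leb01 (\<lambda>x. \<bar>p x\<bar>)"
      using L2_01_product[OF p one_L2_01] by simp
    have Jp_meas: "(\<lambda>x. indicator (J k) x * (p x)\<^sup>2) \<in> borel_measurable leb01" for k
      by (intro borel_measurable_times borel_measurable_power J_ind p_meas)
    have Jp: "integrable leb01 (\<lambda>x. indicator (J k) x * (p x)\<^sup>2)" for k
      by (rule Bochner_Integration.integrable_bound[OF p2 Jp_meas]) (auto simp: indicator_def)
    \<comment> \<open>Every fixed \<open>x\<close> leaves the layers once \<open>3 * h k\<close> is
      below its distance to the end points, and \<open>(p x)^2\<close> dominates.\<close>
    have Jp_lim: "(\<lambda>k. LINT x|leb01. indicator (J k) x * (p x)\<^sup>2) \<longlonglongrightarrow> (LINT x|leb01. 0)"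
    proof (rule integral_dominated_convergence[where w = "\<lambda>x. (p x)\<^sup>2"])
      show "AE x in leb01. (\<lambda>k. indicator (J k) x * (p x)\<^sup>2) \<longlonglongrightarrow> 0"
      proof (rule AE_I2)
        fix x assume x: "x \<in> space leb01"
        have "(\<lambda>k. 3 * h k) \<longlonglongrightarrow> 3 * 0" by (intro tendsto_intros h)
        then have l: "(\<lambda>k. 3 * h k) \<longlonglongrightarrow> 0" by simp
        have "\<forall>\<^sub>F k in sequentially. 3 * h k < x" "\<forall>\<^sub>F k in sequentially. 3 * h k < 1 - x"
          using order_tendstoD(2)[OF l] x by auto
        then have "\<forall>\<^sub>F k in sequentially. indicator (J k) x * (p x)\<^sup>2 = 0"
          by eventually_elim (auto simp: J_def)
        then show "(\<lambda>k. indicator (J k) x * (p x)\<^sup>2) \<longlonglongrightarrow> 0"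
          by (rule tendsto_eventually)
      qed
    qed (use p2 Jp_meas in \<open>simp_all add: indicator_def\<close>)
    define P where "P = (LINT x|leb01. \<bar>p x\<bar>)"
    have P0: "P \<ge> 0" by (simp add: P_def)
    have "(\<lambda>k. (LINT x|leb01. w k x * p x) - (LINT x|leb01. v x * p x)) \<longlonglongrightarrow> 0"
    proof (rule tendstoI)
      fix e :: real assume e: "e > 0"
      \<comment> \<open>The interior error contributes \<open>r * P \<le> e / 4\<close>. The layers
        have total length at most \<open>6 * h k\<close>, so the squared error there contributes
        \<open>6 * (s * M) \<le> e / 4\<close>, whence 24 = 6 * 4.\<close>
      define r s where "r = e / (4 * (P + 1))" and "s = e / (24 * (M + 1))"
      have rs: "r > 0" "s > 0" using e P0 M by (auto simp: r_def s_def)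
      have cancel: "e / (c * t) * t = e / c" if "t > 0" for c t :: real using that by simp
      have rP: "r * P \<le> e / 4"
      proof -
        have "r * P \<le> r * (P + 1)" using rs by (intro mult_left_mono) auto
        also have "\<dots> = e / 4" unfolding r_def using P0 by (intro cancel) simp
        finally show ?thesis .
      qed
      have sM: "6 * (s * M) \<le> e / 4"
      proof -
        have "s * M \<le> s * (M + 1)" using rs by (intro mult_left_mono) auto
        also have "\<dots> = e / 24" unfolding s_def using M by (intro cancel) simp
        finally show ?thesis by simp
      qed
      \<comment> \<open>The threshold depends on the fixed \<open>s\<close>: the division by
        \<open>s\<close> in \<open>young_le\<close> leaves \<open>e / 4\<close>.\<close>
      have "\<forall>\<^sub>F k in sequentially. (LINT x|leb01. indicator (J k) x * (p x)\<^sup>2) < s * (e / 4)"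
        by (rule order_tendstoD(2)[OF Jp_lim]) (use e rs in simp)
      then show "\<forall>\<^sub>F k in sequentially.
        dist ((LINT x|leb01. w k x * p x) - (LINT x|leb01. v x * p x)) 0 < e"
        using inner[OF rs(1)]
      proof eventually_elim
        case (elim k)
        let ?b = "\<lambda>x. r * \<bar>p x\<bar> + (s * M / h k * indicator (J k) x + indicator (J k) x * (p x)\<^sup>2 / s)"
        have iJ: "integrable leb01 (indicator (J k) :: real \<Rightarrow> real)"
          by (rule integrable_leb01_bounded[OF J_ind, of _ 1]) (auto simp: indicator_def)
        have ib: "integrable leb01 ?b"
          by (intro Bochner_Integration.integrable_add integrable_mult_right integrable_divide p1 Jp iJ)
        have iq: "integrable leb01 (\<lambda>x. w k x * p x)" "integrable leb01 (\<lambda>x. v x * p x)"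
          by (intro L2_01_product p w v)+
        have diff: "(LINT x|leb01. w k x * p x) - (LINT x|leb01. v x * p x)
          = (LINT x|leb01. w k x * p x - v x * p x)"
          using iq by simp
        have "\<bar>LINT x|leb01. w k x * p x - v x * p x\<bar> \<le> (LINT x|leb01. ?b x)"
        proof (rule integral_abs_bound_integral)
          show "integrable leb01 (\<lambda>x. w k x * p x - v x * p x)" using iq by simp
          fix x assume "x \<in> space leb01"
          then have x: "x \<in> {0<..<1}" by simp
          have eq: "\<bar>w k x * p x - v x * p x\<bar> = \<bar>w k x - v x\<bar> * \<bar>p x\<bar>"
            by (simp add: abs_mult flip: left_diff_distrib)
          show "\<bar>w k x * p x - v x * p x\<bar> \<le> ?b x"
          proof (cases "x \<in> J k")
            case False
            then have "\<bar>w k x - v x\<bar> \<le> r" using elim(2) x by (auto simp: J_def)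
            then show ?thesis unfolding eq using False by (simp add: mult_right_mono)
          next
            case True
            let ?a = "\<bar>w k x - v x\<bar>" and ?p = "\<bar>p x\<bar>"
            have "?a * ?p \<le> s * ?a\<^sup>2 + ?p\<^sup>2 / s"
              using rs by (intro young_le) auto
            also have "s * ?a\<^sup>2 \<le> s * M / h k"
            proof -
              have "?a\<^sup>2 \<le> M / h k" using layer[OF x, of k] h(2)[of k] by (simp add: field_simps)
              then show ?thesis using rs mult_left_mono[of "?a\<^sup>2" "M / h k" s] by simp
            qed
            finally show ?thesis unfolding eq using True rs by (simp add: add_increasing)
          qed
        qed (rule ib)
        also have "\<dots> = r * P + (s * M / h k * (LINT x|leb01. indicator (J k) x)
            + (LINT x|leb01. indicator (J k) x * (p x)\<^sup>2) / s)"
          using p1 Jp[of k] iJ unfolding P_def by simp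
        also have "\<dots> \<le> e / 4 + (s * M / h k * (6 * h k) + s * (e / 4) / s)"
          using rP J_int[of k] elim(1) rs M h(2)[of k]
          by (intro add_mono mult_left_mono divide_right_mono) auto
        also have "\<dots> \<le> e / 4 + (e / 4 + e / 4)"
          using sM rs h(2)[of k] by simp
        also have "\<dots> < e" using e by simp
        finally show ?case unfolding dist_real_def diff by simp
      qed
    qed
    then show ?thesis by (rule LIM_zero_cancel)
  qed
  then show ?thesis using w v by (simp add: weakly_converges_L2_def)
qed

text \<open>On the layers the norm bound in the form \<open>h * v^2 \<le> C^2\<close> is available.
  In the interior the nodal limit of \<open>delta_x4\<close> extends to whole cells by uniform
  continuity of the limit.\<close>

lemma (in bounded_solution_sequence) weak_limit_delta_x4:
  assumes lim: "uniform_limit {0..1} Y (\<lambda>x. (a x, b x, c x, d x)) sequentially"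
  shows "weakly_converges_L2 (\<lambda>k. piecewise_linear (N k) (delta_x4 (N k) (u k))) (F a b c d)"
proof -
  let ?F = "F a b c d"
  note Fc = F_continuous[OF lim]
  have h: "mesh (N k) > 0" for k using N_pos by (rule mesh_pos)
  obtain K where K: "\<And>x. x \<in> {0..1} \<Longrightarrow> \<bar>?F x\<bar> \<le> K"
    using continuous_bounded01[OF Fc] by blast
  show ?thesis
  proof (rule weakly_converges_L2_boundary_layers[where h = "\<lambda>k. mesh (N k)" and M = "(C + K)\<^sup>2"])
    show "piecewise_linear (N k) (delta_x4 (N k) (u k)) \<in> L2_01" for k
      by (intro continuous_L2_01 continuous_on_piecewise_linear N_pos)
    show "?F \<in> L2_01" by (rule continuous_L2_01[OF Fc])
    show "(\<lambda>k. mesh (N k)) \<longlonglongrightarrow> 0" by (rule h_lim)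
    show "mesh (N k) > 0" for k by (rule h)
  next
    fix e :: real assume e: "e > 0"
    then have e2: "e / 2 > 0" by simp
    have "uniformly_continuous_on {0..1} ?F" using Fc by (intro compact_uniformly_continuous) auto
    then obtain s where s: "s > 0" "\<And>x y. x \<in> {0..1} \<Longrightarrow> y \<in> {0..1} \<Longrightarrow> dist y x < s \<Longrightarrow> dist (?F y) (?F x) < e / 2"
      using e2 unfolding uniformly_continuous_on_def by metis
    have hs: "\<forall>\<^sub>F k in sequentially. mesh (N k) < s"
      using h_lim s(1) by (rule order_tendstoD)
    show "\<forall>\<^sub>F k in sequentially. \<forall>x\<in>{0<..<1}. 3 * mesh (N k) \<le> x \<longrightarrow> x \<le> 1 - 3 * mesh (N k)
      \<longrightarrow> \<bar>piecewise_linear (N k) (delta_x4 (N k) (u k)) x - ?F x\<bar> \<le> e"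
      using delta_x4_limit[OF lim e2] hs
    proof eventually_elim
      case (elim k)
      show ?case
      proof (intro ballI impI)
        fix x :: real assume x: "x \<in> {0<..<1}" "3 * mesh (N k) \<le> x" "x \<le> 1 - 3 * mesh (N k)"
        let ?v = "delta_x4 (N k) (u k)" and ?x = "node (N k)"
        have x01: "x \<in> {0..1}" using x by auto
        obtain i where i: "i < N k" "?x i \<le> x" "x \<le> ?x (Suc i)"
          "\<And>z y e. \<bar>z i - y\<bar> \<le> e \<Longrightarrow> \<bar>z (Suc i) - y\<bar> \<le> e \<Longrightarrow> \<bar>piecewise_linear (N k) z x - y\<bar> \<le> e"
          using piecewise_linear_close[OF N_pos x01, of k] by blast
        \<comment> \<open>The margin of three cells puts both ends of the cell of \<open>x\<close>
          among the nodes 2 to \<open>N k - 2\<close>: the left margin gives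
          \<open>Suc i \<ge> 3\<close>, the right one \<open>i + 3 \<le> N k\<close>.\<close>
        have "3 * mesh (N k) \<le> real (Suc i) * mesh (N k)" using i(3) x(2) by (simp only: node_def)
        then have "2 \<le> i" using h[of k] by simp
        have "real i * mesh (N k) + 3 * mesh (N k) \<le> real (N k) * mesh (N k)"
          using i(2) x(3) node_last[OF N_pos, of k] by (simp only: node_def)
        then have "(real i + 3) * mesh (N k) \<le> real (N k) * mesh (N k)" by (simp add: distrib_right)
        then have "i + 3 \<le> N k" using h[of k] by simp
        have near: "\<bar>?v j - ?F x\<bar> \<le> e"
          if j: "2 \<le> j" "j + 2 \<le> N k" "dist (?x j) x \<le> mesh (N k)" for j
        proof -
          have "?x j \<in> {0..1}" using j by (intro node_in_unit) auto
          then have "dist (?F (?x j)) (?F x) < e / 2" using x01 j(3) elim(2) by (intro s(2)) auto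
          moreover have "\<bar>?v j - ?F (?x j)\<bar> \<le> e / 2" using elim(1) j by blast
          ultimately show ?thesis unfolding dist_real_def by linarith
        qed
        show "\<bar>piecewise_linear (N k) ?v x - ?F x\<bar> \<le> e"
        proof (rule i(4))
          show "\<bar>?v i - ?F x\<bar> \<le> e"
            using \<open>2 \<le> i\<close> \<open>i + 3 \<le> N k\<close> i(2,3) by (intro near) (auto simp: dist_real_def node_Suc)
          show "\<bar>?v (Suc i) - ?F x\<bar> \<le> e"
            using \<open>2 \<le> i\<close> \<open>i + 3 \<le> N k\<close> i(2,3) by (intro near) (auto simp: dist_real_def node_Suc)
        qed
      qed
    qed
  next
    fix k and x :: real assume x: "x \<in> {0<..<1}"
    interpret bounded_solution A B D H f C Q "N k" "u k" by (rule sol)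
    let ?w = "piecewise_linear (N k) v x"
    have "\<bar>v j\<bar> \<le> C / sqrt h" if "j \<le> N k" for j
    proof -
      have "sqrt h * (sqrt h * \<bar>v j\<bar>) \<le> sqrt h * C"
        using hv[OF that] h by (simp add: abs_mult mult.commute flip: mult.assoc)
      then show ?thesis using h by (simp add: pos_le_divide_eq mult.commute)
    qed
    then have "\<bar>?w\<bar> \<le> C / sqrt h" using x by (intro piecewise_linear_bounded N_pos) auto
    then have w: "sqrt h * \<bar>?w\<bar> \<le> C" using h by (simp add: pos_le_divide_eq mult.commute)
    have "sqrt h * \<bar>?F x\<bar> \<le> 1 * K"
      using mesh_le_1[of "N k"] h K[of x] x by (intro mult_mono) auto
    moreover have "sqrt h * \<bar>?w - ?F x\<bar> \<le> sqrt h * (\<bar>?w\<bar> + \<bar>?F x\<bar>)"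
      using h by (intro mult_left_mono abs_triangle_ineq4) auto
    ultimately have "sqrt h * \<bar>?w - ?F x\<bar> \<le> C + K" using w by (simp add: distrib_left)
    then have "(sqrt h * \<bar>?w - ?F x\<bar>)\<^sup>2 \<le> (C + K)\<^sup>2" using h by (intro power_mono) auto
    then show "h * (?w - ?F x)\<^sup>2 \<le> (C + K)\<^sup>2" using h by (simp add: power_mult_distrib)
  qed
qed

section \<open>Weak derivatives\<close>

lemma leb01_integral_continuous:
  fixes g :: "real \<Rightarrow> real"
  assumes "continuous_on {0..1} g"
  shows "(LINT x|leb01. g x) = integral {0..1} g"
  using lebesgue_integral_eq_integral[OF continuous_leb01(2)[OF assms]]
  by (simp add: integral_open_interval_real)

text \<open>The complement of the compact set \<open>K\<close> is open and contains 0 and 1, so all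
  derivatives vanish there along with \<open>p\<close>.\<close>

lemma test_function_derivs:
  assumes p: "p \<in> test_functions"
  shows "((deriv ^^ n) p has_real_derivative (deriv ^^ Suc n) p x) (at x)"
    and "(deriv ^^ n) p 0 = 0" and "(deriv ^^ n) p 1 = 0"
proof -
  have d: "((deriv ^^ n) p has_real_derivative (deriv ^^ Suc n) p x) (at x)" for n x
    using p by (simp add: test_functions_def DERIV_deriv_iff_real_differentiable)
  then show "((deriv ^^ n) p has_real_derivative (deriv ^^ Suc n) p x) (at x)" .
  obtain K where K: "compact K" "K \<subseteq> {0<..<1}" "\<And>x. x \<notin> K \<Longrightarrow> p x = 0"
    using p by (auto simp: test_functions_def)
  have op: "open (- K)" using K(1) compact_imp_closed by blast
  have z: "(deriv ^^ n) p x = 0" if "x \<notin> K" for n x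
    using that
  proof (induction n arbitrary: x)
    case (Suc n)
    have "((deriv ^^ n) p has_real_derivative 0) (at x)"
      by (rule has_field_derivative_transform_within_open[of "\<lambda>_. 0" 0 x "- K"])
        (use op Suc in auto)
    then show ?case using d[of n x] DERIV_unique by blast
  qed (use K in auto)
  have "0 \<notin> K" "1 \<notin> K" using K(2) by auto
  then show "(deriv ^^ n) p 0 = 0" "(deriv ^^ n) p 1 = 0" using z by auto
qed

lemma test_function_continuous: "p \<in> test_functions \<Longrightarrow> continuous_on S ((deriv ^^ n) p)"
  using test_function_derivs(1) by (meson DERIV_isCont continuous_at_imp_continuous_on)

lemma integration_by_parts_test_function:
  assumes w: "\<And>x. x \<in> {0..1} \<Longrightarrow> (w has_real_derivative w' x) (at x within {0..1})"
    and w': "continuous_on {0..1} w'" and p: "p \<in> test_functions"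
  shows "(LINT x|leb01. w x * (deriv ^^ Suc n) p x) = - (LINT x|leb01. w' x * (deriv ^^ n) p x)"
proof -
  have cw: "continuous_on {0..1} w"
    using w by (meson DERIV_continuous continuous_on_eq_continuous_within)
  let ?p = "\<lambda>n. (deriv ^^ n) p"
  note cp = test_function_continuous[OF p, of "{0..1}"]
  have "((\<lambda>x. w x * ?p (Suc n) x + w' x * ?p n x) has_integral (w 1 * ?p n 1 - w 0 * ?p n 0)) {0..1}"
  proof (rule fundamental_theorem_of_calculus)
    fix x :: real assume x: "x \<in> {0..1}"
    have "(?p n has_real_derivative ?p (Suc n) x) (at x within {0..1})"
      using test_function_derivs(1)[OF p] by (rule has_field_derivative_at_within)
    from DERIV_mult[OF w[OF x] this]
    show "((\<lambda>x. w x * ?p n x) has_vector_derivative w x * ?p (Suc n) x + w' x * ?p n x) (at x within {0..1})"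
      unfolding has_real_derivative_iff_has_vector_derivative by (simp add: algebra_simps)
  qed simp
  then have "integral {0..1} (\<lambda>x. w x * ?p (Suc n) x + w' x * ?p n x) = 0"
    using test_function_derivs(2,3)[OF p] by (simp add: integral_unique)
  moreover have "integral {0..1} (\<lambda>x. w x * ?p (Suc n) x + w' x * ?p n x)
    = integral {0..1} (\<lambda>x. w x * ?p (Suc n) x) + integral {0..1} (\<lambda>x. w' x * ?p n x)"
    by (intro integral_add integrable_continuous_real continuous_intros cw w' cp)
  ultimately show ?thesis
    by (subst (1 2) leb01_integral_continuous) (intro continuous_intros cw w' cp | simp)+
qed

text \<open>Integration by parts moves one derivative at a time onto \<open>w\<close>; after
  \<open>j\<close> moves the test function still carries \<open>n - j\<close> of them.\<close>

lemma weak_deriv_classical: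
  assumes w: "\<And>i x. i < m \<Longrightarrow> x \<in> {0..1} \<Longrightarrow> (w i has_real_derivative w (Suc i) x) (at x within {0..1})"
    and cw: "\<And>i. i \<le> m \<Longrightarrow> continuous_on {0..1} (w i)"
    and n: "n \<le> m"
  shows "weak_deriv n (w 0) (w n)"
  unfolding weak_deriv_def
proof
  fix p assume p: "p \<in> test_functions"
  have "(LINT x|leb01. w 0 x * (deriv ^^ n) p x)
    = (-1) ^ j * (LINT x|leb01. w j x * (deriv ^^ (n - j)) p x)" if "j \<le> n" for j
    using that
  proof (induction j)
    case (Suc j)
    then have s: "n - j = Suc (n - Suc j)" by simp
    have "(LINT x|leb01. w j x * (deriv ^^ (n - j)) p x)
      = - (LINT x|leb01. w (Suc j) x * (deriv ^^ (n - Suc j)) p x)"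
      unfolding s by (rule integration_by_parts_test_function) (use w cw n Suc.prems p in auto)
    then show ?case using Suc by simp
  qed simp
  from this[of n] show "(LINT x|leb01. w 0 x * (deriv ^^ n) p x) = (-1) ^ n * (LINT x|leb01. w n x * p x)"
    by simp
qed

lemma sobolev_classical:
  assumes "\<And>i x. i < m \<Longrightarrow> x \<in> {0..1} \<Longrightarrow> (w i has_real_derivative w (Suc i) x) (at x within {0..1})"
    and "\<And>i. i \<le> m \<Longrightarrow> continuous_on {0..1} (w i)"
  shows "w 0 \<in> sobolev m"
proof -
  have "\<exists>v\<in>L2_01. weak_deriv i (w 0) v" if "i \<le> m" for i
    using weak_deriv_classical[of m w i] continuous_L2_01[of "w i"] assms that by blast
  moreover have "w 0 \<in> L2_01" using assms(2) by (intro continuous_L2_01) simp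
  ultimately show ?thesis unfolding sobolev_def by blast
qed

section \<open>Smooth cutoff functions\<close>

text \<open>The derivatives of a bump \<open>poly q x * exp (- c / poly S x)\<close>, cut off to the set where \<open>S\<close> is
  positive, stay in the following family.\<close>

definition bump :: "real \<Rightarrow> real poly \<Rightarrow> nat \<Rightarrow> real poly \<Rightarrow> real \<Rightarrow> real" where
  "bump c S n q x =
     (if poly S x > 0 then poly q x / poly S x ^ n * exp (- c / poly S x) else 0)"

text \<open>With \<open>k = n + 2\<close>, raising
  \<open>c / (k * t) \<le> exp (c / (k * t))\<close> to the power \<open>k\<close> bounds
  \<open>exp (- c / t)\<close> by a multiple of \<open>t ^ k\<close>. This is two powers more than
  the denominator, so \<open>t^2\<close> survives.\<close>

lemma exp_minus_inverse_le:
  fixes c t :: real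
  assumes "c > 0" "t > 0"
  shows "exp (- c / t) / t ^ n \<le> (real (n + 2) / c) ^ (n + 2) * t\<^sup>2"
proof -
  let ?k = "n + 2"
  have "(c / (real ?k * t)) ^ ?k \<le> exp (c / (real ?k * t)) ^ ?k"
  proof (rule power_mono)
    show "c / (real ?k * t) \<le> exp (c / (real ?k * t))"
      using exp_ge_add_one_self[of "c / (real ?k * t)"] by linarith
  qed (use assms in simp)
  also have "\<dots> = exp (c / t)"
  proof -
    have "K * (c / (K * t)) = c / t" if "K > 0" for K :: real using that by simp
    from this[of "real ?k"] show ?thesis unfolding exp_of_nat_mult[symmetric] by simp
  qed
  finally have "1 / exp (c / t) \<le> 1 / (c / (real ?k * t)) ^ ?k"
    using assms by (intro divide_left_mono) auto
  also have "\<dots> = (real ?k / c) ^ ?k * t ^ ?k"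
    using assms by (simp only: power_divide power_mult_distrib) (simp add: field_simps)
  finally have "exp (- c / t) \<le> (real ?k / c) ^ ?k * t ^ ?k"
    by (simp add: exp_minus inverse_eq_divide)
  then have "exp (- c / t) / t ^ n \<le> (real ?k / c) ^ ?k * t ^ ?k / t ^ n"
    using assms by (intro divide_right_mono) auto
  also have "\<dots> = (real ?k / c) ^ ?k * t\<^sup>2" using assms by (simp add: power_add power2_eq_square)
  finally show ?thesis .
qed

text \<open>The majorant vanishes to second order at every zero of \<open>S\<close>, which forces a
  zero derivative of the bump there.\<close>

lemma bump_abs_le:
  assumes "c > 0"
  shows "\<bar>bump c S n q x\<bar> \<le> (real (n + 2) / c) ^ (n + 2) * \<bar>poly (q * S\<^sup>2) x\<bar>"
proof (cases "poly S x > 0")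
  case True
  have "\<bar>bump c S n q x\<bar> = \<bar>poly q x\<bar> * (exp (- c / poly S x) / poly S x ^ n)"
    using True by (simp add: bump_def abs_mult)
  also have "\<dots> \<le> \<bar>poly q x\<bar> * ((real (n + 2) / c) ^ (n + 2) * (poly S x)\<^sup>2)"
    using exp_minus_inverse_le[OF assms True] by (intro mult_left_mono) auto
  finally show ?thesis by (simp add: abs_mult mult_ac)
next
  case False
  then show ?thesis using assms by (simp add: bump_def)
qed

text \<open>Where \<open>S\<close> is positive the quotient rule brings everything over
  \<open>S ^ (n + 2)\<close>; where it is negative the function is locally zero. At a zero of
  \<open>S\<close> the difference quotient is dominated by a multiple of that of
  \<open>q * S\<^sup>2\<close>, whose derivative is 0.\<close>

lemma bump_deriv:
  assumes "c > 0"
  shows "(bump c S n q has_real_derivative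
    bump c S (n + 2) (pderiv q * S\<^sup>2 - of_nat n * q * pderiv S * S + [:c:] * q * pderiv S) x) (at x)"
    (is "(_ has_real_derivative bump c S _ ?Q x) _")
proof -
  have cont: "isCont (poly S) x" by simp
  consider "poly S x > 0" | "poly S x < 0" | "poly S x = 0" by linarith
  then show ?thesis
  proof cases
    case 1
    let ?s = "poly S x" and ?s' = "poly (pderiv S) x"
    have ev: "\<forall>\<^sub>F y in nhds x. bump c S n q y = poly q y / poly S y ^ n * exp (- c / poly S y)"
    proof -
      have "\<forall>\<^sub>F y in nhds x. poly S y > 0"
        using order_tendstoD(1)[OF isCont_tendsto_compose[OF cont filterlim_ident] 1] .
      then show ?thesis by eventually_elim (simp add: bump_def)
    qed
    have "((\<lambda>y. poly q y / poly S y ^ n * exp (- c / poly S y)) has_real_derivative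
      ((poly (pderiv q) x * ?s ^ n - poly q x * (real n * (?s' * ?s ^ (n - 1)))) / (?s ^ n * ?s ^ n))
        * exp (- c / ?s) + poly q x / ?s ^ n * (exp (- c / ?s) * (c * ?s' / (?s * ?s)))) (at x)"
      using 1 by (auto intro!: derivative_eq_intros simp: field_simps)
    moreover have "((poly (pderiv q) x * ?s ^ n - poly q x * (real n * (?s' * ?s ^ (n - 1)))) / (?s ^ n * ?s ^ n))
        * exp (- c / ?s) + poly q x / ?s ^ n * (exp (- c / ?s) * (c * ?s' / (?s * ?s)))
      = poly ?Q x / ?s ^ (n + 2) * exp (- c / ?s)"
    proof -
      \<comment> \<open>Multiplying by \<open>?s\<close> also covers \<open>n = 0\<close>, where
        \<open>n - 1\<close> is truncated.\<close>
      have "real n * ?s ^ (n - 1) * ?s = real n * ?s ^ n" by (cases n) auto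
      then have "real n * ?s ^ (n - 1) = real n * ?s ^ n / ?s" using 1 by (simp add: field_simps)
      then have a: "poly q x * (real n * (?s' * ?s ^ (n - 1))) = poly q x * ?s' * (real n * ?s ^ n / ?s)"
        by (metis mult.assoc mult.left_commute)
      show ?thesis unfolding a using 1
        by (simp add: field_simps power_add power2_eq_square of_nat_poly)
    qed
    moreover have "bump c S (n + 2) ?Q x = poly ?Q x / ?s ^ (n + 2) * exp (- c / ?s)"
      unfolding bump_def using 1 by (simp only: if_True)
    ultimately show ?thesis unfolding DERIV_cong_ev[OF refl ev refl] by (simp only:)
  next
    case 2
    have "\<forall>\<^sub>F y in nhds x. poly S y < 0"
      using order_tendstoD(2)[OF isCont_tendsto_compose[OF cont filterlim_ident] 2] .
    then have ev: "\<forall>\<^sub>F y in nhds x. bump c S n q y = 0"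
      by eventually_elim (simp add: bump_def)
    have "bump c S (n + 2) ?Q x = 0" using 2 by (simp add: bump_def)
    then show ?thesis using DERIV_cong_ev[OF refl ev refl] by simp
  next
    case 3
    let ?R = "q * S\<^sup>2" and ?M = "(real (n + 2) / c) ^ (n + 2)"
    have R0: "poly ?R x = 0" "poly (pderiv ?R) x = 0"
      using 3 by (simp_all add: pderiv_mult power2_eq_square)
    have "(poly ?R has_real_derivative 0) (at x)" using poly_DERIV[of ?R x] unfolding R0(2) .
    then have "((\<lambda>h. (poly ?R (x + h) - poly ?R x) / h) \<longlongrightarrow> 0) (at 0)"
      by (simp add: DERIV_def)
    then have "((\<lambda>h. poly ?R (x + h) / h) \<longlongrightarrow> 0) (at 0)" unfolding R0(1) by simp
    then have "((\<lambda>h. ?M * \<bar>poly ?R (x + h) / h\<bar>) \<longlongrightarrow> ?M * \<bar>0\<bar>) (at 0)"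
      by (intro tendsto_intros)
    then have lim: "((\<lambda>h. ?M * \<bar>poly ?R (x + h) / h\<bar>) \<longlongrightarrow> 0) (at 0)" by simp
    have "((\<lambda>h. bump c S n q (x + h) / h) \<longlongrightarrow> 0) (at 0)"
    proof (rule Lim_null_comparison[OF always_eventually lim], rule allI)
      fix h :: real
      have "\<bar>bump c S n q (x + h)\<bar> / \<bar>h\<bar> \<le> ?M * \<bar>poly ?R (x + h)\<bar> / \<bar>h\<bar>"
        by (intro divide_right_mono bump_abs_le assms) auto
      then show "norm (bump c S n q (x + h) / h) \<le> ?M * \<bar>poly ?R (x + h) / h\<bar>"
        by simp
    qed
    then have "(bump c S n q has_real_derivative 0) (at x)"
      using 3 by (simp add: DERIV_def bump_def)
    moreover have "bump c S (n + 2) ?Q x = 0" using 3 by (simp add: bump_def)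
    ultimately show ?thesis by simp
  qed
qed

lemma bump_funpow_deriv:
  assumes "c > 0"
  shows "\<exists>n' q'. (deriv ^^ k) (bump c S n q) = bump c S n' q'"
proof (induction k)
  case (Suc k)
  then obtain n' q' where "(deriv ^^ k) (bump c S n q) = bump c S n' q'" by blast
  moreover have "deriv (bump c S n' q') = bump c S (n' + 2)
      (pderiv q' * S\<^sup>2 - of_nat n' * q' * pderiv S * S + [:c:] * q' * pderiv S)"
    using bump_deriv[OF assms] by (intro ext DERIV_imp_deriv)
  ultimately show ?case by auto
qed auto

lemma bump_smooth:
  assumes "c > 0"
  shows "(deriv ^^ k) (bump c S n q) differentiable (at x)"
  using bump_funpow_deriv[OF assms, of k S n q] bump_deriv[OF assms] real_differentiable_def by metis

lemma bump_continuous: "c > 0 \<Longrightarrow> continuous_on A (bump c S n q)"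
  using bump_deriv by (meson DERIV_isCont continuous_at_imp_continuous_on)

definition cut :: "real \<Rightarrow> real poly" where
  "cut c = [:- c * (1 - c), 1, - 1:]"

lemma cut_eq: "poly (cut c) x = (x - c) * (1 - c - x)"
  by (simp add: cut_def algebra_simps)

lemma cut_pos: "0 < c \<Longrightarrow> c < 1 / 2 \<Longrightarrow> poly (cut c) x > 0 \<longleftrightarrow> c < x \<and> x < 1 - c"
  by (auto simp: cut_eq zero_less_mult_iff)

text \<open>The parameter is both the margin of the support and the weight in the exponent, so a
  single limit \<open>c \<rightarrow> 0\<close> makes the support fill the interval and the values
  tend to 1.\<close>

definition cutoff :: "real \<Rightarrow> real \<Rightarrow> real" where
  "cutoff c = bump c (cut c) 0 1"

lemma bump_cutoff: "bump c (cut c) 0 q x = poly q x * cutoff c x"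
  by (simp add: cutoff_def bump_def)

lemma cutoff_range: "c > 0 \<Longrightarrow> cutoff c x \<in> {0..1}"
  by (simp add: cutoff_def bump_def)

lemma cutoff_outside: "0 < c \<Longrightarrow> c < 1 / 2 \<Longrightarrow> x \<notin> {c..1 - c} \<Longrightarrow> cutoff c x = 0"
  using cut_pos[of c x] by (auto simp: cutoff_def bump_def)

lemma cutoff_continuous: "c > 0 \<Longrightarrow> continuous_on A (cutoff c)"
  unfolding cutoff_def by (rule bump_continuous)

text \<open>Dominated convergence along \<open>c k = 1 / (k + 3)\<close>, where the shift by 3 keeps
  the margin below 1/2.\<close>

lemma cutoff_mass:
  assumes "r > 0"
  obtains c where "0 < c" "c < 1 / 2" "(LINT x|leb01. 1 - cutoff c x) < r"
proof -
  define c where "c = (\<lambda>k::nat. 1 / (real k + 3))"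
  have c: "0 < c k" "c k < 1 / 2" for k by (auto simp: c_def field_simps)
  have c0: "c \<longlonglongrightarrow> 0" unfolding c_def by real_asymp
  have "(\<lambda>k. LINT x|leb01. 1 - cutoff (c k) x) \<longlonglongrightarrow> (LINT x|leb01. 0)"
  proof (rule integral_dominated_convergence[where w = "\<lambda>_. 1"])
    show "AE x in leb01. (\<lambda>k. 1 - cutoff (c k) x) \<longlonglongrightarrow> 0"
    proof (rule AE_I2)
      fix x assume "x \<in> space leb01"
      then have x: "0 < x" "x < 1" by auto
      have S: "(\<lambda>k. poly (cut (c k)) x) \<longlonglongrightarrow> (x - 0) * (1 - 0 - x)"
        unfolding cut_eq by (intro tendsto_intros c0)
      have "(\<lambda>k. exp (- c k / poly (cut (c k)) x)) \<longlonglongrightarrow> exp (- 0 / ((x - 0) * (1 - 0 - x)))"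
        using x by (intro tendsto_intros S c0) auto
      then have "(\<lambda>k. 1 - exp (- c k / poly (cut (c k)) x)) \<longlonglongrightarrow> 1 - 1"
        by (intro tendsto_intros) simp
      moreover have "\<forall>\<^sub>F k in sequentially. poly (cut (c k)) x > 0"
        using order_tendstoD(1)[OF S, of 0] x by simp
      then have "\<forall>\<^sub>F k in sequentially. 1 - exp (- c k / poly (cut (c k)) x) = 1 - cutoff (c k) x"
        by eventually_elim (simp add: cutoff_def bump_def)
      ultimately have "(\<lambda>k. 1 - cutoff (c k) x) \<longlonglongrightarrow> 1 - 1"
        by (rule Lim_transform_eventually)
      then show "(\<lambda>k. 1 - cutoff (c k) x) \<longlonglongrightarrow> 0" by simp
    qed
    show "(\<lambda>x. 1 - cutoff (c k) x) \<in> borel_measurable leb01" for k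
      by (intro continuous_leb01 continuous_intros cutoff_continuous c)
    show "AE x in leb01. norm (1 - cutoff (c k) x) \<le> 1" for k
      using cutoff_range[OF c(1)] by (intro AE_I2) auto
  qed auto
  then have "\<forall>\<^sub>F k in sequentially. (LINT x|leb01. 1 - cutoff (c k) x) < r"
    using assms by (intro order_tendstoD) auto
  from eventually_happens'[OF sequentially_bot this]
  obtain k where "(LINT x|leb01. 1 - cutoff (c k) x) < r" ..
  with c show ?thesis using that by blast
qed

section \<open>Approximation by test functions\<close>

text \<open>A 2 by 2 linear system whose matrix consists of moments of \<open>\<eta>\<close>. For
  \<open>\<eta> = 1\<close> its determinant is 1/3 - 1/4 = 1/12; a mass defect of at most 1/100
  still leaves 99/100 * 8/25 - 1/4 > 1/20. The numerators are at most \<open>2 * T\<close>, which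
  gives the factor 40.\<close>

lemma moment_correction:
  fixes \<eta> q :: "real \<Rightarrow> real"
  assumes \<eta>: "continuous_on {0..1} \<eta>" "\<And>x. x \<in> {0..1} \<Longrightarrow> \<eta> x \<in> {0..1}"
    and q: "continuous_on {0..1} q"
    and mass: "integral {0..1} (\<lambda>x. 1 - \<eta> x) \<le> 1 / 100"
    and T: "\<bar>integral {0..1} (\<lambda>x. q x * \<eta> x)\<bar> \<le> T" "\<bar>integral {0..1} (\<lambda>x. x * (q x * \<eta> x))\<bar> \<le> T"
  obtains \<alpha> \<beta> where "\<bar>\<alpha>\<bar> \<le> 40 * T" "\<bar>\<beta>\<bar> \<le> 40 * T"
    "integral {0..1} (\<lambda>x. (q x + (\<alpha> + \<beta> * x)) * \<eta> x) = 0"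
    "integral {0..1} (\<lambda>x. x * ((q x + (\<alpha> + \<beta> * x)) * \<eta> x)) = 0"
proof -
  let ?I = "integral {0..1::real}"
  define a where "a = (\<lambda>k::nat. ?I (\<lambda>x. x ^ k * \<eta> x))"
  define b0 b1 where "b0 = ?I (\<lambda>x. q x * \<eta> x)" and "b1 = ?I (\<lambda>x. x * (q x * \<eta> x))"
  define s where "s = ?I (\<lambda>x. 1 - \<eta> x)"
  have pow: "?I (\<lambda>x. x ^ k) = 1 / real (Suc k)" for k
  proof -
    have "((\<lambda>x. x ^ k) has_integral (1 ^ Suc k / real (Suc k) - 0 ^ Suc k / real (Suc k))) {0..1}"
    proof (rule fundamental_theorem_of_calculus)
      fix x :: real
      have "((\<lambda>x. x ^ Suc k / real (Suc k)) has_real_derivative x ^ k) (at x within {0..1})"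
        using DERIV_cdivide[OF DERIV_pow[of "Suc k" x "{0..1}"], of "real (Suc k)"] by simp
      then show "((\<lambda>x. x ^ Suc k / real (Suc k)) has_vector_derivative x ^ k) (at x within {0..1})"
        by (simp only: has_real_derivative_iff_has_vector_derivative)
    qed simp
    then show ?thesis by (simp add: integral_unique)
  qed
  have a_bounds: "1 / real (Suc k) - 1 / 100 \<le> a k \<and> a k \<le> 1 / real (Suc k)" for k
  proof -
    have ci: "(\<lambda>x::real. x ^ k) integrable_on {0..1}" "(\<lambda>x. x ^ k * \<eta> x) integrable_on {0..1}"
      "(\<lambda>x. x ^ k - x ^ k * \<eta> x) integrable_on {0..1}" "(\<lambda>x. 1 - \<eta> x) integrable_on {0..1}"
      by (intro integrable_continuous_real continuous_intros \<eta>(1))+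
    have d: "?I (\<lambda>x. x ^ k - x ^ k * \<eta> x) = 1 / real (Suc k) - a k"
      unfolding a_def pow[symmetric] by (intro integral_diff ci)
    have pt: "0 \<le> x ^ k - x ^ k * \<eta> x" "x ^ k - x ^ k * \<eta> x \<le> 1 - \<eta> x" if "x \<in> {0..1}" for x
    proof -
      have "x ^ k - x ^ k * \<eta> x = x ^ k * (1 - \<eta> x)" by (simp add: right_diff_distrib)
      moreover have "0 \<le> x ^ k" "x ^ k \<le> 1" using that by (auto simp: power_le_one)
      ultimately show "0 \<le> x ^ k - x ^ k * \<eta> x" "x ^ k - x ^ k * \<eta> x \<le> 1 - \<eta> x"
        using \<eta>(2)[OF that] by (auto simp: mult_left_le_one_le)
    qed
    have "0 \<le> ?I (\<lambda>x. x ^ k - x ^ k * \<eta> x)" by (rule integral_nonneg[OF ci(3)]) (rule pt)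
    moreover have "?I (\<lambda>x. x ^ k - x ^ k * \<eta> x) \<le> s"
      unfolding s_def by (rule integral_le[OF ci(3,4)]) (rule pt)
    ultimately show ?thesis using mass unfolding d s_def by linarith
  qed
  define det where "det = a 0 * a 2 - a 1 * a 1"
  have a: "99 / 100 \<le> a 0" "a 0 \<le> 1" "0 \<le> a 1" "a 1 \<le> 1 / 2" "8 / 25 \<le> a 2" "a 2 \<le> 1"
    using a_bounds[of 0] a_bounds[of 1] a_bounds[of 2] by simp_all
  have "99 / 100 * (8 / 25) \<le> a 0 * a 2" using a by (intro mult_mono) auto
  moreover have "a 1 * a 1 \<le> 1 / 2 * (1 / 2)" using a by (intro mult_mono) auto
  ultimately have det: "det \<ge> 1 / 20" unfolding det_def by simp
  \<comment> \<open>Cramer's rule with right-hand sides \<open>- b0\<close> and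
    \<open>- b1\<close>.\<close>
  define \<alpha> \<beta> where "\<alpha> = (a 1 * b1 - a 2 * b0) / det" and "\<beta> = (a 1 * b0 - a 0 * b1) / det"
  have T': "\<bar>b0\<bar> \<le> T" "\<bar>b1\<bar> \<le> T" using T by (simp_all add: b0_def b1_def)
  have bound: "\<bar>(y * t - z * r) / det\<bar> \<le> 40 * T"
    if "0 \<le> y" "y \<le> 1" "0 \<le> z" "z \<le> 1" "\<bar>t\<bar> \<le> T" "\<bar>r\<bar> \<le> T" for y z t r
  proof -
    have "\<bar>y * t\<bar> \<le> 1 * T" "\<bar>z * r\<bar> \<le> 1 * T" unfolding abs_mult using that by (intro mult_mono; simp)+
    then have n: "\<bar>y * t - z * r\<bar> \<le> 2 * T" by linarith
    have "\<bar>(y * t - z * r) / det\<bar> = \<bar>y * t - z * r\<bar> / det" using det by (simp add: abs_divide)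
    also have "\<dots> \<le> 2 * T / (1 / 20)" using n det by (intro frac_le) auto
    finally show ?thesis by simp
  qed
  have "det \<noteq> 0" using det by simp
  have lin: "b0 + \<alpha> * a 0 + \<beta> * a 1 = 0" "b1 + \<alpha> * a 1 + \<beta> * a 2 = 0"
  proof -
    have "det * (b0 + \<alpha> * a 0 + \<beta> * a 1) = det * b0 + (a 1 * b1 - a 2 * b0) * a 0 + (a 1 * b0 - a 0 * b1) * a 1"
      using \<open>det \<noteq> 0\<close> by (simp add: \<alpha>_def \<beta>_def distrib_left)
    also have "\<dots> = 0" by (simp add: det_def algebra_simps)
    finally show "b0 + \<alpha> * a 0 + \<beta> * a 1 = 0" using \<open>det \<noteq> 0\<close> by simp
    have "det * (b1 + \<alpha> * a 1 + \<beta> * a 2) = det * b1 + (a 1 * b1 - a 2 * b0) * a 1 + (a 1 * b0 - a 0 * b1) * a 2"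
      using \<open>det \<noteq> 0\<close> by (simp add: \<alpha>_def \<beta>_def distrib_left)
    also have "\<dots> = 0" by (simp add: det_def algebra_simps)
    finally show "b1 + \<alpha> * a 1 + \<beta> * a 2 = 0" using \<open>det \<noteq> 0\<close> by simp
  qed
  have hi: "((\<lambda>x. x ^ k * \<eta> x) has_integral a k) {0..1}" for k
    unfolding a_def by (intro integrable_integral integrable_continuous_real continuous_intros \<eta>(1))
  have hq: "((\<lambda>x. q x * \<eta> x) has_integral b0) {0..1}" "((\<lambda>x. x * (q x * \<eta> x)) has_integral b1) {0..1}"
    unfolding b0_def b1_def
    by (intro integrable_integral integrable_continuous_real continuous_intros \<eta>(1) q)+
  have "((\<lambda>x. q x * \<eta> x + \<alpha> * (x ^ 0 * \<eta> x) + \<beta> * (x ^ 1 * \<eta> x)) has_integral (b0 + \<alpha> * a 0 + \<beta> * a 1)) {0..1}"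
    by (intro has_integral_add has_integral_mult_right hi hq)
  moreover have "(\<lambda>x. q x * \<eta> x + \<alpha> * (x ^ 0 * \<eta> x) + \<beta> * (x ^ 1 * \<eta> x)) = (\<lambda>x. (q x + (\<alpha> + \<beta> * x)) * \<eta> x)"
    by (auto simp: algebra_simps)
  ultimately have 1: "integral {0..1} (\<lambda>x. (q x + (\<alpha> + \<beta> * x)) * \<eta> x) = 0"
    unfolding lin by (simp add: integral_unique)
  have "((\<lambda>x. x * (q x * \<eta> x) + \<alpha> * (x ^ 1 * \<eta> x) + \<beta> * (x ^ 2 * \<eta> x)) has_integral (b1 + \<alpha> * a 1 + \<beta> * a 2)) {0..1}"
    by (intro has_integral_add has_integral_mult_right hi hq)
  moreover have "(\<lambda>x. x * (q x * \<eta> x) + \<alpha> * (x ^ 1 * \<eta> x) + \<beta> * (x ^ 2 * \<eta> x)) = (\<lambda>x. x * ((q x + (\<alpha> + \<beta> * x)) * \<eta> x))"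
    by (auto simp: algebra_simps power2_eq_square)
  ultimately have 2: "integral {0..1} (\<lambda>x. x * ((q x + (\<alpha> + \<beta> * x)) * \<eta> x)) = 0"
    unfolding lin by (simp add: integral_unique)
  show ?thesis
    by (rule that[OF _ _ 1 2]) (use bound a T' in \<open>auto simp: \<alpha>_def \<beta>_def\<close>)
qed

text \<open>A primitive is constant on either side of \<open>{c..d}\<close>. Normalised at 0 it
  vanishes on the left, and its value on the right is the integral of \<open>F\<close>.\<close>

lemma compactly_supported_antiderivative:
  fixes F :: "real \<Rightarrow> real"
  assumes F: "continuous_on UNIV F" and c: "0 < c" "d < 1" and z: "\<And>x. x \<notin> {c..d} \<Longrightarrow> F x = 0"
    and int: "integral {0..1} F = 0"
  obtains P where "\<And>x. (P has_real_derivative F x) (at x)" "\<And>x. x \<notin> {c..d} \<Longrightarrow> P x = 0"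
proof -
  have "\<exists>G. \<forall>x::real. - \<infinity> < ereal x \<longrightarrow> ereal x < \<infinity> \<longrightarrow> (G has_vector_derivative F x) (at x)"
    using F by (intro einterval_antiderivative) (auto simp: continuous_on_eq_continuous_at)
  then obtain G where G: "\<And>x. (G has_real_derivative F x) (at x)"
    by (auto simp: has_real_derivative_iff_has_vector_derivative)
  define P where "P = (\<lambda>x. G x - G 0)"
  have P: "(P has_real_derivative F x) (at x)" for x
    unfolding P_def using G[of x] by (auto intro!: derivative_eq_intros)
  have const: "P x = P y" if "convex S" "S \<inter> {c..d} = {}" "x \<in> S" "y \<in> S" for x y S
  proof -
    have "(P has_real_derivative 0) (at x within S)" if "x \<in> S" for x
      using P[of x] z[of x] \<open>S \<inter> {c..d} = {}\<close> that
      by (metis disjoint_iff has_field_derivative_at_within)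
    then show ?thesis using has_field_derivative_zero_constant[of S P] that by metis
  qed
  have "(F has_integral (P 1 - P 0)) {0..1}"
    by (rule fundamental_theorem_of_calculus)
      (use P in \<open>auto simp: has_real_derivative_iff_has_vector_derivative[symmetric]
        intro: has_field_derivative_at_within\<close>)
  then have "P 1 = 0" using int by (simp add: integral_unique P_def)
  have "P x = 0" if "x \<notin> {c..d}" for x
  proof (cases "x < c")
    case True
    then have "P x = P 0" by (intro const[of "{..<c}"]) (use c in auto)
    then show ?thesis by (simp add: P_def)
  next
    case False
    then have "P x = P 1" by (intro const[of "{d<..}"]) (use c that in auto)
    then show ?thesis using \<open>P 1 = 0\<close> by simp
  qed
  then show ?thesis using that P by blast
qed

text \<open>The vanishing integral gives the first primitive compact support. Integration by parts
  equates the integral of that primitive with minus the first moment of \<open>F\<close>, so the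
  second primitive has compact support too.\<close>

lemma test_function_from_second_derivative:
  assumes F: "\<And>k x. (deriv ^^ k) F differentiable (at x)" and c: "0 < c" "d < 1"
    and z: "\<And>x. x \<notin> {c..d} \<Longrightarrow> F x = 0"
    and int: "integral {0..1} F = 0" "integral {0..1} (\<lambda>x. x * F x) = 0"
  obtains p p' where "p \<in> test_functions" "deriv p = p'" "deriv p' = F"
    "\<And>x. (p has_real_derivative p' x) (at x)" "\<And>x. (p' has_real_derivative F x) (at x)"
    "p 0 = 0" "p' 0 = 0"
proof -
  have Fc: "continuous_on S F" for S
    using F[of 0] by (auto intro!: continuous_at_imp_continuous_on differentiable_imp_continuous_within)
  obtain p' where p': "\<And>x. (p' has_real_derivative F x) (at x)" "\<And>x. x \<notin> {c..d} \<Longrightarrow> p' x = 0"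
    using compactly_supported_antiderivative[OF Fc c z int(1)] by blast
  then have p'c: "continuous_on S p'" for S
    by (meson DERIV_isCont continuous_at_imp_continuous_on)
  have "((\<lambda>x. p' x + x * F x) has_integral (1 * p' 1 - 0 * p' 0)) {0..1}"
  proof (rule fundamental_theorem_of_calculus)
    fix x :: real
    have "((\<lambda>x. x * p' x) has_real_derivative 1 * p' x + F x * x) (at x within {0..1})"
      by (intro DERIV_mult DERIV_ident has_field_derivative_at_within[OF p'(1)])
    then show "((\<lambda>x. x * p' x) has_vector_derivative p' x + x * F x) (at x within {0..1})"
      by (simp add: has_real_derivative_iff_has_vector_derivative mult.commute)
  qed simp
  then have "integral {0..1} (\<lambda>x. p' x + x * F x) = 0"
    using p'(2)[of 1] c by (simp add: integral_unique)
  moreover have "integral {0..1} (\<lambda>x. p' x + x * F x) = integral {0..1} p' + integral {0..1} (\<lambda>x. x * F x)"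
    by (intro integral_add integrable_continuous_real continuous_intros p'c Fc)
  ultimately have "integral {0..1} p' = 0" using int(2) by simp
  then obtain p where p: "\<And>x. (p has_real_derivative p' x) (at x)" "\<And>x. x \<notin> {c..d} \<Longrightarrow> p x = 0"
    using compactly_supported_antiderivative[OF p'c c p'(2)] by blast
  have d: "deriv p = p'" "deriv p' = F"
    using p(1) p'(1) by (auto intro!: DERIV_imp_deriv)
  have "(deriv ^^ n) p differentiable (at x)" for n x
  proof -
    consider "n = 0" | "n = 1" | k where "n = Suc (Suc k)" by (metis One_nat_def not0_implies_Suc)
    then show ?thesis
    proof cases
      case 1 then show ?thesis using p(1) real_differentiable_def by auto
    next
      case 2 then show ?thesis using p'(1) d real_differentiable_def by auto
    next
      case 3
      then have "(deriv ^^ n) p = (deriv ^^ k) F" by (simp add: funpow_swap1 d)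
      then show ?thesis using F by simp
    qed
  qed
  moreover have "{c..d} \<subseteq> {0<..<1}" using c by auto
  ultimately have "p \<in> test_functions"
    unfolding test_functions_def using p(2) by (auto intro!: exI[of _ "{c..d}"])
  moreover have "p 0 = 0" "p' 0 = 0" using p(2) p'(2) c by auto
  ultimately show ?thesis using that d p(1) p'(1) by blast
qed

text \<open>Turns an L^1 bound on the error of the second derivative into uniform bounds for the
  first derivative and the function.\<close>

lemma primitive_abs_le:
  fixes w g :: "real \<Rightarrow> real"
  assumes "\<And>x. x \<in> {0..1} \<Longrightarrow> (w has_real_derivative g x) (at x within {0..1})"
    and "w 0 = 0" and g: "continuous_on {0..1} g" and x: "x \<in> {0..1}"
  shows "\<bar>w x\<bar> \<le> integral {0..1} (\<lambda>t. \<bar>g t\<bar>)"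
proof -
  have sub: "{0..x} \<subseteq> {0..1}" using x by auto
  have "(g has_integral (w x - w 0)) {0..x}"
  proof (rule fundamental_theorem_of_calculus)
    fix t assume "t \<in> {0..x}"
    then have "(w has_real_derivative g t) (at t within {0..x})"
      using assms(1)[of t] x sub by (intro has_field_derivative_subset[OF assms(1) sub]) auto
    then show "(w has_vector_derivative g t) (at t within {0..x})"
      by (simp add: has_real_derivative_iff_has_vector_derivative)
  qed (use x in simp)
  then have "w x = integral {0..x} g" using assms(2) by (simp add: integral_unique)
  also have "norm \<dots> \<le> integral {0..x} (\<lambda>t. norm (g t))"
    by (intro Henstock_Kurzweil_Integration.integral_norm_bound_integral integrable_continuous_real
        continuous_on_norm continuous_on_subset[OF g sub]) simp
  also have "\<dots> \<le> integral {0..1} (\<lambda>t. norm (g t))"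
    by (intro integral_subset_le sub integrable_continuous_real continuous_intros g continuous_on_subset[OF g sub]) auto
  finally show ?thesis by simp
qed

lemma real_poly_approximation:
  fixes g :: "real \<Rightarrow> real"
  assumes "continuous_on {0..1} g" "e > 0"
  obtains q where "\<And>x. x \<in> {0..1} \<Longrightarrow> \<bar>g x - poly q x\<bar> \<le> e"
proof -
  obtain r where r: "real_polynomial_function r" "\<And>x. x \<in> {0..1} \<Longrightarrow> \<bar>g x - r x\<bar> < e"
    by (rule Stone_Weierstrass_real_polynomial_function[OF compact_Icc assms]) blast
  then obtain a n where "r = (\<lambda>x. \<Sum>i\<le>n. a i * x ^ i)"
    unfolding real_polynomial_function_iff_sum by blast
  then have eq: "poly (\<Sum>i\<le>n. monom (a i) i) x = r x" for x
    by (simp add: poly_sum poly_monom)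
  show ?thesis
    by (rule that[of "\<Sum>i\<le>n. monom (a i) i"]) (unfold eq, rule less_imp_le[OF r(2)])
qed

text \<open>The second derivative \<open>c\<close> is approximated by a polynomial times a cutoff. An affine correction
  of the polynomial makes the moments of order 0 and 1 vanish, which is what the double primitive
  needs to have compact support.\<close>

lemma H2_approximation:
  fixes a b c :: "real \<Rightarrow> real"
  assumes ab: "\<And>x. x \<in> {0..1} \<Longrightarrow> (a has_real_derivative b x) (at x within {0..1})"
    and bc: "\<And>x. x \<in> {0..1} \<Longrightarrow> (b has_real_derivative c x) (at x within {0..1})"
    and c: "continuous_on {0..1} c"
    and bdry: "a 0 = 0" "a 1 = 0" "b 0 = 0" "b 1 = 0"
    and r: "r > 0"
  obtains p where "p \<in> test_functions"
    "(LINT x|leb01. (a x - p x)\<^sup>2) + (LINT x|leb01. (b x - deriv p x)\<^sup>2)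
      + (LINT x|leb01. (c x - deriv (deriv p) x)\<^sup>2) < r"
proof -
  let ?I = "integral {0..1::real}"
  have ca: "continuous_on {0..1} a" and cb: "continuous_on {0..1} b"
    using ab bc by (meson DERIV_continuous continuous_on_eq_continuous_within)+
  obtain K where K: "\<And>x. x \<in> {0..1} \<Longrightarrow> \<bar>c x\<bar> \<le> K"
    using continuous_bounded01[OF c] by blast
  have K0: "K \<ge> 0" using K[of 0] by force
  define W where "W = 4 * 162\<^sup>2 + 2 * K"
  define e where "e = min 1 (r / (W + 1))"
  have W0: "W \<ge> 0" using K0 by (simp add: W_def)
  have e: "0 < e" "e \<le> 1" using r W0 by (auto simp: e_def)
  have We: "W * e < r"
  proof -
    have "W * e < (W + 1) * e" using e by (simp add: distrib_right)
    also have "\<dots> \<le> (W + 1) * (r / (W + 1))" using W0 by (intro mult_left_mono) (auto simp: e_def)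
    also have "\<dots> = r" using W0 by simp
    finally show ?thesis .
  qed
  obtain q where q: "\<And>x. x \<in> {0..1} \<Longrightarrow> \<bar>c x - poly q x\<bar> \<le> e"
    using real_poly_approximation[OF c e(1)] by blast
  have cq: "continuous_on S (poly q)" for S by (intro continuous_intros)
  \<comment> \<open>The bound 1/100 is what \<open>moment_correction\<close> asks for;
    \<open>e / (K + 1)\<close> yields \<open>K * s \<le> e\<close>.\<close>
  obtain d where d: "0 < d" "d < 1 / 2" "(LINT x|leb01. 1 - cutoff d x) < min (1 / 100) (e / (K + 1))"
    using cutoff_mass[of "min (1 / 100) (e / (K + 1))"] e K0 by auto
  let ?\<eta> = "cutoff d"
  have c\<eta>: "continuous_on S ?\<eta>" for S using d by (intro cutoff_continuous)
  have \<eta>: "0 \<le> ?\<eta> x" "?\<eta> x \<le> 1" for x using cutoff_range[OF d(1), of x] by auto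
  define s where "s = ?I (\<lambda>x. 1 - ?\<eta> x)"
  have s: "s < 1 / 100" "s < e / (K + 1)"
  proof -
    have "(LINT x|leb01. 1 - ?\<eta> x) = s"
      unfolding s_def by (intro leb01_integral_continuous continuous_intros c\<eta>)
    then show "s < 1 / 100" "s < e / (K + 1)" using d(3) by simp_all
  qed
  have s0: "s \<ge> 0" unfolding s_def
    by (intro integral_nonneg integrable_continuous_real continuous_intros c\<eta>) (simp add: \<eta>)
  have Ks: "K * s \<le> e"
  proof -
    have "K * s \<le> (K + 1) * (e / (K + 1))" using s s0 K0 by (intro mult_mono) auto
    then show ?thesis using K0 by simp
  qed
  \<comment> \<open>Several majorants below have this shape; constants are the case
    \<open>z = 0\<close>.\<close>
  have Is: "?I (\<lambda>x. y + z * (1 - ?\<eta> x)) = y + z * s" for y z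
  proof -
    have "((\<lambda>x. y + z * (1 - ?\<eta> x)) has_integral (y * (1 - 0) + z * s)) {0..1}"
      unfolding s_def
      by (intro has_integral_add has_integral_mult_right integrable_integral
          integrable_continuous_real continuous_intros c\<eta>)
        (use has_integral_const_real[of y 0 1] in simp)
    then show ?thesis by (simp add: integral_unique)
  qed
  have near: "\<bar>poly q x * ?\<eta> x - c x\<bar> \<le> e + K * (1 - ?\<eta> x)" if x: "x \<in> {0..1}" for x
  proof -
    have "poly q x * ?\<eta> x - c x = - ((c x - poly q x) * ?\<eta> x) - c x * (1 - ?\<eta> x)"
      by (simp add: algebra_simps)
    moreover have "\<bar>(c x - poly q x) * ?\<eta> x\<bar> \<le> e * 1"
      unfolding abs_mult using q[OF x] \<eta>[of x] e by (intro mult_mono) auto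
    moreover have "\<bar>c x * (1 - ?\<eta> x)\<bar> \<le> K * (1 - ?\<eta> x)"
      unfolding abs_mult using K[OF x] \<eta>[of x] by (intro mult_mono) auto
    ultimately show ?thesis by linarith
  qed
  \<comment> \<open>Used with \<open>y = 1\<close> and \<open>y = x\<close>, for which the boundary
    conditions make the moment of \<open>c\<close> vanish. The moment of the approximation is then
    at most its L^1 distance to \<open>c\<close>.\<close>
  have moment: "\<bar>?I (\<lambda>x. y x * (poly q x * ?\<eta> x))\<bar> \<le> 2 * e"
    if y: "continuous_on {0..1} y" "\<And>x. x \<in> {0..1} \<Longrightarrow> \<bar>y x\<bar> \<le> 1" "?I (\<lambda>x. y x * c x) = 0" for y
  proof -
    have "?I (\<lambda>x. y x * (poly q x * ?\<eta> x - c x))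
      = ?I (\<lambda>x. y x * (poly q x * ?\<eta> x) - y x * c x)" by (simp add: right_diff_distrib)
    also have "\<dots> = ?I (\<lambda>x. y x * (poly q x * ?\<eta> x)) - ?I (\<lambda>x. y x * c x)"
      by (intro integral_diff integrable_continuous_real continuous_intros y c c\<eta> cq)
    finally have "?I (\<lambda>x. y x * (poly q x * ?\<eta> x)) = ?I (\<lambda>x. y x * (poly q x * ?\<eta> x - c x))"
      using y(3) by simp
    also have "norm \<dots> \<le> ?I (\<lambda>x. e + K * (1 - ?\<eta> x))"
    proof (intro Henstock_Kurzweil_Integration.integral_norm_bound_integral
        integrable_continuous_real continuous_intros y c c\<eta> cq)
      fix x :: real assume x: "x \<in> {0..1}"
      have "\<bar>y x * (poly q x * ?\<eta> x - c x)\<bar> \<le> 1 * (e + K * (1 - ?\<eta> x))"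
        unfolding abs_mult using y(2)[OF x] near[OF x] by (intro mult_mono) auto
      then show "norm (y x * (poly q x * ?\<eta> x - c x)) \<le> e + K * (1 - ?\<eta> x)" by simp
    qed
    also have "\<dots> \<le> 2 * e" unfolding Is using Ks by simp
    finally show ?thesis by simp
  qed
  have ftc: "?I g = w 1 - w 0"
    if "\<And>x. x \<in> {0..1} \<Longrightarrow> (w has_real_derivative g x) (at x within {0..1})" for w g
    using fundamental_theorem_of_calculus[of 0 1 w g] that
    by (simp add: has_real_derivative_iff_has_vector_derivative integral_unique)
  have Ic: "?I c = 0" using ftc[OF bc] bdry by simp
  have Ib: "?I b = 0" using ftc[OF ab] bdry by simp
  have "?I (\<lambda>x. b x + x * c x) = 1 * b 1 - 0 * b 0"
  proof (rule ftc[of "\<lambda>x. x * b x"])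
    fix x :: real assume "x \<in> {0..1}"
    from DERIV_mult[OF DERIV_ident bc[OF this]]
    show "((\<lambda>x. x * b x) has_real_derivative b x + x * c x) (at x within {0..1})"
      by (simp add: mult.commute)
  qed
  moreover have "?I (\<lambda>x. b x + x * c x) = ?I b + ?I (\<lambda>x. x * c x)"
    by (intro integral_add integrable_continuous_real continuous_intros cb c)
  ultimately have Ixc: "?I (\<lambda>x. x * c x) = 0" using bdry Ib by simp
  have T: "\<bar>?I (\<lambda>x. poly q x * ?\<eta> x)\<bar> \<le> 2 * e" "\<bar>?I (\<lambda>x. x * (poly q x * ?\<eta> x))\<bar> \<le> 2 * e"
    using moment[of "\<lambda>_. 1"] moment[of "\<lambda>x. x"] Ic Ixc by auto
  obtain \<alpha> \<beta> where \<alpha>\<beta>: "\<bar>\<alpha>\<bar> \<le> 40 * (2 * e)" "\<bar>\<beta>\<bar> \<le> 40 * (2 * e)"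
    "?I (\<lambda>x. (poly q x + (\<alpha> + \<beta> * x)) * ?\<eta> x) = 0"
    "?I (\<lambda>x. x * ((poly q x + (\<alpha> + \<beta> * x)) * ?\<eta> x)) = 0"
    using moment_correction[OF c\<eta> _ cq _ T] \<eta> s(1) unfolding s_def by auto
  define F where "F = bump d (cut d) 0 (q + [:\<alpha>, \<beta>:])"
  have F: "F = (\<lambda>x. (poly q x + (\<alpha> + \<beta> * x)) * ?\<eta> x)"
    by (simp add: F_def bump_cutoff fun_eq_iff mult.commute)
  have smooth: "(deriv ^^ k) F differentiable (at x)" for k x
    unfolding F_def by (rule bump_smooth[OF d(1)])
  have Fz: "F x = 0" if "x \<notin> {d..1 - d}" for x
    using cutoff_outside[OF d(1,2) that] by (simp add: F)
  have cF: "continuous_on S F" for S unfolding F by (intro continuous_intros cq c\<eta>)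
  have "1 - d < 1" using d by simp
  obtain p p' where p: "p \<in> test_functions" "deriv p = p'" "deriv p' = F"
    "\<And>x. (p has_real_derivative p' x) (at x)" "\<And>x. (p' has_real_derivative F x) (at x)"
    "p 0 = 0" "p' 0 = 0"
    using test_function_from_second_derivative[OF smooth d(1) \<open>1 - d < 1\<close> Fz] \<alpha>\<beta>(3,4)
    unfolding F by blast
  have cp: "continuous_on S p" "continuous_on S p'" for S
    using p(4,5) by (meson DERIV_isCont continuous_at_imp_continuous_on)+
  \<comment> \<open>161 = 1 + 80 + 80: the polynomial approximation and the two correction
    coefficients, each at most \<open>40 * (2 * e)\<close>.\<close>
  have diff: "\<bar>c x - F x\<bar> \<le> 161 * e + K * (1 - ?\<eta> x)" if x: "x \<in> {0..1}" for x
  proof -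
    have "\<bar>\<beta> * x\<bar> \<le> 40 * (2 * e) * 1" unfolding abs_mult using \<alpha>\<beta>(2) x by (intro mult_mono) auto
    then have ab: "\<bar>\<alpha> + \<beta> * x\<bar> \<le> 160 * e" using \<alpha>\<beta>(1) by linarith
    have "\<bar>(\<alpha> + \<beta> * x) * ?\<eta> x\<bar> \<le> 160 * e * 1"
      unfolding abs_mult using ab \<eta>[of x] e by (intro mult_mono) auto
    moreover have "c x - F x = - (poly q x * ?\<eta> x - c x) - (\<alpha> + \<beta> * x) * ?\<eta> x"
      unfolding F by (simp add: algebra_simps)
    ultimately show ?thesis using near[OF x] by linarith
  qed
  define J where "J = ?I (\<lambda>x. \<bar>c x - F x\<bar>)"
  \<comment> \<open>The integrated cutoff defect \<open>K * s \<le> e\<close> raises 161 to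
    162.\<close>
  have J: "J \<le> 162 * e"
  proof -
    have "J \<le> ?I (\<lambda>x. 161 * e + K * (1 - ?\<eta> x))" unfolding J_def
      by (intro integral_le integrable_continuous_real continuous_intros c cF c\<eta> diff)
    then show ?thesis unfolding Is using Ks by simp
  qed
  have J0: "J \<ge> 0" unfolding J_def
    by (intro integral_nonneg integrable_continuous_real continuous_intros c cF) simp
  have bp: "\<bar>b x - p' x\<bar> \<le> J" if "x \<in> {0..1}" for x
    unfolding J_def
  proof (rule primitive_abs_le[OF _ _ _ that])
    show "((\<lambda>x. b x - p' x) has_real_derivative c y - F y) (at y within {0..1})" if "y \<in> {0..1}" for y
      by (intro DERIV_diff bc that has_field_derivative_at_within[OF p(5)])
    show "continuous_on {0..1} (\<lambda>y. c y - F y)" by (intro continuous_intros c cF)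
  qed (simp add: bdry p(7))
  have ap: "\<bar>a x - p x\<bar> \<le> J" if x: "x \<in> {0..1}" for x
  proof -
    have "\<bar>a x - p x\<bar> \<le> ?I (\<lambda>x. \<bar>b x - p' x\<bar>)"
    proof (rule primitive_abs_le[OF _ _ _ x])
      show "((\<lambda>x. a x - p x) has_real_derivative b y - p' y) (at y within {0..1})" if "y \<in> {0..1}" for y
        by (intro DERIV_diff ab that has_field_derivative_at_within[OF p(4)])
      show "continuous_on {0..1} (\<lambda>y. b y - p' y)" by (intro continuous_intros cb cp)
    qed (simp add: bdry p(6))
    also have "\<dots> \<le> ?I (\<lambda>x. J + 0 * (1 - ?\<eta> x))"
      by (intro integral_le integrable_continuous_real continuous_intros cb cp c\<eta>) (use bp in auto)
    finally show ?thesis unfolding Is by simp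
  qed
  have sq: "(LINT x|leb01. (g x)\<^sup>2) \<le> (162 * e)\<^sup>2"
    if g: "continuous_on {0..1} g" "\<And>x. x \<in> {0..1} \<Longrightarrow> \<bar>g x\<bar> \<le> J" for g
  proof -
    have "(LINT x|leb01. (g x)\<^sup>2) = ?I (\<lambda>x. (g x)\<^sup>2)"
      by (intro leb01_integral_continuous continuous_intros g)
    also have "\<dots> \<le> ?I (\<lambda>x. (162 * e)\<^sup>2 + 0 * (1 - ?\<eta> x))"
    proof (intro integral_le integrable_continuous_real continuous_intros g c\<eta>)
      fix x :: real assume "x \<in> {0..1}"
      then have "\<bar>g x\<bar> \<le> \<bar>162 * e\<bar>" using g(2)[of x] J e by simp
      then show "(g x)\<^sup>2 \<le> (162 * e)\<^sup>2 + 0 * (1 - ?\<eta> x)" by (simp add: abs_le_square_iff)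
    qed
    finally show ?thesis unfolding Is by simp
  qed
  have 1: "(LINT x|leb01. (a x - p x)\<^sup>2) \<le> (162 * e)\<^sup>2"
    by (intro sq continuous_intros ca cp ap)
  have 2: "(LINT x|leb01. (b x - p' x)\<^sup>2) \<le> (162 * e)\<^sup>2"
    by (intro sq continuous_intros cb cp bp)
  have 3: "(LINT x|leb01. (c x - F x)\<^sup>2) \<le> 2 * (162 * e)\<^sup>2 + 2 * K * e"
  proof -
    have "(LINT x|leb01. (c x - F x)\<^sup>2) = ?I (\<lambda>x. (c x - F x)\<^sup>2)"
      by (intro leb01_integral_continuous continuous_intros c cF)
    also have "\<dots> \<le> ?I (\<lambda>x. 2 * (161 * e)\<^sup>2 + 2 * K\<^sup>2 * (1 - ?\<eta> x))"
    proof (intro integral_le integrable_continuous_real continuous_intros c cF c\<eta>)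
      fix x :: real assume x: "x \<in> {0..1}"
      let ?t = "1 - ?\<eta> x"
      have t: "0 \<le> ?t" "?t \<le> 1" using \<eta>[of x] by auto
      have "0 \<le> 161 * e + K * ?t" using t e K0 by simp
      then have "(c x - F x)\<^sup>2 \<le> (161 * e + K * ?t)\<^sup>2"
        using diff[OF x] by (simp add: abs_le_square_iff[symmetric])
      also have "\<dots> \<le> 2 * (161 * e)\<^sup>2 + 2 * (K * ?t)\<^sup>2"
        using zero_le_power2[of "161 * e - K * ?t"] by (simp only: power2_sum power2_diff)
      \<comment> \<open>Bounding \<open>?t^2\<close> by \<open>?t\<close> keeps the majorant linear
        in the cutoff defect, whose integral is \<open>s\<close>.\<close>
      also have "(K * ?t)\<^sup>2 \<le> K\<^sup>2 * ?t"
        unfolding power_mult_distrib using t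
        by (intro mult_left_mono) (simp_all add: power2_eq_square mult_left_le)
      finally show "(c x - F x)\<^sup>2 \<le> 2 * (161 * e)\<^sup>2 + 2 * K\<^sup>2 * ?t" by simp
    qed
    also have "\<dots> = 2 * (161 * e)\<^sup>2 + 2 * K * (K * s)"
      unfolding Is by (simp add: power2_eq_square)
    also have "\<dots> \<le> 2 * (162 * e)\<^sup>2 + 2 * K * e"
      using Ks K0 e by (intro add_mono mult_left_mono power_mono) auto
    finally show ?thesis .
  qed
  have "e\<^sup>2 \<le> e" using e by (simp add: power2_eq_square mult_left_le)
  then have "4 * (162 * e)\<^sup>2 + 2 * K * e \<le> W * e"
    by (simp add: W_def power_mult_distrib distrib_right)
  then show ?thesis
    using 1 2 3 We p(1) by (intro that[of p]) (auto simp: p(2,3))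
qed

lemma sobolev0_2_classical:
  fixes a b c :: "real \<Rightarrow> real"
  assumes ab: "\<And>x. x \<in> {0..1} \<Longrightarrow> (a has_real_derivative b x) (at x within {0..1})"
    and bc: "\<And>x. x \<in> {0..1} \<Longrightarrow> (b has_real_derivative c x) (at x within {0..1})"
    and c: "continuous_on {0..1} c"
    and bdry: "a 0 = 0" "a 1 = 0" "b 0 = 0" "b 1 = 0"
  shows "a \<in> sobolev0 2"
proof -
  let ?w = "(!) [a, b, c]"
  have ca: "continuous_on {0..1} a" and cb: "continuous_on {0..1} b"
    using ab bc by (meson DERIV_continuous continuous_on_eq_continuous_within)+
  have w: "(?w i has_real_derivative ?w (Suc i) x) (at x within {0..1})"
    if "i < 2" "x \<in> {0..1}" for i x
  proof -
    have "i = 0 \<or> i = 1" using that by linarith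
    then show ?thesis using ab[OF that(2)] bc[OF that(2)] by auto
  qed
  have cw: "continuous_on {0..1} (?w i)" if "i \<le> 2" for i
  proof -
    have "i = 0 \<or> i = 1 \<or> i = 2" using that by linarith
    then show ?thesis using ca cb c by auto
  qed
  have "a \<in> sobolev 2" using sobolev_classical[of 2 ?w, OF w cw] by simp
  moreover have "?w i \<in> L2_01 \<and> weak_deriv i a (?w i)" if "i \<le> 2" for i
    using weak_deriv_classical[of 2 ?w, OF w cw that] continuous_L2_01[OF cw[OF that]] by simp
  moreover have "\<exists>p\<in>test_functions. sqrt (\<Sum>i\<le>2. LINT x|leb01. (?w i x - (deriv ^^ i) p x)\<^sup>2) < e"
    if "e > 0" for e
  proof -
    \<comment> \<open>The tolerance is squared because \<open>sobolev0\<close> takes the root of the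
      sum.\<close>
    have "e\<^sup>2 > 0" using that by simp
    obtain p where p: "p \<in> test_functions"
      "(LINT x|leb01. (a x - p x)\<^sup>2) + (LINT x|leb01. (b x - deriv p x)\<^sup>2)
        + (LINT x|leb01. (c x - deriv (deriv p) x)\<^sup>2) < e\<^sup>2"
      using H2_approximation[OF ab bc c bdry \<open>e\<^sup>2 > 0\<close>] .
    have "{..2::nat} = {0, 1, 2}" by auto
    then have "(\<Sum>i\<le>2. LINT x|leb01. (?w i x - (deriv ^^ i) p x)\<^sup>2) < e\<^sup>2"
      using p(2) by (simp add: eval_nat_numeral add.assoc)
    then have "sqrt (\<Sum>i\<le>2. LINT x|leb01. (?w i x - (deriv ^^ i) p x)\<^sup>2) < sqrt (e\<^sup>2)"
      by (rule real_sqrt_less_mono)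
    then show ?thesis using p(1) that by (intro bexI[of _ p]) auto
  qed
  ultimately show ?thesis unfolding sobolev0_def by blast
qed

section \<open>The convergence theorem\<close>

theorem theorem5p2:
  fixes A B D H f :: "real \<Rightarrow> real"
    and N :: "nat \<Rightarrow> nat"
    and g :: "nat \<Rightarrow> nat \<Rightarrow> real"
  assumes "A \<in> C01 1"
    and "B \<in> C01 0" and "D \<in> C01 0" and "H \<in> C01 0"
    and "f \<in> C01 0"
    and "\<not> is_eigenvalue_L_cont A B D H 0"
    and "\<forall>k. 0 < N k" and "strict_mono N"
    and "\<forall>k. uniquely_solvable_mesh A D (N k)"
    and "\<forall>k. g k \<in> l2h0 (N k)"
    and "\<forall>k. hermite_deriv (N k) (g k) \<in> l2h0 (N k)"
    and "\<forall>k. \<forall>i\<in>{1..N k - 1}.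
           delta_x4 (N k) (g k) i
           + D (node (N k) i) * delta_x3 (N k) A D f (g k) i
           + A (node (N k) i) * delta_x2_tilde (N k) A D f (g k) i
           + (deriv01 A (node (N k) i) + H (node (N k) i)) * hermite_deriv (N k) (g k) i
           + B (node (N k) i) * g k i
           = f (node (N k) i)"
    and "\<forall>k. hermite_deriv (N k) (delta_x4 (N k) (g k)) \<in> l2h0 (N k)"
    and "bdd_above (range (\<lambda>k. norm_h (N k) (delta_x4 (N k) (g k))))"
  shows "\<exists>g_lim v_lim.
           continuous_on {0..1} g_lim \<and>
           uniform_limit {0..1} (\<lambda>k. piecewise_linear (N k) (g k)) g_lim sequentially \<and>
           weakly_converges_L2 (\<lambda>k. piecewise_linear (N k) (delta_x4 (N k) (g k))) v_lim \<and>
           g_lim \<in> sobolev 4 \<inter> sobolev0 2 \<and>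
           g_lim \<in> C01 4 \<and>
           (\<forall>x\<in>{0..1}. L_cont A B D H g_lim x = f x)"
proof -
  have "continuous_on {0..1} A" "continuous_on {0..1} (deriv01 A)"
    using \<open>A \<in> C01 1\<close> unfolding C01_def by (auto dest: spec[of _ "0::nat"] spec[of _ "1::nat"])
  then have cont: "continuous_on {0..1} A" "continuous_on {0..1} B" "continuous_on {0..1} D"
    "continuous_on {0..1} (\<lambda>x. deriv01 A x + H x)" "continuous_on {0..1} f"
    using assms(2-5) by (auto simp: C01_0 intro!: continuous_intros)
  obtain C where C: "\<And>k. norm_h (N k) (delta_x4 (N k) (g k)) \<le> C"
    using assms(14) by (auto simp: bdd_above_def)
  obtain Q1 where Q1: "\<And>x. x \<in> {0..1} \<Longrightarrow> \<bar>A x\<bar> \<le> Q1"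
    using continuous_bounded01[OF cont(1)] by blast
  obtain Q2 where Q2: "\<And>x. x \<in> {0..1} \<Longrightarrow> \<bar>B x\<bar> \<le> Q2"
    using continuous_bounded01[OF cont(2)] by blast
  obtain Q3 where Q3: "\<And>x. x \<in> {0..1} \<Longrightarrow> \<bar>D x\<bar> \<le> Q3"
    using continuous_bounded01[OF cont(3)] by blast
  obtain Q4 where Q4: "\<And>x. x \<in> {0..1} \<Longrightarrow> \<bar>deriv01 A x + H x\<bar> \<le> Q4"
    using continuous_bounded01[OF cont(4)] by blast
  obtain Q5 where Q5: "\<And>x. x \<in> {0..1} \<Longrightarrow> \<bar>f x\<bar> \<le> Q5"
    using continuous_bounded01[OF cont(5)] by blast
  define Q where "Q = Max {Q1, Q2, Q3, Q4, Q5}"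
  have Q: "Q1 \<le> Q" "Q2 \<le> Q" "Q3 \<le> Q" "Q4 \<le> Q" "Q5 \<le> Q" by (simp_all add: Q_def)
  have sol: "bounded_solution A B D H f C Q (N k) (g k)" for k
  proof (rule bounded_solution.intro)
    show "4 \<le> N k" using assms(9) by (simp add: uniquely_solvable_mesh_def)
  qed (use assms(10,12) in \<open>blast intro: C order_trans[OF Q1 Q(1)] order_trans[OF Q2 Q(2)]
      order_trans[OF Q3 Q(3)] order_trans[OF Q4 Q(4)] order_trans[OF Q5 Q(5)]\<close>)+
  interpret bounded_solution_sequence A B D H f C Q N g
    by (rule bounded_solution_sequence.intro) (fact sol assms(8) cont)+
  obtain a b c d where sol: "bvp_solution A B D H f a b c d"
    and lim: "uniform_limit {0..1} Y (\<lambda>x. (a x, b x, c x, d x)) sequentially"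
    using whole_sequence_converges[OF assms(6)] by blast
  let ?w = "(!) [a, b, c, d, bvp_rhs A B D H f a b c d]"
  note w = bvp_solution_derivs[OF sol]
  have cw: "continuous_on {0..1} (?w i)" if "i \<le> 4" for i
  proof (cases "i < 4")
    case True
    then show ?thesis
      using w[of i] by (meson DERIV_continuous continuous_on_eq_continuous_within)
  next
    case False
    then have "?w i = bvp_rhs A B D H f a b c d" using that by simp
    moreover have "continuous_on {0..1} (bvp_rhs A B D H f a b c d)"
      unfolding bvp_rhs_def by (intro continuous_intros cont bvp_solution_continuous[OF sol])
    ultimately show ?thesis by simp
  qed
  have "a \<in> sobolev 4" using sobolev_classical[of 4 ?w, OF w cw] by simp
  moreover have "a \<in> sobolev0 2"
    by (rule sobolev0_2_classical[of a b c])
      (use sol bvp_solution_continuous[OF sol] in \<open>auto simp: bvp_solution_def\<close>)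
  ultimately show ?thesis
    using bvp_solution_continuous(1)[OF sol] component_limits(1)[OF lim] weak_limit_delta_x4[OF lim]
      bvp_solution_classical(1,2)[OF sol cont] by blast
qed

end
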